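(* Let $T>0$, $n,d\ge 1$, let $W=(W^1,\dots,W^d)$ be a standard $d$-dimensional Brownian motion and $\eta=(\eta_k)_{k\ge1}$ a sequence of i.i.d. Rademacher random variables ($\mathbb P(\eta_k=1)=\mathbb P(\eta_k=-1)=1/2$) independent of $W$. Let $\sigma^0,\sigma^1,\dots,\sigma^d:\mathbb R^n\to\mathbb R^n$ satisfy: (i) $\sigma^0\in\mathcal C^1(\mathbb R^n,\mathbb R^n)$ is Lipschitz continuous and its first order derivatives are locally Lipschitz with polynomially growing Lipschitz constants; (ii) for every $j\in\{1,\dots,d\}$, $\sigma^j\in\mathcal C^5(\mathbb R^n,\mathbb R^n)$ is Lipschitz continuous, its derivatives of order $5$ are locally Lipschitz with polynomially growing Lipschitz constants, and $\sigma^j$ satisfies: there exists $C_{\sigma^j}>0$ such that for all $(\theta,x,y,z,w)\in\mathbb R\times(\mathbb R^n)^4$, $$\|\sigma^j(x+\theta\sigma^j(z))+\sigma^j(y)-\sigma^j(x)-\sigma^j(y+\theta\sigma^j(w))\|\le C_{\sigma^j}|\theta|\big(\|x-y\|+(1+|\theta|)\|z-w\|\big);$$ (iii) for every $j\in\{1,\dots,d\}$, $\partial\sigma^j\sigma^j$ is Lipschitz continuous. For $N\in\mathbb N^*$ let $h=T/N$, $t_k=kh$ and $\Delta W^j_{t_{k+1}}=W^j_{t_{k+1}}-W^j_{t_k}$. Let $X^{NV,\eta}$ be the Ninomiya–Victoir scheme started at $x_0\in\mathbb R^n$: $X^{NV,\eta}_{t_0}=x_0$ and for $k\in\{0,\dots,N-1\}$,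 $X^{NV,\eta}_{t_{k+1}}=\exp(\tfrac h2\sigma^0)\exp(\Delta W^d_{t_{k+1}}\sigma^d)\cdots\exp(\Delta W^1_{t_{k+1}}\sigma^1)\exp(\tfrac h2\sigma^0)X^{NV,\eta}_{t_k}$ if $\eta_{k+1}=1$, and $X^{NV,\eta}_{t_{k+1}}=\exp(\tfrac h2\sigma^0)\exp(\Delta W^1_{t_{k+1}}\sigma^1)\cdots\exp(\Delta W^d_{t_{k+1}}\sigma^d)\exp(\tfrac h2\sigma^0)X^{NV,\eta}_{t_k}$ if $\eta_{k+1}=-1$. Let $\hat X^{NV,\eta}$ be the scheme obtained by replacing each exact flow by a Runge–Kutta step: $\hat X^{NV,\eta}_{t_0}=x_0$ and for $k\in\{0,\dots,N-1\}$, $\hat X^{NV,\eta}_{t_{k+\frac1{d+2}}}=\Psi_2^{\sigma^0}(\tfrac h2,\hat X^{NV,\eta}_{t_k})$, for $j\in\{1,\dots,d\}$, $$\hat X^{NV,\eta}_{t_{k+\frac{j+1}{d+2}}}=\mathbf 1_{\{\eta_{k+1}=1\}}\Psi_4^{\sigma^j}\big(\Delta W^j_{t_{k+1}},\hat X^{NV,\eta}_{t_{k+\frac{j}{d+2}}}\big)+\mathbf 1_{\{\eta_{k+1}=-1\}}\Psi_4^{\sigma^{d+1-j}}\big(\Delta W^{d+1-j}_{t_{k+1}},\hat X^{NV,\eta}_{t_{k+\frac{j}{d+2}}}\big),$$ and $\hat X^{NV,\eta}_{t_{k+1}}=\Psi_2^{\sigma^0}(\tfrac h2,\hat X^{NV,\eta}_{t_{k+\frac{d+1}{d+2}}})$.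 Then for every $p\ge1$ there exist $\hat C_{NV}>0$ and $q\in\mathbb N^*$ such that for all $N\in\mathbb N^*$ and all $x_0\in\mathbb R^n$, $$\mathbb E\Big[\max_{0\le k\le N}\big\|X^{NV,\eta}_{t_k}-\hat X^{NV,\eta}_{t_k}\big\|^{2p}\Big]\le\frac{\hat C_{NV}}{N^{4p}}\big(1+\|x_0\|^{2q}\big).$$
   Context: For a Lipschitz $V:\mathbb R^n\to\mathbb R^n$, $\exp(tV)x$ denotes the value at time $t\in\mathbb R$ of the solution of the ODE $\dot x(t)=V(x(t))$, $x(0)=x$. $\partial V$ is the Jacobian matrix of $V$ and $\partial V V$ denotes $x\mapsto\partial V(x)V(x)$. Runge–Kutta maps: $\Psi_2^V(\theta,x)=x+\frac\theta2V(x)+\frac\theta2V(x+\theta V(x))$ and $\Psi_4^V(\theta,x)=x+\frac\theta6\Big(V(x)+2V\big(x+\tfrac\theta2V(x)\big)+2V\big(x+\tfrac\theta2V(x+\tfrac\theta2V(x))\big)+V\big(x+\theta V(x+\tfrac\theta2V(x+\tfrac\theta2V(x)))\big)\Big)$. A function $g$ is "locally Lipschitz with polynomially growing Lipschitz constant" if there exist $C>0$, $q\in\mathbb N$ with $\|g(x)-g(y)\|\le C(1+\|x\|^q+\|y\|^q)\|x-y\|$ for all $x,y$. *)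

theory Defs
  imports "HOL-Analysis.Analysis" "HOL-Probability.Probability"
begin

definition poly_lip :: "('a::real_normed_vector \<Rightarrow> 'b::real_normed_vector) \<Rightarrow> bool" where
  "poly_lip g \<longleftrightarrow> (\<exists>C>0. \<exists>q::nat. \<forall>x y.
      norm (g x - g y) \<le> C * (1 + norm x ^ q + norm y ^ q) * norm (x - y))"

fun dk :: "('a::real_normed_vector \<Rightarrow> 'b::real_normed_vector) \<Rightarrow> 'a list \<Rightarrow> 'a \<Rightarrow> 'b" where
  "dk f [] = f"
| "dk f (h # hs) = dk (\<lambda>x. frechet_derivative f (at x) h) hs"

fun Ck :: "nat \<Rightarrow> ('a::real_normed_vector \<Rightarrow> 'b::real_normed_vector) \<Rightarrow> bool" where
  "Ck 0 f = continuous_on UNIV f"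
| "Ck (Suc k) f = ((\<forall>x. f differentiable (at x)) \<and>
                    (\<forall>h. Ck k (\<lambda>x. frechet_derivative f (at x) h)))"

text \<open>The derivatives of order k (as k-linear maps) are locally Lipschitz with polynomially
  growing Lipschitz constant (w.r.t. the operator norm of multilinear maps).\<close>
definition deriv_poly_lip :: "nat \<Rightarrow> ('a::real_normed_vector \<Rightarrow> 'b::real_normed_vector) \<Rightarrow> bool" where
  "deriv_poly_lip k f \<longleftrightarrow> (\<exists>C>0. \<exists>q::nat. \<forall>hs x y. length hs = k \<longrightarrow>
      norm (dk f hs x - dk f hs y) \<le> C * (1 + norm x ^ q + norm y ^ q) * norm (x - y) * (\<Prod>h\<leftarrow>hs. norm h))"

definition lipschitz :: "('a::metric_space \<Rightarrow> 'b::metric_space) \<Rightarrow> bool" where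
  "lipschitz f \<longleftrightarrow> (\<exists>L. L-lipschitz_on UNIV f)"

definition flow :: "('a::real_normed_vector \<Rightarrow> 'a) \<Rightarrow> real \<Rightarrow> 'a \<Rightarrow> 'a" where
  "flow V t x = (THE y. \<exists>f. f 0 = x \<and> (\<forall>s. (f has_vector_derivative V (f s)) (at s)) \<and> f t = y)"

definition Psi2 :: "('a::real_normed_vector \<Rightarrow> 'a) \<Rightarrow> real \<Rightarrow> 'a \<Rightarrow> 'a" where
  "Psi2 V \<theta> x = x + (\<theta>/2) *\<^sub>R V x + (\<theta>/2) *\<^sub>R V (x + \<theta> *\<^sub>R V x)"

definition Psi4 :: "('a::real_normed_vector \<Rightarrow> 'a) \<Rightarrow> real \<Rightarrow> 'a \<Rightarrow> 'a" where
  "Psi4 V \<theta> x = x + (\<theta>/6) *\<^sub>R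
     (V x + 2 *\<^sub>R V (x + (\<theta>/2) *\<^sub>R V x)
          + 2 *\<^sub>R V (x + (\<theta>/2) *\<^sub>R V (x + (\<theta>/2) *\<^sub>R V x))
          + V (x + \<theta> *\<^sub>R V (x + (\<theta>/2) *\<^sub>R V (x + (\<theta>/2) *\<^sub>R V x))))"

text \<open>Independence of two random variables with possibly different codomains
  (same as prob_space.indep_var, cf. lemma prob_space.indep_var_eq, but heterogeneous).\<close>
definition indep_rv :: "'a measure \<Rightarrow> 'b measure \<Rightarrow> ('a \<Rightarrow> 'b) \<Rightarrow> 'c measure \<Rightarrow> ('a \<Rightarrow> 'c) \<Rightarrow> bool" where
  "indep_rv M S X T Y \<longleftrightarrow> X \<in> measurable M S \<and> Y \<in> measurable M T \<and>
     prob_space.indep_set M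
       (sigma_sets (space M) { X -` A \<inter> space M | A. A \<in> sets S})
       (sigma_sets (space M) { Y -` A \<inter> space M | A. A \<in> sets T})"

definition brownian_motion :: "'a measure \<Rightarrow> nat \<Rightarrow> (nat \<Rightarrow> real \<Rightarrow> 'a \<Rightarrow> real) \<Rightarrow> bool" where
  "brownian_motion M d W \<longleftrightarrow> prob_space M \<and>
     (\<forall>j\<in>{1..d}. \<forall>t\<ge>0. W j t \<in> borel_measurable M) \<and>
     (AE \<omega> in M. \<forall>j\<in>{1..d}. W j 0 \<omega> = 0 \<and> continuous_on {0..} (\<lambda>t. W j t \<omega>)) \<and>
     (\<forall>s t. 0 \<le> s \<and> s < t \<longrightarrow>
        (\<forall>j\<in>{1..d}. distributed M lborel (\<lambda>\<omega>. W j t \<omega> - W j s \<omega>) (normal_density 0 (sqrt (t - s)))) \<and>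
        prob_space.indep_vars M (\<lambda>_. borel) (\<lambda>j \<omega>. W j t \<omega> - W j s \<omega>) {1..d} \<and>
        indep_rv M
          (PiM {1..d} (\<lambda>_. PiM {0..s} (\<lambda>_. borel))) (\<lambda>\<omega>. \<lambda>j\<in>{1..d}. \<lambda>r\<in>{0..s}. W j r \<omega>)
          (PiM {1..d} (\<lambda>_. borel)) (\<lambda>\<omega>. \<lambda>j\<in>{1..d}. W j t \<omega> - W j s \<omega>))"

definition rademacher_seq :: "'a measure \<Rightarrow> (nat \<Rightarrow> 'a \<Rightarrow> real) \<Rightarrow> bool" where
  "rademacher_seq M \<eta> \<longleftrightarrow> prob_space M \<and>
     prob_space.indep_vars M (\<lambda>_. borel) \<eta> {1..} \<and>
     (\<forall>k\<ge>1. measure M {\<omega>\<in>space M. \<eta> k \<omega> = 1} = 1/2 \<and> measure M {\<omega>\<in>space M. \<eta> k \<omega> = -1} = 1/2)"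

definition dW :: "(nat \<Rightarrow> real \<Rightarrow> 'a \<Rightarrow> real) \<Rightarrow> real \<Rightarrow> nat \<Rightarrow> nat \<Rightarrow> nat \<Rightarrow> 'a \<Rightarrow> real" where
  "dW W T N k j \<omega> = W j (real (Suc k) * T / real N) \<omega> - W j (real k * T / real N) \<omega>"

definition nv_step :: "(nat \<Rightarrow> 'v::real_normed_vector \<Rightarrow> 'v) \<Rightarrow> nat \<Rightarrow> real \<Rightarrow> (nat \<Rightarrow> real) \<Rightarrow> real \<Rightarrow> 'v \<Rightarrow> 'v" where
  "nv_step \<sigma> d h dw e x =
     flow (\<sigma> 0) (h/2)
       (foldl (\<lambda>y j. flow (\<sigma> j) (dw j) y) (flow (\<sigma> 0) (h/2) x)
          (if e = 1 then [1..<d+1] else rev [1..<d+1]))"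

definition nv_hat_step :: "(nat \<Rightarrow> 'v::real_normed_vector \<Rightarrow> 'v) \<Rightarrow> nat \<Rightarrow> real \<Rightarrow> (nat \<Rightarrow> real) \<Rightarrow> real \<Rightarrow> 'v \<Rightarrow> 'v" where
  "nv_hat_step \<sigma> d h dw e x =
     Psi2 (\<sigma> 0) (h/2)
       (foldl (\<lambda>y j. of_bool (e = 1) *\<^sub>R Psi4 (\<sigma> j) (dw j) y
                    + of_bool (e = -1) *\<^sub>R Psi4 (\<sigma> (d+1-j)) (dw (d+1-j)) y)
          (Psi2 (\<sigma> 0) (h/2) x) [1..<d+1])"

primrec nv_scheme :: "(nat \<Rightarrow> 'v::real_normed_vector \<Rightarrow> 'v) \<Rightarrow> nat \<Rightarrow> real \<Rightarrow> nat \<Rightarrow>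
    (nat \<Rightarrow> real \<Rightarrow> 'a \<Rightarrow> real) \<Rightarrow> (nat \<Rightarrow> 'a \<Rightarrow> real) \<Rightarrow> 'v \<Rightarrow> 'a \<Rightarrow> nat \<Rightarrow> 'v" where
  "nv_scheme \<sigma> d T N W \<eta> x0 \<omega> 0 = x0"
| "nv_scheme \<sigma> d T N W \<eta> x0 \<omega> (Suc k) =
     nv_step \<sigma> d (T / real N) (\<lambda>j. dW W T N k j \<omega>) (\<eta> (Suc k) \<omega>) (nv_scheme \<sigma> d T N W \<eta> x0 \<omega> k)"

primrec nv_hat_scheme :: "(nat \<Rightarrow> 'v::real_normed_vector \<Rightarrow> 'v) \<Rightarrow> nat \<Rightarrow> real \<Rightarrow> nat \<Rightarrow>
    (nat \<Rightarrow> real \<Rightarrow> 'a \<Rightarrow> real) \<Rightarrow> (nat \<Rightarrow> 'a \<Rightarrow> real) \<Rightarrow> 'v \<Rightarrow> 'a \<Rightarrow> nat \<Rightarrow> 'v" where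
  "nv_hat_scheme \<sigma> d T N W \<eta> x0 \<omega> 0 = x0"
| "nv_hat_scheme \<sigma> d T N W \<eta> x0 \<omega> (Suc k) =
     nv_hat_step \<sigma> d (T / real N) (\<lambda>j. dW W T N k j \<omega>) (\<eta> (Suc k) \<omega>) (nv_hat_scheme \<sigma> d T N W \<eta> x0 \<omega> k)"

end

(* The joint state of the exact scheme y and the Runge-Kutta scheme z, together with the running maximum
   a of s = |y - z|^(2r), is a Markov chain once the signs eta are frozen. Along it the Lyapunov function
   a^2/2 - a s + s^2 + h^(8r) (1 + |z|^(2m)) grows in mean by a factor at most 1 + D h per substep, which
   yields the moment bound and Doob's maximal inequality at the same time. For this, an increment of y - z
   over a diffusion substep must have size sqrt h (|y - z| + h^2 g(z)), g of polynomial growth, with a mean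
   of size h (|y - z| + h^2 g(z)). The part proportional to |y - z| comes from the stability of the exact
   flow, whose second time derivative is Lipschitz; the other part is the local error at z, which for the
   fourth order method is theta^5 c(z) + O(theta^6), and the odd Gaussian moment of theta^5 vanishes. *)
theory Submission
  imports Defs
begin

section \<open>Flows of Lipschitz vector fields\<close>

text \<open>Where the rate comes from: the local error of a diffusion substep has size h^(5/2), but
  its mean is only of size h^3. Bounding it in norm and summing over N steps would leave h^(3/2);
  its centred part has to be added up like a martingale, which gives h^2. A drift substep has a
  local error of size h^3 and calls for no averaging. For this reason increments are kept as an
  exact odd polynomial in the Gaussian variable plus a remainder of size h. The local errors grow
  polynomially in z, so the moments of the approximate scheme have to be controlled together with
  the error. The weight h^(8r) = (h^2)^(4r) is the size of the source term in |y - z|^(4r), so that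
  this source is absorbed into D h times the Lyapunov function. At the start y = z, so the initial
  value is just h^(8r) (1 + |x0|^(2m)): it carries the whole rate. The signs decide the order of the
  substeps. The bound is uniform over frozen sign sequences, so Fubini removes the freezing. All
  powers are even integers, which keeps the expansions polynomial; a real p is reached at the very
  end by comparison with the power 4r, r being p rounded up.\<close>

lemma norm_diff_le_of_derivative:
  fixes g :: "real \<Rightarrow> 'b::real_normed_vector"
  assumes g: "\<And>s. (g has_vector_derivative g' s) (at s)"
    and B: "\<And>s. \<bar>s\<bar> \<le> \<bar>t\<bar> \<Longrightarrow> norm (g' s) \<le> B"
  shows "norm (g t - g 0) \<le> B * \<bar>t\<bar>"
proof -
  have "norm (g t - g 0) \<le> B * norm (t - 0)"
  proof (rule differentiable_bound[of "closed_segment 0 t" g "\<lambda>s h. h *\<^sub>R g' s"])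
    show "(g has_derivative (\<lambda>h. h *\<^sub>R g' s)) (at s within closed_segment 0 t)" for s
      using g[of s] unfolding has_vector_derivative_def by (rule has_derivative_at_withinI)
    show "onorm (\<lambda>h. h *\<^sub>R g' s) \<le> B" if "s \<in> closed_segment 0 t" for s
    proof -
      have "\<bar>s\<bar> \<le> \<bar>t\<bar>" using that by (auto simp: closed_segment_eq_real_ivl split: if_splits)
      then have "norm (g' s) \<le> B" by (rule B)
      then show ?thesis
        by (intro onorm_le) (auto simp: mult.commute[of B] intro: mult_left_mono)
    qed
  qed auto
  then show ?thesis by simp
qed

lemma has_vector_derivative_reflect:
  assumes "\<And>s. (g has_vector_derivative g' s) (at s)"
  shows "((\<lambda>s. g (- s)) has_vector_derivative - g' (- s)) (at s)"
proof -
  have "((g \<circ> uminus) has_vector_derivative (-1) *\<^sub>R g' (- s)) (at s)"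
    by (rule vector_diff_chain_at) (auto intro!: derivative_eq_intros assms)
  then show ?thesis by (simp add: o_def)
qed

text \<open>The squared norm is differentiable even where \<open>u\<close> vanishes, and
  Cauchy-Schwarz makes \<open>exp (- 2 L s) * (u s \<bullet> u s)\<close> nonincreasing. Negative
  times follow by reflecting time.\<close>

lemma gronwall_norm:
  fixes u :: "real \<Rightarrow> 'b::real_inner"
  assumes u: "\<And>s. (u has_vector_derivative u' s) (at s)"
    and b: "\<And>s. norm (u' s) \<le> L * norm (u s)"
  shows "norm (u t) \<le> exp (L * \<bar>t\<bar>) * norm (u 0)"
proof -
  have pos: "norm (v t) \<le> exp (L * t) * norm (v 0)"
    if "0 \<le> t" and v: "\<And>s. (v has_vector_derivative v' s) (at s)"
      and b: "\<And>s. norm (v' s) \<le> L * norm (v s)" for v v' :: "real \<Rightarrow> 'b" and t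
  proof -
    define D where "D s = exp (- (2 * L * s)) * (v s \<bullet> v s)" for s
    have D: "(D has_real_derivative
        exp (- (2 * L * s)) * (2 * (v s \<bullet> v' s) - 2 * L * (v s \<bullet> v s))) (at s)" for s
    proof -
      have "((\<lambda>s. v s \<bullet> v s) has_real_derivative v s \<bullet> v' s + v' s \<bullet> v s) (at s)"
        using has_derivative_inner[OF v[of s, unfolded has_vector_derivative_def]
            v[of s, unfolded has_vector_derivative_def]]
        by (simp add: has_field_derivative_def algebra_simps) (simp add: distrib_left[symmetric] mult.commute[of _ "_ + _"] add.commute)
      then show ?thesis unfolding D_def
        by (auto intro!: derivative_eq_intros simp: inner_commute algebra_simps)
    qed
    have "D t \<le> D 0"
    proof (rule DERIV_nonpos_imp_nonincreasing[OF \<open>0 \<le> t\<close>])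
      fix s
      have "v s \<bullet> v' s \<le> norm (v s) * norm (v' s)" by (rule norm_cauchy_schwarz)
      also have "\<dots> \<le> norm (v s) * (L * norm (v s))" by (intro mult_left_mono b) auto
      also have "\<dots> = L * (v s \<bullet> v s)" by (simp add: power2_norm_eq_inner[symmetric] power2_eq_square)
      finally have "2 * (v s \<bullet> v' s) - 2 * L * (v s \<bullet> v s) \<le> 0" by simp
      then have "exp (- (2 * L * s)) * (2 * (v s \<bullet> v' s) - 2 * L * (v s \<bullet> v s)) \<le> 0"
        by (intro mult_nonneg_nonpos) auto
      then show "\<exists>y. (D has_real_derivative y) (at s) \<and> y \<le> 0" using D by blast
    qed
    then have "(norm (v t))\<^sup>2 \<le> exp (2 * L * t) * (norm (v 0))\<^sup>2"
      by (simp add: D_def power2_norm_eq_inner exp_minus divide_simps split: if_splits) (simp add: mult_ac)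
    also have "\<dots> = (exp (L * t) * norm (v 0))\<^sup>2"
      by (simp add: power_mult_distrib exp_double[symmetric] mult_ac)
    finally show ?thesis by (rule power2_le_imp_le) auto
  qed
  show ?thesis
  proof (cases "0 \<le> t")
    case True
    then show ?thesis using pos[OF True u b] by simp
  next
    case False
    have "norm (u (- (- t))) \<le> exp (L * (- t)) * norm (u (- 0))"
      by (rule pos[OF _ has_vector_derivative_reflect[OF u]]) (use False b in auto)
    then show ?thesis using False by simp
  qed
qed

lemma ex_antiderivative_real:
  fixes g :: "real \<Rightarrow> 'a::euclidean_space"
  assumes "continuous_on UNIV g"
  shows "\<exists>F. F 0 = x \<and> (\<forall>t. (F has_vector_derivative g t) (at t))"
proof -
  obtain F where F: "\<And>t. (F has_vector_derivative g t) (at t)"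
    using einterval_antiderivative[of "-\<infinity>" "\<infinity>" g] assms
    by (auto simp: continuous_on_eq_continuous_at)
  show ?thesis
    by (rule exI[of _ "\<lambda>t. F t - F 0 + x"]) (auto intro!: derivative_eq_intros F)
qed

text \<open>Integration reproduces the weight \<open>exp (k |t|)\<close> and gains a factor 1/k.
  With k = 2 L this cancels the Lipschitz constant in the Picard iteration and leaves the
  contraction factor 1/2.\<close>

lemma norm_le_exp_of_derivative:
  fixes g :: "real \<Rightarrow> 'b::real_normed_vector"
  assumes g: "\<And>s. (g has_vector_derivative g' s) (at s)" and "g 0 = 0" "0 < k"
    and b: "\<And>s. norm (g' s) \<le> B * exp (k * \<bar>s\<bar>)"
  shows "norm (g t) \<le> B / k * exp (k * \<bar>t\<bar>)"
proof -
  have B: "0 \<le> B" using order_trans[OF norm_ge_zero b[of 0]] by simp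
  have pos: "norm (v t) \<le> B / k * exp (k * t)"
    if t: "0 \<le> t" and v: "\<And>s. (v has_vector_derivative v' s) (at s)" and v0: "v 0 = 0"
      and b: "\<And>s. norm (v' s) \<le> B * exp (k * \<bar>s\<bar>)" for v v' :: "real \<Rightarrow> 'b" and t
  proof (cases "t = 0")
    case True
    then show ?thesis using B v0 \<open>0 < k\<close> by simp
  next
    case False
    have "norm (v t - v 0) \<le> B / k * exp (k * t) - B / k * exp (k * 0)"
    proof (rule differentiable_bound_general[where f' = v' and \<phi>' = "\<lambda>s. B * exp (k * s)"])
      show "continuous_on {0..t} v"
        by (intro continuous_at_imp_continuous_on ballI) (use has_vector_derivative_continuous[OF v] in auto)
      show "norm (v' s) \<le> B * exp (k * s)" if "0 < s" "s < t" for s using b[of s] that by simp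
      show "((\<lambda>x. B / k * exp (k * x)) has_vector_derivative B * exp (k * s)) (at s)" for s
        unfolding has_real_derivative_iff_has_vector_derivative[symmetric]
        using \<open>0 < k\<close> by (auto intro!: derivative_eq_intros)
    qed (use t False v \<open>0 < k\<close> in \<open>auto intro!: continuous_intros\<close>)
    moreover have "0 \<le> B / k" using B \<open>0 < k\<close> by simp
    ultimately show ?thesis using v0 by simp
  qed
  show ?thesis
  proof (cases "0 \<le> t")
    case True
    then show ?thesis using pos[OF True g \<open>g 0 = 0\<close> b] by simp
  next
    case False
    have "norm (g (- (- t))) \<le> B / k * exp (k * (- t))"
      by (rule pos[OF _ has_vector_derivative_reflect[OF g]])
         (use False b[of "- s" for s] \<open>g 0 = 0\<close> in auto)
    then show ?thesis using False by simp
  qed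
qed

section \<open>Existence and uniqueness of the flow\<close>

definition is_solution :: "('a::real_normed_vector \<Rightarrow> 'a) \<Rightarrow> 'a \<Rightarrow> (real \<Rightarrow> 'a) \<Rightarrow> bool" where
  "is_solution V x f \<longleftrightarrow> f 0 = x \<and> (\<forall>s. (f has_vector_derivative V (f s)) (at s))"

lemma is_solution_diff_bound:
  fixes V :: "'a::real_inner \<Rightarrow> 'a"
  assumes V: "L-lipschitz_on UNIV V" and f: "is_solution V x f" and g: "is_solution V y g"
  shows "norm (f t - g t) \<le> exp (L * \<bar>t\<bar>) * norm (x - y)"
proof -
  have "norm (f t - g t) \<le> exp (L * \<bar>t\<bar>) * norm (f 0 - g 0)"
  proof (rule gronwall_norm)
    show "((\<lambda>t. f t - g t) has_vector_derivative V (f s) - V (g s)) (at s)" for s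
      using f g by (auto simp: is_solution_def intro!: derivative_intros)
    show "norm (V (f s) - V (g s)) \<le> L * norm (f s - g s)" for s
      using lipschitz_onD[OF V, of "f s" "g s"] by (simp add: dist_norm)
  qed
  then show ?thesis using f g by (simp add: is_solution_def)
qed

text \<open>Picard iteration; in the weight \<open>exp (2 L |t|)\<close> the iteration is a contraction
  with factor 1/2, which gives convergence on the whole real line at once.\<close>

lemma ex_is_solution:
  fixes V :: "'a::euclidean_space \<Rightarrow> 'a"
  assumes V: "L-lipschitz_on UNIV V" and L: "L > 0"
  shows "\<exists>f. is_solution V x f"
proof -
  have Vc: "continuous_on UNIV V" by (rule lipschitz_on_continuous_on[OF V])
  have VL: "norm (V a - V b) \<le> L * norm (a - b)" for a b
    using lipschitz_onD[OF V, of a b] by (simp add: dist_norm)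
  \<comment> \<open>The Picard operator. It is selected as an antiderivative of \<open>V\<close>
    along \<open>f\<close> with value \<open>x\<close> at time 0, so that its derivative and initial
    value are all that is ever used.\<close>
  define P where "P f = (SOME F. F 0 = x \<and> (\<forall>t. (F has_vector_derivative V (f t)) (at t)))"
    for f :: "real \<Rightarrow> 'a"
  have P: "P f 0 = x \<and> (\<forall>t. (P f has_vector_derivative V (f t)) (at t))"
    if "continuous_on UNIV f" for f
    unfolding P_def
    by (rule someI_ex[OF ex_antiderivative_real])
       (intro continuous_on_compose2[OF Vc that] subset_UNIV)
  define \<phi> where "\<phi> n = (P ^^ n) (\<lambda>_. x)" for n
  have \<phi>_Suc: "\<phi> (Suc n) = P (\<phi> n)" for n by (simp add: \<phi>_def)
  have cont: "continuous_on UNIV (\<phi> n)" for n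
  proof (induction n)
    case 0
    then show ?case by (simp add: \<phi>_def)
  next
    case (Suc n)
    then show ?case unfolding \<phi>_Suc using P[OF Suc]
      by (intro continuous_at_imp_continuous_on ballI) (auto intro: has_vector_derivative_continuous)
  qed
  have \<phi>0: "\<phi> n 0 = x" for n
    by (cases n) (use P[OF cont] in \<open>auto simp: \<phi>_Suc\<close>, simp add: \<phi>_def)
  have \<phi>': "(\<phi> (Suc n) has_vector_derivative V (\<phi> n t)) (at t)" for n t
    using P[OF cont[of n]] by (simp add: \<phi>_Suc)
  \<comment> \<open>The first Picard increment has constant derivative \<open>V x\<close>, which is
    at most |V x| times the weight; integrating divides by 2 L.\<close>
  define A where "A = norm (V x) / (2 * L)"
  define w where "w t = exp (2 * L * \<bar>t\<bar>)" for t
  have step: "norm (\<phi> (Suc n) t - \<phi> n t) \<le> A * (1/2)^n * w t" for n t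
  proof (induction n arbitrary: t)
    case 0
    have d: "((\<lambda>t. \<phi> (Suc 0) t - x) has_vector_derivative V x) (at s)" for s
      using \<phi>'[of 0 s] by (auto intro!: derivative_eq_intros simp: \<phi>_def)
    have "norm (\<phi> (Suc 0) t - x) \<le> norm (V x) / (2 * L) * exp (2 * L * \<bar>t\<bar>)"
      by (rule norm_le_exp_of_derivative[OF d])
         (use L \<phi>0 in \<open>auto simp: mult_le_cancel_left1\<close>)
    then show ?case by (simp add: A_def w_def \<phi>_def)
  next
    case (Suc n)
    have d: "((\<lambda>t. \<phi> (Suc (Suc n)) t - \<phi> (Suc n) t) has_vector_derivative
        V (\<phi> (Suc n) s) - V (\<phi> n s)) (at s)" for s
      by (intro derivative_intros \<phi>')
    have "norm (\<phi> (Suc (Suc n)) t - \<phi> (Suc n) t) \<le> (L * A * (1/2)^n) / (2 * L) * exp (2 * L * \<bar>t\<bar>)"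
    proof (rule norm_le_exp_of_derivative[OF d])
      fix s
      have "norm (V (\<phi> (Suc n) s) - V (\<phi> n s)) \<le> L * norm (\<phi> (Suc n) s - \<phi> n s)" by (rule VL)
      also have "\<dots> \<le> L * (A * (1/2)^n * w s)" by (intro mult_left_mono Suc) (use L in auto)
      finally show "norm (V (\<phi> (Suc n) s) - V (\<phi> n s)) \<le> L * A * (1/2)^n * exp (2 * L * \<bar>s\<bar>)"
        by (simp add: w_def mult_ac)
    qed (use L \<phi>0 in auto)
    then show ?case using L by (simp add: w_def field_simps)
  qed
  have wpos: "0 < w t" for t by (simp add: w_def)
  have A0: "0 \<le> A" using L by (simp add: A_def)
  have summ: "summable (\<lambda>n. \<phi> (Suc n) t - \<phi> n t)" for t
  proof (rule summable_comparison_test')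
    show "summable (\<lambda>n. A * w t * (1/2)^n)" by (intro summable_mult summable_geometric) auto
    show "norm (\<phi> (Suc n) t - \<phi> n t) \<le> A * w t * (1/2)^n" for n
      using step[of n t] by (simp add: mult_ac)
  qed
  define g where "g t = x + (\<Sum>n. \<phi> (Suc n) t - \<phi> n t)" for t
  have tele: "(\<Sum>i<n. \<phi> (Suc i) t - \<phi> i t) = \<phi> n t - x" for n t
    using sum_lessThan_telescope[of "\<lambda>i. \<phi> i t" n] by (simp add: \<phi>_def)
  have close: "norm (\<phi> n t - g t) \<le> 2 * A * w t * (1/2)^n" for n t
  proof -
    have "g t - \<phi> n t = (\<Sum>i. \<phi> (Suc (i + n)) t - \<phi> (i + n) t)"
      unfolding suminf_minus_initial_segment[OF summ[of t], of n] tele[of t n] g_def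
      by (simp only: algebra_simps)
    also have "norm \<dots> \<le> (\<Sum>i. A * w t * (1/2)^n * (1/2)^i)"
    proof (rule norm_suminf_le)
      show "norm (\<phi> (Suc (i + n)) t - \<phi> (i + n) t) \<le> A * w t * (1/2)^n * (1/2)^i" for i
        using step[of "i + n" t] by (simp add: power_add mult_ac)
    qed (intro summable_mult summable_geometric, auto)
    also have "\<dots> = A * w t * (1/2)^n * 2"
      by (subst suminf_mult) (auto simp: suminf_geometric)
    finally show ?thesis by (simp add: norm_minus_commute mult_ac)
  qed
  have lim: "(\<lambda>n. \<phi> n t) \<longlonglongrightarrow> g t" for t
  proof -
    have "(\<lambda>n. 2 * A * w t * (1/2)^n) \<longlonglongrightarrow> 2 * A * w t * 0"
      by (intro tendsto_intros LIMSEQ_power_zero) auto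
    then have "(\<lambda>n. \<phi> n t - g t) \<longlonglongrightarrow> 0"
      by (intro Lim_null_comparison[OF always_eventually[OF allI[OF close]]]) simp
    then show ?thesis by (rule LIM_zero_cancel)
  qed
  have "(g has_vector_derivative V (g t)) (at t)" for t
  proof -
    \<comment> \<open>The weight is bounded only on bounded time sets, so the derivatives converge
      uniformly on this ball around \<open>t\<close> and the limit is differentiated there. The ball
      is centred at 0 because the initial value supplies the one point of convergence that the
      theorem on differentiated sequences asks for.\<close>
    define S where "S = ball (0::real) (\<bar>t\<bar> + 1)"
    have "\<exists>G. \<forall>s\<in>S. (\<lambda>n. \<phi> (Suc n) s) \<longlonglongrightarrow> G s \<and>
        (G has_derivative (\<lambda>h. h *\<^sub>R V (g s))) (at s within S)"
    proof (rule has_derivative_sequence)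
      show "(\<phi> (Suc n) has_derivative (\<lambda>h. h *\<^sub>R V (\<phi> n s))) (at s within S)" for n s
        using \<phi>'[of n s] unfolding has_vector_derivative_def by (rule has_derivative_at_withinI)
      show "0 \<in> S" "(\<lambda>n. \<phi> (Suc n) 0) \<longlonglongrightarrow> x" by (auto simp: S_def \<phi>0)
      fix e :: real assume "e > 0"
      define K where "K = L * (2 * A * exp (2 * L * (\<bar>t\<bar> + 1)))"
      have "(\<lambda>n. K * (1/2)^n) \<longlonglongrightarrow> K * 0"
        by (intro tendsto_intros LIMSEQ_power_zero) auto
      then have "\<forall>\<^sub>F n in sequentially. K * (1/2)^n < e"
        using \<open>e > 0\<close> by (auto intro: order_tendstoD)
      then show "\<forall>\<^sub>F n in sequentially. \<forall>s\<in>S. \<forall>h.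
          norm (h *\<^sub>R V (\<phi> n s) - h *\<^sub>R V (g s)) \<le> e * norm h"
      proof eventually_elim
        case (elim n)
        have "norm (h *\<^sub>R V (\<phi> n s) - h *\<^sub>R V (g s)) \<le> e * norm h" if "s \<in> S" for s h
        proof -
          have "norm (V (\<phi> n s) - V (g s)) \<le> L * norm (\<phi> n s - g s)" by (rule VL)
          also have "\<dots> \<le> L * (2 * A * w s * (1/2)^n)" using L by (intro mult_left_mono close) auto
          also have "\<dots> \<le> L * (2 * A * exp (2 * L * (\<bar>t\<bar> + 1)) * (1/2)^n)"
            using that L A0 by (intro mult_left_mono mult_right_mono) (auto simp: S_def w_def)
          also have "\<dots> \<le> e" using elim by (simp add: K_def mult_ac)
          finally have "norm (V (\<phi> n s) - V (g s)) * norm h \<le> e * norm h"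
            by (rule mult_right_mono) auto
          then show ?thesis by (simp add: scaleR_diff_right[symmetric] mult_ac)
        qed
        then show ?case by blast
      qed
    qed (auto simp: S_def)
    then obtain G where G: "\<And>s. s \<in> S \<Longrightarrow> (\<lambda>n. \<phi> (Suc n) s) \<longlonglongrightarrow> G s"
      "\<And>s. s \<in> S \<Longrightarrow> (G has_vector_derivative V (g s)) (at s within S)"
      unfolding has_vector_derivative_def by blast
    have eq: "G s = g s" if "s \<in> S" for s
      using G(1)[OF that] LIMSEQ_Suc[OF lim[of s]] LIMSEQ_unique by blast
    have "open S" "t \<in> S" by (auto simp: S_def)
    have "(G has_vector_derivative V (g t)) (at t)"
      using G(2)[OF \<open>t \<in> S\<close>] unfolding at_within_open[OF \<open>t \<in> S\<close> \<open>open S\<close>] .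
    then show ?thesis
      by (rule has_vector_derivative_transform_within_open[OF _ \<open>open S\<close> \<open>t \<in> S\<close> eq])
  qed
  moreover have "g 0 = x"
    using LIMSEQ_unique[OF lim[of 0, unfolded \<phi>0] tendsto_const] .
  ultimately show ?thesis unfolding is_solution_def by blast
qed

lemma lipschitz_obtain:
  assumes "lipschitz V"
  obtains L where "L > 0" "L-lipschitz_on UNIV V"
proof -
  obtain L where "L-lipschitz_on UNIV V" using assms by (auto simp: lipschitz_def)
  then have "(\<bar>L\<bar> + 1)-lipschitz_on UNIV V" by (rule lipschitz_on_le) auto
  then show ?thesis by (intro that[of "\<bar>L\<bar> + 1"]) auto
qed

text \<open>Gronwall with equal initial values gives uniqueness, so the definite description in
  \<open>flow\<close> denotes the Picard solution.\<close>

lemma is_solution_flow: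
  fixes V :: "'a::euclidean_space \<Rightarrow> 'a"
  assumes "lipschitz V"
  shows "is_solution V x (\<lambda>t. flow V t x)"
proof -
  obtain L where L: "L > 0" "L-lipschitz_on UNIV V" using lipschitz_obtain[OF assms] .
  obtain f where f: "is_solution V x f" using ex_is_solution[OF L(2,1)] by blast
  have "flow V t x = f t" for t
    unfolding flow_def
  proof (rule the_equality)
    show "\<exists>fa. fa 0 = x \<and> (\<forall>s. (fa has_vector_derivative V (fa s)) (at s)) \<and> fa t = f t"
      using f by (auto simp: is_solution_def)
    fix y assume "\<exists>f. f 0 = x \<and> (\<forall>s. (f has_vector_derivative V (f s)) (at s)) \<and> f t = y"
    then obtain g where g: "is_solution V x g" "g t = y" by (auto simp: is_solution_def)
    show "y = f t" using is_solution_diff_bound[OF L(2) f g(1), of t] g(2) by simp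
  qed
  then have "(\<lambda>t. flow V t x) = f" by auto
  then show ?thesis using f by simp
qed

lemma flow_0:
  fixes V :: "'a::euclidean_space \<Rightarrow> 'a"
  assumes "lipschitz V"
  shows "flow V 0 x = x"
  using is_solution_flow[OF assms, of x] by (simp add: is_solution_def)

lemma flow_has_vector_derivative:
  fixes V :: "'a::euclidean_space \<Rightarrow> 'a"
  assumes "lipschitz V"
  shows "((\<lambda>t. flow V t x) has_vector_derivative V (flow V s x)) (at s)"
  using is_solution_flow[OF assms, of x] by (simp add: is_solution_def)

lemma flow_diff_bound:
  fixes V :: "'a::euclidean_space \<Rightarrow> 'a"
  assumes "L-lipschitz_on UNIV V"
  shows "norm (flow V t x - flow V t y) \<le> exp (L * \<bar>t\<bar>) * norm (x - y)"
proof -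
  have "lipschitz V" using assms by (auto simp: lipschitz_def)
  then show ?thesis
    by (intro is_solution_diff_bound[OF assms is_solution_flow is_solution_flow])
qed

section \<open>Growth and stability of the flow\<close>

lemma lipschitz_growth:
  fixes V :: "'a::real_normed_vector \<Rightarrow> 'b::real_normed_vector"
  assumes "L-lipschitz_on UNIV V"
  shows "norm (V x) \<le> (L + norm (V 0)) * (1 + norm x)"
proof -
  have "norm (V x) \<le> norm (V x - V 0) + norm (V 0)" by (metis diff_add_cancel norm_triangle_ineq)
  also have "\<dots> \<le> L * norm x + norm (V 0)" using lipschitz_onD[OF assms, of x 0] by (simp add: dist_norm)
  also have "\<dots> \<le> (L + norm (V 0)) * (1 + norm x)"
    using lipschitz_on_nonneg[OF assms] by (simp add: algebra_simps)
  finally show ?thesis .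
qed

text \<open>Adjoining a constant coordinate makes the affine growth of V linear, so the homogeneous
  Gronwall inequality applies.\<close>

lemma flow_growth:
  fixes V :: "'a::euclidean_space \<Rightarrow> 'a"
  assumes "lipschitz V"
  obtains K where "K > 0" "\<And>t x. 1 + norm (flow V t x) \<le> K * exp (K * \<bar>t\<bar>) * (1 + norm x)"
    "\<And>t x. norm (flow V t x - x) \<le> K * \<bar>t\<bar> * exp (K * \<bar>t\<bar>) * (1 + norm x)"
proof -
  obtain L where L: "L > 0" "L-lipschitz_on UNIV V" using lipschitz_obtain[OF assms] .
  define k where "k = L + norm (V 0)"
  have k: "k > 0" using L by (simp add: k_def add_pos_nonneg)
  have Vk: "norm (V x) \<le> k * (1 + norm x)" for x unfolding k_def by (rule lipschitz_growth[OF L(2)])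
  have gr: "1 + norm (flow V t x) \<le> 2 * exp (2 * k * \<bar>t\<bar>) * (1 + norm x)" for t x
  proof -
    have "norm (flow V t x, 1::real) \<le> exp (2 * k * \<bar>t\<bar>) * norm (flow V 0 x, 1::real)"
    proof (rule gronwall_norm)
      show "((\<lambda>t. (flow V t x, 1::real)) has_vector_derivative (V (flow V s x), 0)) (at s)" for s
        by (intro has_vector_derivative_Pair flow_has_vector_derivative assms derivative_intros)
      fix s
      have "norm (V (flow V s x)) \<le> k * (1 + norm (flow V s x))" by (rule Vk)
      also have "\<dots> \<le> k * (norm (flow V s x, 1::real) + norm (flow V s x, 1::real))"
        using norm_fst_le[of "flow V s x" "1::real"] norm_snd_le[of "1::real" "flow V s x"] k
        by (intro mult_left_mono add_mono) auto
      finally show "norm (V (flow V s x), 0::real) \<le> 2 * k * norm (flow V s x, 1::real)"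
        by (simp add: norm_Pair)
    qed
    moreover have "norm (flow V 0 x, 1::real) \<le> norm x + 1"
      using norm_triangle_ineq[of "(x, 0::real)" "(0::'a, 1::real)"] by (simp add: flow_0[OF assms])
    ultimately have *: "norm (flow V t x, 1::real) \<le> exp (2 * k * \<bar>t\<bar>) * (norm x + 1)"
      by (meson exp_ge_zero mult_left_mono order_trans)
    have "1 + norm (flow V t x) \<le> 2 * norm (flow V t x, 1::real)"
      using norm_fst_le[of "flow V t x" "1::real"] norm_snd_le[of "1::real" "flow V t x"] by simp
    then show ?thesis using * by (simp add: algebra_simps)
  qed
  have in2: "norm (flow V t x - x) \<le> 2 * k * \<bar>t\<bar> * exp (2 * k * \<bar>t\<bar>) * (1 + norm x)" for t x
  proof -
    have "norm (flow V t x - flow V 0 x) \<le> (k * (2 * exp (2 * k * \<bar>t\<bar>) * (1 + norm x))) * \<bar>t\<bar>"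
    proof (rule norm_diff_le_of_derivative[OF flow_has_vector_derivative[OF assms]])
      fix s assume s: "\<bar>s\<bar> \<le> \<bar>t\<bar>"
      have "norm (V (flow V s x)) \<le> k * (1 + norm (flow V s x))" by (rule Vk)
      also have "\<dots> \<le> k * (2 * exp (2 * k * \<bar>s\<bar>) * (1 + norm x))"
        using k by (intro mult_left_mono gr) auto
      also have "\<dots> \<le> k * (2 * exp (2 * k * \<bar>t\<bar>) * (1 + norm x))"
        using s k by (intro mult_left_mono mult_right_mono) auto
      finally show "norm (V (flow V s x)) \<le> k * (2 * exp (2 * k * \<bar>t\<bar>) * (1 + norm x))" .
    qed
    then show ?thesis by (simp add: flow_0[OF assms] mult_ac)
  qed
  \<comment> \<open>A single constant above the prefactors 2 and 2 k and above the exponential rate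
    2 k.\<close>
  define K where "K = 2 * k + 2"
  have e: "exp (2 * k * \<bar>t\<bar>) \<le> exp (K * \<bar>t\<bar>)" for t
    by (simp add: K_def mult_right_mono)
  show ?thesis
  proof (rule that[of K])
    show "K > 0" using k by (simp add: K_def)
    show "1 + norm (flow V t x) \<le> K * exp (K * \<bar>t\<bar>) * (1 + norm x)" for t x
      by (rule order_trans[OF gr], intro mult_right_mono mult_mono e) (use k in \<open>auto simp: K_def\<close>)
    show "norm (flow V t x - x) \<le> K * \<bar>t\<bar> * exp (K * \<bar>t\<bar>) * (1 + norm x)" for t x
      by (rule order_trans[OF in2], intro mult_right_mono mult_mono e) (use k in \<open>auto simp: K_def\<close>)
  qed
qed

text \<open>The factor |t| is the point: for t = sqrt h \<xi> it gives the size sqrt h of an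
  increment of y - z over a diffusion substep, and for t = h/2 the size h over a drift
  substep.\<close>

lemma flow_increment_diff_bound:
  fixes V :: "'a::euclidean_space \<Rightarrow> 'a"
  assumes L: "L-lipschitz_on UNIV V"
  shows "norm (flow V t x - flow V t y - (x - y)) \<le> L * \<bar>t\<bar> * exp (L * \<bar>t\<bar>) * norm (x - y)"
proof -
  have lip: "lipschitz V" using L by (auto simp: lipschitz_def)
  have L0: "L \<ge> 0" by (rule lipschitz_on_nonneg[OF L])
  have "norm ((flow V t x - flow V t y) - (flow V 0 x - flow V 0 y))
      \<le> (L * (exp (L * \<bar>t\<bar>) * norm (x - y))) * \<bar>t\<bar>"
  proof (rule norm_diff_le_of_derivative)
    show "((\<lambda>t. flow V t x - flow V t y) has_vector_derivative
        V (flow V s x) - V (flow V s y)) (at s)" for s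
      by (intro derivative_intros flow_has_vector_derivative lip)
    fix s assume s: "\<bar>s\<bar> \<le> \<bar>t\<bar>"
    have "norm (V (flow V s x) - V (flow V s y)) \<le> L * norm (flow V s x - flow V s y)"
      using lipschitz_onD[OF L, of "flow V s x" "flow V s y"] by (simp add: dist_norm)
    also have "\<dots> \<le> L * (exp (L * \<bar>s\<bar>) * norm (x - y))"
      by (intro mult_left_mono flow_diff_bound L L0)
    also have "\<dots> \<le> L * (exp (L * \<bar>t\<bar>) * norm (x - y))"
      using s L0 by (intro mult_left_mono mult_right_mono) (auto intro!: mult_left_mono)
    finally show "norm (V (flow V s x) - V (flow V s y)) \<le> L * (exp (L * \<bar>t\<bar>) * norm (x - y))" .
  qed
  then show ?thesis by (simp add: flow_0[OF lip] mult_ac)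
qed

text \<open>This is where the Lipschitz continuity of the derivative of V along V enters: it is the
  second time derivative of the flow.\<close>

lemma flow_second_order_diff_bound:
  fixes V :: "'a::euclidean_space \<Rightarrow> 'a"
  assumes L: "L-lipschitz_on UNIV V" and D: "\<And>x. V differentiable (at x)"
    and W: "K-lipschitz_on UNIV (\<lambda>x. frechet_derivative V (at x) (V x))"
  shows "norm (flow V t x - flow V t y - (x - y) - t *\<^sub>R (V x - V y))
    \<le> K * t\<^sup>2 * exp (L * \<bar>t\<bar>) * norm (x - y)"
proof -
  have lip: "lipschitz V" using L by (auto simp: lipschitz_def)
  have L0: "L \<ge> 0" by (rule lipschitz_on_nonneg[OF L])
  have K0: "K \<ge> 0" by (rule lipschitz_on_nonneg[OF W])
  define W where "W x = frechet_derivative V (at x) (V x)" for x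
  have dV: "((\<lambda>t. V (flow V t x)) has_vector_derivative W (flow V s x)) (at s)" for x s
  proof -
    have "((V \<circ> (\<lambda>t. flow V t x)) has_derivative
        frechet_derivative V (at (flow V s x)) \<circ> (\<lambda>h. h *\<^sub>R V (flow V s x))) (at s)"
      using flow_has_vector_derivative[OF lip, of x s, unfolded has_vector_derivative_def]
        frechet_derivative_works[of V "at (flow V s x)"] D
      by (intro diff_chain_at) auto
    moreover have "linear (frechet_derivative V (at (flow V s x)))"
      by (intro linear_frechet_derivative D)
    ultimately show ?thesis
      by (simp add: has_vector_derivative_def o_def W_def linear_scale)
  qed
  have exp_le: "exp (L * \<bar>s\<bar>) * norm (x - y) \<le> exp (L * \<bar>t\<bar>) * norm (x - y)" if "\<bar>s\<bar> \<le> \<bar>t\<bar>" for s t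
    using that L0 by (intro mult_right_mono) (auto intro!: mult_left_mono)
  have h: "norm (V (flow V t x) - V (flow V t y) - (V x - V y))
      \<le> (K * (exp (L * \<bar>t\<bar>) * norm (x - y))) * \<bar>t\<bar>" for t
  proof -
    have "norm ((V (flow V t x) - V (flow V t y)) - (V (flow V 0 x) - V (flow V 0 y)))
      \<le> (K * (exp (L * \<bar>t\<bar>) * norm (x - y))) * \<bar>t\<bar>"
    proof (rule norm_diff_le_of_derivative)
      show "((\<lambda>t. V (flow V t x) - V (flow V t y)) has_vector_derivative
          W (flow V s x) - W (flow V s y)) (at s)" for s
        by (intro derivative_intros dV)
      fix s assume s: "\<bar>s\<bar> \<le> \<bar>t\<bar>"
      have "norm (W (flow V s x) - W (flow V s y)) \<le> K * norm (flow V s x - flow V s y)"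
        using lipschitz_onD[OF W, of "flow V s x" "flow V s y"] by (simp add: dist_norm W_def)
      also have "\<dots> \<le> K * (exp (L * \<bar>s\<bar>) * norm (x - y))"
        by (intro mult_left_mono flow_diff_bound L K0)
      also have "\<dots> \<le> K * (exp (L * \<bar>t\<bar>) * norm (x - y))"
        using exp_le[OF s] K0 by (intro mult_left_mono) auto
      finally show "norm (W (flow V s x) - W (flow V s y)) \<le> K * (exp (L * \<bar>t\<bar>) * norm (x - y))" .
    qed
    then show ?thesis by (simp add: flow_0[OF lip])
  qed
  \<comment> \<open>The derivative of \<open>u\<close> is exactly the quantity bounded in
    \<open>h\<close>, so a second integration produces the factor t^2.\<close>
  define u where "u t = flow V t x - flow V t y - t *\<^sub>R (V x - V y)" for t
  have "norm (u t - u 0) \<le> ((K * (exp (L * \<bar>t\<bar>) * norm (x - y))) * \<bar>t\<bar>) * \<bar>t\<bar>"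
  proof (rule norm_diff_le_of_derivative)
    show "(u has_vector_derivative
        V (flow V s x) - V (flow V s y) - (V x - V y)) (at s)" for s
      unfolding u_def
      by (rule derivative_eq_intros flow_has_vector_derivative[OF lip] refl)+ simp
    fix s assume s: "\<bar>s\<bar> \<le> \<bar>t\<bar>"
    show "norm (V (flow V s x) - V (flow V s y) - (V x - V y))
        \<le> (K * (exp (L * \<bar>t\<bar>) * norm (x - y))) * \<bar>t\<bar>"
      by (rule order_trans[OF h], intro mult_mono mult_left_mono exp_le s K0) (auto simp: K0)
  qed
  moreover have "u t - u 0 = flow V t x - flow V t y - (x - y) - t *\<^sub>R (V x - V y)"
    by (simp add: u_def flow_0[OF lip])
  ultimately show ?thesis by (simp add: power2_eq_square mult_ac)
qed

text \<open>Continuity in time at a fixed starting point combines with the Lipschitz bound in the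
  starting point, which is locally uniform in time. Joint continuity later yields the measurability
  of the schemes.\<close>

lemma continuous_flow:
  fixes V :: "'a::euclidean_space \<Rightarrow> 'a"
  assumes "lipschitz V"
  shows "continuous_on UNIV (\<lambda>p. flow V (fst p) (snd p))"
proof -
  obtain L where L: "L > 0" "L-lipschitz_on UNIV V" using lipschitz_obtain[OF assms] .
  have "isCont (\<lambda>p. flow V (fst p) (snd p)) (t, x)" for t x
  proof -
    have c: "isCont (\<lambda>t. flow V t x) t"
      using flow_has_vector_derivative[OF assms] has_vector_derivative_continuous by blast
    have "isCont ((\<lambda>t. flow V t x) \<circ> fst) (t, x)"
      by (rule continuous_at_compose) (use c in \<open>auto intro: continuous_intros\<close>)
    then have c2: "((\<lambda>p. flow V (fst p) x) \<longlongrightarrow> flow V t x) (at (t, x))"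
      by (simp add: isCont_def o_def)
    have bnd: "norm (flow V (fst p) (snd p) - flow V t x)
        \<le> exp (L * \<bar>fst p\<bar>) * norm (snd p - x) + norm (flow V (fst p) x - flow V t x)" for p
      using flow_diff_bound[OF L(2), of "fst p" "snd p" x]
        norm_triangle_ineq[of "flow V (fst p) (snd p) - flow V (fst p) x" "flow V (fst p) x - flow V t x"]
      by simp
    have "((\<lambda>p. exp (L * \<bar>fst p\<bar>) * norm (snd p - x) + norm (flow V (fst p) x - flow V t x))
        \<longlongrightarrow> exp (L * \<bar>fst (t, x)\<bar>) * norm (snd (t, x) - x) + norm (flow V (fst (t,x)) x - flow V t x)) (at (t, x))"
      using c2 by (intro tendsto_intros) simp_all
    then have "((\<lambda>p. flow V (fst p) (snd p) - flow V t x) \<longlongrightarrow> 0) (at (t, x))"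
      by (intro Lim_null_comparison[OF always_eventually[OF allI[OF bnd]]]) simp
    then show ?thesis unfolding isCont_def by (simp add: LIM_zero_iff)
  qed
  then show ?thesis by (auto simp: continuous_on_eq_continuous_at)
qed

section \<open>Families of curves with controlled Taylor expansions\<close>

text \<open>Polynomial growth in x and exponential growth in |t|, measured by one weight that is at
  least 1, so that bounds with different exponents are comparable. The class is closed under sums
  and products, and exponentials of |t| remain integrable when t is Gaussian.\<close>

definition pexp_bounded :: "('a::real_normed_vector \<Rightarrow> real \<Rightarrow> 'b::real_normed_vector) \<Rightarrow> bool" where
  "pexp_bounded u \<longleftrightarrow> (\<exists>C\<ge>0. \<exists>q. \<forall>x t. norm (u x t) \<le> C * ((1 + norm x) * exp \<bar>t\<bar>) ^ q)"

lemma weight_ge_1: "1 \<le> (1 + norm x) * exp \<bar>t::real\<bar>"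
  using mult_mono[of 1 "1 + norm x" 1 "exp \<bar>t\<bar>"] by simp

lemma weight_mono:
  assumes "C \<le> D" "0 \<le> C" "q \<le> r" "\<bar>s\<bar> \<le> \<bar>t::real\<bar>"
  shows "C * ((1 + norm x) * exp \<bar>s\<bar>) ^ q \<le> D * ((1 + norm x) * exp \<bar>t\<bar>) ^ r"
proof -
  have "((1 + norm x) * exp \<bar>s\<bar>) ^ q \<le> ((1 + norm x) * exp \<bar>s\<bar>) ^ r"
    using assms weight_ge_1 by (intro power_increasing) auto
  also have "\<dots> \<le> ((1 + norm x) * exp \<bar>t\<bar>) ^ r"
    using assms by (intro power_mono mult_left_mono) auto
  finally show ?thesis using assms by (intro mult_mono) auto
qed

lemma pexp_boundedE:
  assumes "pexp_bounded u"
  obtains C q where "C \<ge> 0" "\<And>x s t. \<bar>s\<bar> \<le> \<bar>t\<bar> \<Longrightarrow> norm (u x s) \<le> C * ((1 + norm x) * exp \<bar>t\<bar>) ^ q"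
proof -
  obtain C q where C: "C \<ge> 0" "\<And>x t. norm (u x t) \<le> C * ((1 + norm x) * exp \<bar>t\<bar>) ^ q"
    using assms unfolding pexp_bounded_def by blast
  show ?thesis
    by (rule that[OF C(1) order_trans[OF C(2)]]) (intro weight_mono, use C in auto)
qed

lemma pexp_boundedI:
  assumes "C \<ge> 0" "\<And>x t. norm (u x t) \<le> C * ((1 + norm x) * exp \<bar>t\<bar>) ^ q"
  shows "pexp_bounded u"
  using assms unfolding pexp_bounded_def by blast

lemma pexp_bounded_mono:
  assumes "pexp_bounded v" "\<And>x t. norm (u x t) \<le> norm (v x t)"
  shows "pexp_bounded u"
  using assms unfolding pexp_bounded_def by (meson order_trans)

lemma pexp_bounded_weight: "pexp_bounded (\<lambda>x t. C * ((1 + norm x) * exp \<bar>t\<bar>) ^ q :: real)"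
  by (rule pexp_boundedI[of "\<bar>C\<bar>"]) (auto simp: abs_mult)

lemma pexp_bounded_const: "pexp_bounded (\<lambda>x t. c)"
  by (rule pexp_boundedI[of "norm c" _ 0]) auto

lemma pexp_bounded_fst: "pexp_bounded (\<lambda>x t. x)"
  by (rule pexp_boundedI[of 1 _ 1])
     (use mult_mono[of "norm x" "1 + norm x" 1 "exp \<bar>t\<bar>" for x :: 'a and t :: real] in auto)

lemma pexp_bounded_time: "pexp_bounded (\<lambda>x t. t)"
proof (rule pexp_boundedI[of 1 _ 1])
  fix x :: 'a and t :: real
  have "\<bar>t\<bar> \<le> exp \<bar>t\<bar>" using exp_ge_add_one_self[of "\<bar>t\<bar>"] by linarith
  then have "1 * \<bar>t\<bar> \<le> (1 + norm x) * exp \<bar>t\<bar>" by (intro mult_mono) auto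
  then show "norm t \<le> 1 * ((1 + norm x) * exp \<bar>t\<bar>) ^ 1" by simp
qed simp

lemma pexp_bounded_norm:
  "pexp_bounded u \<Longrightarrow> pexp_bounded (\<lambda>x t. norm (u x t))"
  by (simp add: pexp_bounded_def)

lemma pexp_bounded_add:
  assumes "pexp_bounded u" "pexp_bounded v"
  shows "pexp_bounded (\<lambda>x t. u x t + v x t)"
proof -
  obtain C q where C: "C \<ge> 0" "\<And>x s t. \<bar>s\<bar> \<le> \<bar>t\<bar> \<Longrightarrow> norm (u x s) \<le> C * ((1 + norm x) * exp \<bar>t\<bar>) ^ q"
    using pexp_boundedE[OF assms(1)] by metis
  obtain D r where D: "D \<ge> 0" "\<And>x s t. \<bar>s\<bar> \<le> \<bar>t\<bar> \<Longrightarrow> norm (v x s) \<le> D * ((1 + norm x) * exp \<bar>t\<bar>) ^ r"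
    using pexp_boundedE[OF assms(2)] by metis
  show ?thesis
  proof (rule pexp_boundedI[of "C + D" _ "max q r"])
    fix x :: 'a and t :: real
    have "norm (u x t + v x t) \<le> norm (u x t) + norm (v x t)" by (rule norm_triangle_ineq)
    also have "\<dots> \<le> C * ((1 + norm x) * exp \<bar>t\<bar>) ^ q + D * ((1 + norm x) * exp \<bar>t\<bar>) ^ r"
      by (intro add_mono C D) auto
    also have "\<dots> \<le> C * ((1 + norm x) * exp \<bar>t\<bar>) ^ max q r + D * ((1 + norm x) * exp \<bar>t\<bar>) ^ max q r"
      by (intro add_mono weight_mono) (use C D in auto)
    finally show "norm (u x t + v x t) \<le> (C + D) * ((1 + norm x) * exp \<bar>t\<bar>) ^ max q r"
      by (simp add: algebra_simps)
  qed (use C D in auto)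
qed

lemma pexp_bounded_scaleR:
  assumes "pexp_bounded u" "pexp_bounded v"
  shows "pexp_bounded (\<lambda>x t. u x t *\<^sub>R v x t)"
proof -
  obtain C q where C: "C \<ge> 0" "\<And>x s t. \<bar>s\<bar> \<le> \<bar>t\<bar> \<Longrightarrow> norm (u x s) \<le> C * ((1 + norm x) * exp \<bar>t\<bar>) ^ q"
    using pexp_boundedE[OF assms(1)] by metis
  obtain D r where D: "D \<ge> 0" "\<And>x s t. \<bar>s\<bar> \<le> \<bar>t\<bar> \<Longrightarrow> norm (v x s) \<le> D * ((1 + norm x) * exp \<bar>t\<bar>) ^ r"
    using pexp_boundedE[OF assms(2)] by metis
  show ?thesis
  proof (rule pexp_boundedI[of "C * D" _ "q + r"])
    fix x :: 'a and t :: real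
    have "norm (u x t) * norm (v x t) \<le> (C * ((1 + norm x) * exp \<bar>t\<bar>) ^ q) * (D * ((1 + norm x) * exp \<bar>t\<bar>) ^ r)"
      by (intro mult_mono C D) (use C in auto)
    then show "norm (u x t *\<^sub>R v x t) \<le> C * D * ((1 + norm x) * exp \<bar>t\<bar>) ^ (q + r)"
      by (simp add: power_add mult_ac)
  qed (use C D in auto)
qed

lemma pexp_bounded_mult:
  fixes u v :: "'a::real_normed_vector \<Rightarrow> real \<Rightarrow> real"
  assumes "pexp_bounded u" "pexp_bounded v"
  shows "pexp_bounded (\<lambda>x t. u x t * v x t)"
  using pexp_bounded_scaleR[OF assms] by simp

lemma pexp_bounded_power:
  fixes u :: "'a::real_normed_vector \<Rightarrow> real \<Rightarrow> real"
  assumes "pexp_bounded u"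
  shows "pexp_bounded (\<lambda>x t. u x t ^ n)"
  by (induction n) (auto intro: pexp_bounded_const pexp_bounded_mult assms)

lemmas pexp_bounded_intros = pexp_bounded_const pexp_bounded_fst pexp_bounded_time pexp_bounded_norm
  pexp_bounded_add pexp_bounded_mult pexp_bounded_power pexp_bounded_scaleR

lemma pexp_bounded_poly_lip:
  assumes V: "poly_lip V" and u: "pexp_bounded u"
  shows "pexp_bounded (\<lambda>x t. V (u x t))"
proof -
  obtain C q where C: "C > 0" "\<And>x y. norm (V x - V y) \<le> C * (1 + norm x ^ q + norm y ^ q) * norm (x - y)"
    using V unfolding poly_lip_def by blast
  have "pexp_bounded (\<lambda>x t. norm (V 0) + C * (1 + norm (u x t) ^ q + norm (0::'b) ^ q) * norm (u x t))"
    by (intro pexp_bounded_intros u)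
  then show ?thesis
  proof (rule pexp_bounded_mono)
    fix x t
    have "norm (V (u x t)) \<le> norm (V 0) + norm (V (u x t) - V 0)"
      by (metis add.commute diff_add_cancel norm_triangle_ineq)
    also have "\<dots> \<le> norm (V 0) + C * (1 + norm (u x t) ^ q + norm (0::'b) ^ q) * norm (u x t)"
      using C(2)[of "u x t" 0] by simp
    finally show "norm (V (u x t))
      \<le> norm (norm (V 0) + C * (1 + norm (u x t) ^ q + norm (0::'b) ^ q) * norm (u x t))"
      by simp
  qed
qed

text \<open>The Lipschitz condition on the highest derivative is only recorded at the base point t = 0,
  which is all that the Taylor expansion below needs.\<close>

fun taylor_class :: "nat \<Rightarrow> ('a::real_normed_vector \<Rightarrow> real \<Rightarrow> 'b::real_normed_vector) \<Rightarrow> bool" where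
  "taylor_class 0 u \<longleftrightarrow> pexp_bounded (\<lambda>x t. u x 0) \<and>
     (\<exists>B. pexp_bounded B \<and> (\<forall>x t. norm (u x t - u x 0) \<le> \<bar>t\<bar> * (B x t :: real)))"
| "taylor_class (Suc m) u \<longleftrightarrow> pexp_bounded (\<lambda>x t. u x 0) \<and>
     (\<exists>u'. (\<forall>x t. (u x has_vector_derivative u' x t) (at t)) \<and> taylor_class m u')"

lemma taylor_class_SucI:
  assumes "pexp_bounded (\<lambda>x t. u x 0)" "\<And>x t. (u x has_vector_derivative u' x t) (at t)"
    "taylor_class m u'"
  shows "taylor_class (Suc m) u"
  using assms by auto

lemma taylor_class_0_bounded:
  assumes "taylor_class 0 u"
  shows "pexp_bounded u"
proof -
  obtain B where B: "pexp_bounded B" "\<And>x t. norm (u x t - u x 0) \<le> \<bar>t\<bar> * (B x t :: real)"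
    using assms by auto
  have u0: "pexp_bounded (\<lambda>x t. u x 0)" using assms by simp
  have "pexp_bounded (\<lambda>x t. norm (u x 0) + norm t * B x t)"
    by (intro pexp_bounded_intros u0 B)
  then show ?thesis
  proof (rule pexp_bounded_mono)
    fix x t
    have "norm (u x t) \<le> norm (u x 0) + norm (u x t - u x 0)"
      by (metis add.commute diff_add_cancel norm_triangle_ineq)
    then show "norm (u x t) \<le> norm (norm (u x 0) + norm t * B x t)" using B(2)[of x t] by simp
  qed
qed

text \<open>In the base case the mean value inequality asks for a bound on the derivative at all
  times up to |t|; it is available because the weight is monotone in |t|.\<close>

lemma taylor_class_Suc_D: "taylor_class (Suc m) u \<Longrightarrow> taylor_class m u"
proof (induction m arbitrary: u)
  case 0
  then obtain u' where u': "\<And>x t. (u x has_vector_derivative u' x t) (at t)" "taylor_class 0 u'"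
    by auto
  obtain C q where C: "C \<ge> 0" "\<And>x s t. \<bar>s\<bar> \<le> \<bar>t\<bar> \<Longrightarrow> norm (u' x s) \<le> C * ((1 + norm x) * exp \<bar>t\<bar>) ^ q"
    using pexp_boundedE[OF taylor_class_0_bounded[OF u'(2)]] by metis
  have "norm (u x t - u x 0) \<le> \<bar>t\<bar> * (C * ((1 + norm x) * exp \<bar>t\<bar>) ^ q)" for x t
    using norm_diff_le_of_derivative[OF u'(1), of t x] C(2) by (metis mult.commute)
  then show ?case using 0 pexp_bounded_weight[of C q] by auto
next
  case (Suc m)
  then show ?case by auto
qed

lemma taylor_class_mono: "taylor_class n u \<Longrightarrow> m \<le> n \<Longrightarrow> taylor_class m u"
  by (induction n) (auto simp: le_Suc_eq simp del: taylor_class.simps dest: taylor_class_Suc_D)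

lemma taylor_class_const:
  assumes "pexp_bounded (\<lambda>x (t::real). f x)"
  shows "taylor_class m (\<lambda>x t. f x)"
proof -
  have z: "taylor_class m (\<lambda>x t. 0)" for m
  proof (induction m)
    case 0
    then show ?case by (auto intro!: exI[of _ "\<lambda>x t. 0"] pexp_bounded_const)
  next
    case (Suc m)
    then show ?case by (auto intro!: exI[of _ "\<lambda>x t. 0"] pexp_bounded_const)
  qed
  show ?thesis
  proof (cases m)
    case 0
    then show ?thesis using assms by (auto intro!: exI[of _ "\<lambda>x t. 0"] pexp_bounded_const)
  next
    case (Suc k)
    then show ?thesis using assms z[of k]
      by (auto intro!: exI[of _ "\<lambda>x t. 0"] pexp_bounded_const)
  qed
qed

lemma taylor_class_time: "taylor_class m (\<lambda>x t. c * t)"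
proof (cases m)
  case 0
  then show ?thesis
    by (auto intro!: exI[of _ "\<lambda>x t. \<bar>c\<bar>"] pexp_bounded_const simp: abs_mult)
next
  case (Suc k)
  have "taylor_class k (\<lambda>x t. c)" by (intro taylor_class_const pexp_bounded_const)
  then show ?thesis unfolding Suc
    by (auto intro!: exI[of _ "\<lambda>x t. c"] pexp_bounded_const derivative_eq_intros
        simp: has_real_derivative_iff_has_vector_derivative[symmetric])
qed

lemma taylor_class_add:
  "taylor_class m u \<Longrightarrow> taylor_class m v \<Longrightarrow> taylor_class m (\<lambda>x t. u x t + v x t)"
proof (induction m arbitrary: u v)
  case 0
  then obtain B D where B: "pexp_bounded B" "\<And>x t. norm (u x t - u x 0) \<le> \<bar>t\<bar> * (B x t :: real)"
    and D: "pexp_bounded D" "\<And>x t. norm (v x t - v x 0) \<le> \<bar>t\<bar> * (D x t :: real)"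
    by (auto)
  have "norm (u x t + v x t - (u x 0 + v x 0)) \<le> \<bar>t\<bar> * (B x t + D x t)" for x t
    using norm_triangle_mono[OF B(2)[of x t] D(2)[of x t]] by (simp add: algebra_simps)
  then show ?case using 0 pexp_bounded_add[OF B(1) D(1)] by (auto intro!: pexp_bounded_add)
next
  case (Suc m)
  then obtain u' v' where u': "\<And>x t. (u x has_vector_derivative u' x t) (at t)" "taylor_class m u'"
    and v': "\<And>x t. (v x has_vector_derivative v' x t) (at t)" "taylor_class m v'" by auto
  show ?case
  proof (rule taylor_class_SucI)
    show "taylor_class m (\<lambda>x t. u' x t + v' x t)" by (rule Suc.IH[OF u'(2) v'(2)])
    show "((\<lambda>t. u x t + v x t) has_vector_derivative u' x t + v' x t) (at t)" for x t
      by (intro derivative_intros u' v')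
    show "pexp_bounded (\<lambda>x t. u x 0 + v x 0)"
      using Suc.prems by (intro pexp_bounded_add) auto
  qed
qed

lemma taylor_class_scaleR:
  fixes f :: "'a::real_normed_vector \<Rightarrow> real \<Rightarrow> real"
  shows "taylor_class m f \<Longrightarrow> taylor_class m u \<Longrightarrow> taylor_class m (\<lambda>x t. f x t *\<^sub>R u x t)"
proof (induction m arbitrary: f u)
  case 0
  then obtain B D where B: "pexp_bounded B" "\<And>x t. norm (f x t - f x 0) \<le> \<bar>t\<bar> * (B x t :: real)"
    and D: "pexp_bounded D" "\<And>x t. norm (u x t - u x 0) \<le> \<bar>t\<bar> * (D x t :: real)" by auto
  have f: "pexp_bounded f" and u0: "pexp_bounded (\<lambda>x t. u x 0)"
    using 0 taylor_class_0_bounded[OF 0(1)] by auto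
  define E where "E x t = norm (f x t) * D x t + B x t * norm (u x 0)" for x t
  have "norm (f x t *\<^sub>R u x t - f x 0 *\<^sub>R u x 0) \<le> \<bar>t\<bar> * E x t" for x t
  proof -
    have "f x t *\<^sub>R u x t - f x 0 *\<^sub>R u x 0 = f x t *\<^sub>R (u x t - u x 0) + (f x t - f x 0) *\<^sub>R u x 0"
      by (simp add: algebra_simps)
    also have "norm \<dots> \<le> norm (f x t) * norm (u x t - u x 0) + norm (f x t - f x 0) * norm (u x 0)"
      by (rule order_trans[OF norm_triangle_ineq]) simp
    also have "\<dots> \<le> norm (f x t) * (\<bar>t\<bar> * D x t) + (\<bar>t\<bar> * B x t) * norm (u x 0)"
      by (intro add_mono mult_left_mono mult_right_mono B D) auto
    finally show ?thesis by (simp add: E_def algebra_simps)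
  qed
  moreover have "pexp_bounded E" unfolding E_def by (intro pexp_bounded_intros f u0 B D)
  moreover have "pexp_bounded (\<lambda>x t. f x 0 *\<^sub>R u x 0)"
    using 0 by (intro pexp_bounded_scaleR) auto
  ultimately show ?case by auto
next
  case (Suc m)
  then obtain f' u' where f': "\<And>x t. (f x has_vector_derivative f' x t) (at t)" "taylor_class m f'"
    and u': "\<And>x t. (u x has_vector_derivative u' x t) (at t)" "taylor_class m u'" by auto
  have tc: "taylor_class m (\<lambda>x t. f x t *\<^sub>R u' x t + f' x t *\<^sub>R u x t)"
    by (intro taylor_class_add Suc.IH[OF taylor_class_Suc_D[OF Suc.prems(1)] u'(2)]
        Suc.IH[OF f'(2) taylor_class_Suc_D[OF Suc.prems(2)]])
  have "((\<lambda>t. f x t *\<^sub>R u x t) has_vector_derivative f x t *\<^sub>R u' x t + f' x t *\<^sub>R u x t) (at t)" for x t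
    using has_vector_derivative_scaleR[of "f x" "f' x t" t UNIV "u x" "u' x t"] f'(1) u'(1)
    by (simp add: has_real_derivative_iff_has_vector_derivative)
  note d = this
  have "pexp_bounded (\<lambda>x t. f x 0 *\<^sub>R u x 0)"
    using Suc.prems by (intro pexp_bounded_scaleR) auto
  then show ?case by (rule taylor_class_SucI[OF _ d tc])
qed

lemma taylor_class_sum:
  assumes "finite I" "\<And>i. i \<in> I \<Longrightarrow> taylor_class m (u i)"
  shows "taylor_class m (\<lambda>x t. \<Sum>i\<in>I. u i x t)"
  using assms
  by (induction I rule: finite_induct)
     (auto intro: taylor_class_add taylor_class_const pexp_bounded_const simp del: taylor_class.simps)

lemma taylor_class_inner:
  fixes u :: "'a::real_normed_vector \<Rightarrow> real \<Rightarrow> 'b::real_inner"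
  shows "taylor_class m u \<Longrightarrow> taylor_class m (\<lambda>x t. u x t \<bullet> b)"
proof (induction m arbitrary: u)
  case 0
  then obtain B where B: "pexp_bounded B" "\<And>x t. norm (u x t - u x 0) \<le> \<bar>t\<bar> * (B x t :: real)" by auto
  have "norm (u x t \<bullet> b - u x 0 \<bullet> b) \<le> \<bar>t\<bar> * (B x t * norm b)" for x t
  proof -
    have "norm (u x t \<bullet> b - u x 0 \<bullet> b) \<le> norm (u x t - u x 0) * norm b"
      by (metis inner_diff_left Cauchy_Schwarz_ineq2 real_norm_def)
    also have "\<dots> \<le> (\<bar>t\<bar> * B x t) * norm b" by (intro mult_right_mono B) auto
    finally show ?thesis by (simp add: mult_ac)
  qed
  moreover have "pexp_bounded (\<lambda>x t. B x t * norm b)" by (intro pexp_bounded_intros B)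
  moreover have "pexp_bounded (\<lambda>x t. u x 0 \<bullet> b)"
    by (rule pexp_bounded_mono[of "\<lambda>x t. norm (u x 0) * norm b"])
       (use 0 in \<open>auto intro!: pexp_bounded_intros Cauchy_Schwarz_ineq2\<close>)
  ultimately show ?case by auto
next
  case (Suc m)
  then obtain u' where u': "\<And>x t. (u x has_vector_derivative u' x t) (at t)" "taylor_class m u'" by auto
  have d: "((\<lambda>t. u x t \<bullet> b) has_vector_derivative u' x t \<bullet> b) (at t)" for x t
    using bounded_linear.has_vector_derivative[OF bounded_linear_inner_left u'(1)] .
  have "pexp_bounded (\<lambda>x t. u x 0 \<bullet> b)"
    by (rule pexp_bounded_mono[of "\<lambda>x t. norm (u x 0) * norm b"])
       (use Suc.prems in \<open>auto intro!: pexp_bounded_intros Cauchy_Schwarz_ineq2\<close>)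
  then show ?case by (rule taylor_class_SucI[OF _ d Suc.IH[OF u'(2)]])
qed

section \<open>Vector fields whose derivatives have controlled growth\<close>

fun poly_smooth :: "nat \<Rightarrow> ('a::real_normed_vector \<Rightarrow> 'b::real_normed_vector) \<Rightarrow> bool" where
  "poly_smooth 0 f \<longleftrightarrow> poly_lip f"
| "poly_smooth (Suc m) f \<longleftrightarrow> (\<forall>x. f differentiable (at x)) \<and>
     (\<forall>h. poly_smooth m (\<lambda>x. frechet_derivative f (at x) h))"

text \<open>Once the directions are fixed, the product of their norms is just a constant. Each
  directional derivative may therefore carry its own constants; uniformity is recovered later by
  restricting to the finitely many basis directions.\<close>

lemma poly_smoothI:
  assumes "Ck m f" "deriv_poly_lip m f"
  shows "poly_smooth m f"
proof -
  have "poly_lip (dk f hs)" if "length hs = m" for hs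
  proof -
    obtain C q where "C > 0" and *: "\<forall>hs x y. length hs = m \<longrightarrow> norm (dk f hs x - dk f hs y)
        \<le> C * (1 + norm x ^ q + norm y ^ q) * norm (x - y) * (\<Prod>h\<leftarrow>hs. norm h)"
      using assms(2) unfolding deriv_poly_lip_def by blast
    note C = \<open>C > 0\<close> *[rule_format, OF that]
    define P where "P = (\<Prod>h\<leftarrow>hs. norm h)"
    \<comment> \<open>The product \<open>P\<close> may be 0, whereas \<open>poly_lip\<close> demands
      a strictly positive constant; hence |P| + 1.\<close>
    have "norm (dk f hs x - dk f hs y) \<le> (C * (\<bar>P\<bar> + 1)) * (1 + norm x ^ q + norm y ^ q) * norm (x - y)" for x y
    proof -
      have "norm (dk f hs x - dk f hs y) \<le> C * (1 + norm x ^ q + norm y ^ q) * norm (x - y) * P"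
        using C(2) by (simp add: P_def)
      also have "\<dots> \<le> C * (1 + norm x ^ q + norm y ^ q) * norm (x - y) * (\<bar>P\<bar> + 1)"
        using C(1) by (intro mult_left_mono) (auto intro!: mult_nonneg_nonneg)
      finally show ?thesis by (simp add: mult_ac)
    qed
    then show ?thesis unfolding poly_lip_def using C(1)
      by (intro exI[of _ "C * (\<bar>P\<bar> + 1)"] exI[of _ q] conjI) (auto intro!: mult_pos_pos)
  qed
  with assms(1) show ?thesis
  proof (induction m arbitrary: f)
    case 0
    then show ?case using 0(2)[of "[]"] by simp
  next
    case (Suc m)
    have "poly_smooth m (\<lambda>x. frechet_derivative f (at x) h)" for h
      by (rule Suc.IH) (use Suc.prems(1) Suc.prems(2)[of "h # hs" for hs] in auto)
    then show ?case using Suc.prems(1) by simp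
  qed
qed

lemma poly_lip_growth:
  assumes "poly_lip f"
  obtains C q where "C \<ge> 0" "\<And>x. norm (f x) \<le> C * (1 + norm x) ^ q"
proof -
  have "pexp_bounded (\<lambda>x (t::real). f x)"
    using pexp_bounded_poly_lip[OF assms pexp_bounded_fst] .
  then obtain C q where C: "C \<ge> 0" "\<And>x s t. \<bar>s\<bar> \<le> \<bar>t\<bar> \<Longrightarrow> norm (f x) \<le> C * ((1 + norm x) * exp \<bar>t\<bar>) ^ q"
    using pexp_boundedE by metis
  show ?thesis by (rule that[of C q]) (use C(1) C(2)[of 0 0] in auto)
qed

lemma power_add_le:
  fixes a b :: real
  assumes "0 \<le> a" "0 \<le> b"
  shows "(a + b) ^ n \<le> 2 ^ n * (a ^ n + b ^ n)"
proof -
  have "(a + b) ^ n \<le> (2 * max a b) ^ n" using assms by (intro power_mono) auto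
  also have "\<dots> = 2 ^ n * max a b ^ n" by (rule power_mult_distrib)
  also have "\<dots> \<le> 2 ^ n * (a ^ n + b ^ n)"
    using assms by (intro mult_left_mono) (auto simp: max_def)
  finally show ?thesis .
qed

lemma poly_weight_le:
  fixes a b :: real
  assumes "0 \<le> a" "0 \<le> b"
  shows "(1 + a + b) ^ q \<le> 4 ^ q * (1 + a ^ q + b ^ q)"
proof -
  have "(1 + a + b) ^ q \<le> 2 ^ q * ((1 + a) ^ q + b ^ q)" using assms by (intro power_add_le) auto
  also have "\<dots> \<le> 2 ^ q * (2 ^ q * (1 ^ q + a ^ q) + 2 ^ q * b ^ q)"
    using assms power_add_le[of 1 a q] mult_right_mono[of 1 "2 ^ q" "b ^ q :: real"]
    by (intro mult_left_mono add_mono) auto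
  also have "\<dots> = 4 ^ q * (1 + a ^ q + b ^ q)"
  proof -
    have "(4::real) ^ q = 2 ^ q * 2 ^ q" by (simp flip: power_mult_distrib)
    then show ?thesis by (simp add: algebra_simps)
  qed
  finally show ?thesis .
qed

lemma frechet_derivative_Basis:
  fixes f :: "'a::euclidean_space \<Rightarrow> 'b::real_normed_vector"
  assumes "f differentiable (at x)"
  shows "frechet_derivative f (at x) v = (\<Sum>i\<in>Basis. (v \<bullet> i) *\<^sub>R frechet_derivative f (at x) i)"
proof -
  have l: "linear (frechet_derivative f (at x))" by (intro linear_frechet_derivative assms)
  have "frechet_derivative f (at x) v = frechet_derivative f (at x) (\<Sum>i\<in>Basis. (v \<bullet> i) *\<^sub>R i)"
    by (simp add: euclidean_representation)
  also have "\<dots> = (\<Sum>i\<in>Basis. (v \<bullet> i) *\<^sub>R frechet_derivative f (at x) i)"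
    by (simp add: linear_sum[OF l] linear_scale[OF l])
  finally show ?thesis .
qed

lemma poly_growth_Basis:
  fixes g :: "'i \<Rightarrow> 'a::euclidean_space \<Rightarrow> 'b::real_normed_vector"
  assumes "finite I" "\<And>i. i \<in> I \<Longrightarrow> poly_lip (g i)"
  obtains C q where "C > 0" "\<And>i x. i \<in> I \<Longrightarrow> norm (g i (x::'a)) \<le> C * (1 + norm x) ^ q"
proof -
  have "\<forall>i\<in>I. \<exists>C q. C \<ge> 0 \<and> (\<forall>x. norm (g i x) \<le> C * (1 + norm x) ^ q)"
    using assms(2) poly_lip_growth by metis
  then obtain C q where C: "\<And>i. i \<in> I \<Longrightarrow> C i \<ge> 0"
    "\<And>i x. i \<in> I \<Longrightarrow> norm (g i x) \<le> C i * (1 + norm x) ^ q i" by metis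
  show ?thesis
  proof (rule that[of "1 + sum C I" "sum q I"])
    show "1 + sum C I > 0" using C(1) by (intro add_pos_nonneg sum_nonneg) auto
    fix i and x :: 'a assume i: "i \<in> I"
    have "C i \<le> sum C I" by (rule member_le_sum) (use i assms(1) C(1) in auto)
    moreover have "q i \<le> sum q I" by (rule member_le_sum) (use i assms(1) in auto)
    ultimately
    have "C i * (1 + norm x) ^ q i \<le> (1 + sum C I) * (1 + norm x) ^ sum q I"
      using C(1)[OF i] by (intro mult_mono power_increasing) auto
    then show "norm (g i x) \<le> (1 + sum C I) * (1 + norm x) ^ sum q I"
      using C(2)[OF i, of x] by linarith
  qed
qed

lemma norm_segment_le:
  fixes x y :: "'a::real_normed_vector"
  assumes "z \<in> closed_segment x y"
  shows "norm z \<le> norm x + norm y"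
proof -
  obtain u where u: "0 \<le> u" "u \<le> 1" "z = (1 - u) *\<^sub>R x + u *\<^sub>R y"
    using assms by (auto simp: closed_segment_def)
  have "norm z \<le> (1 - u) * norm x + u * norm y"
    unfolding u(3) by (rule order_trans[OF norm_triangle_ineq]) (use u in auto)
  also have "\<dots> \<le> 1 * norm x + 1 * norm y" using u by (intro add_mono mult_right_mono) auto
  finally show ?thesis by simp
qed

lemma norm_Basis_sum_le:
  fixes v :: "'a::euclidean_space"
  assumes "\<And>i. i \<in> Basis \<Longrightarrow> norm (g i) \<le> K"
  shows "norm (\<Sum>i\<in>Basis. (v \<bullet> i) *\<^sub>R g i) \<le> real DIM('a) * K * norm v"
proof -
  have "norm (\<Sum>i\<in>Basis. (v \<bullet> i) *\<^sub>R g i) \<le> (\<Sum>i\<in>(Basis::'a set). norm v * K)"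
  proof (rule order_trans[OF norm_sum sum_mono])
    fix i :: 'a assume i: "i \<in> Basis"
    then show "norm ((v \<bullet> i) *\<^sub>R g i) \<le> norm v * K"
      using assms[OF i] Basis_le_norm[OF i, of v] by (simp add: mult_mono)
  qed
  then show ?thesis by (simp add: mult_ac)
qed

text \<open>Mean value inequality along the segment from x to y, on which norms are at most |x| +
  |y|. The operator norm of the derivative is controlled through its values on the basis
  vectors.\<close>

lemma poly_smooth_Suc_D:
  fixes f :: "'a::euclidean_space \<Rightarrow> 'b::real_normed_vector"
  shows "poly_smooth (Suc m) f \<Longrightarrow> poly_smooth m f"
proof (induction m arbitrary: f)
  case 0
  then have D: "\<And>x. f differentiable (at x)"
    and L: "\<And>i. i \<in> Basis \<Longrightarrow> poly_lip (\<lambda>x. frechet_derivative f (at x) i)" by auto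
  obtain C q where C: "C > 0"
    "\<And>i x. i \<in> Basis \<Longrightarrow> norm (frechet_derivative f (at x) i) \<le> C * (1 + norm x) ^ q"
    using poly_growth_Basis[of Basis "\<lambda>i x. frechet_derivative f (at x) i", OF finite_Basis L] by metis
  define K where "K = real DIM('a) * C"
  have "norm (f x - f y) \<le> (K * 4 ^ q) * (1 + norm x ^ q + norm y ^ q) * norm (x - y)" for x y
  proof -
    have "norm (f x - f y) \<le> (K * (1 + norm x + norm y) ^ q) * norm (x - y)"
    proof (rule differentiable_bound[of "closed_segment x y"])
      fix z assume z: "z \<in> closed_segment x y"
      show "(f has_derivative frechet_derivative f (at z)) (at z within closed_segment x y)"
        using D frechet_derivative_works has_derivative_at_withinI by blast
      have "C * (1 + norm z) ^ q \<le> C * (1 + norm x + norm y) ^ q"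
        using norm_segment_le[OF z] C(1) by (intro mult_left_mono power_mono) auto
      then have b: "norm (frechet_derivative f (at z) i) \<le> C * (1 + norm x + norm y) ^ q" if "i \<in> Basis" for i
        using C(2)[OF that, of z] by linarith
      show "onorm (frechet_derivative f (at z)) \<le> K * (1 + norm x + norm y) ^ q"
      proof (rule onorm_le)
        fix v
        show "norm (frechet_derivative f (at z) v) \<le> K * (1 + norm x + norm y) ^ q * norm v"
          unfolding frechet_derivative_Basis[OF D, of z v] K_def
          using norm_Basis_sum_le[of "frechet_derivative f (at z)", OF b, of v] by (simp add: mult_ac)
      qed
    qed auto
    also have "\<dots> \<le> (K * (4 ^ q * (1 + norm x ^ q + norm y ^ q))) * norm (x - y)"
      using C(1) by (intro mult_right_mono mult_left_mono poly_weight_le) (auto simp: K_def)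
    finally show ?thesis by (simp add: mult_ac)
  qed
  moreover have "K * 4 ^ q > 0" using C(1) by (simp add: K_def)
  ultimately show ?case unfolding poly_smooth.simps poly_lip_def by blast
next
  case (Suc m)
  then show ?case by (auto simp del: poly_smooth.simps(1))
qed

lemma poly_smooth_mono:
  fixes f :: "'a::euclidean_space \<Rightarrow> 'b::real_normed_vector"
  shows "poly_smooth n f \<Longrightarrow> m \<le> n \<Longrightarrow> poly_smooth m f"
  by (induction n) (auto simp: le_Suc_eq simp del: poly_smooth.simps dest: poly_smooth_Suc_D)

text \<open>The chain rule written in coordinates: the new derivative is a sum of products of a
  coordinate of \<open>u'\<close> with a partial derivative of \<open>V\<close> along
  \<open>u\<close>. The partial derivatives are one degree less smooth, so the induction hypothesis
  applies to them.\<close>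

lemma taylor_class_compose:
  fixes V :: "'b::euclidean_space \<Rightarrow> 'c::real_normed_vector"
  shows "poly_smooth m V \<Longrightarrow> taylor_class m u \<Longrightarrow> taylor_class m (\<lambda>x t. V (u x t))"
proof (induction m arbitrary: V u)
  case 0
  then have V: "poly_lip V" by simp
  then obtain C q where C: "C > 0" "\<And>x y. norm (V x - V y) \<le> C * (1 + norm x ^ q + norm y ^ q) * norm (x - y)"
    unfolding poly_lip_def by blast
  obtain B where B: "pexp_bounded B" "\<And>x t. norm (u x t - u x 0) \<le> \<bar>t\<bar> * (B x t :: real)"
    and u0: "pexp_bounded (\<lambda>x t. u x 0)" using 0 by auto
  have u: "pexp_bounded u" using 0 taylor_class_0_bounded by blast
  define E where "E x t = C * (1 + norm (u x t) ^ q + norm (u x 0) ^ q) * B x t" for x t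
  have "norm (V (u x t) - V (u x 0)) \<le> \<bar>t\<bar> * E x t" for x t
  proof -
    have "norm (V (u x t) - V (u x 0)) \<le> C * (1 + norm (u x t) ^ q + norm (u x 0) ^ q) * norm (u x t - u x 0)"
      by (rule C)
    also have "\<dots> \<le> C * (1 + norm (u x t) ^ q + norm (u x 0) ^ q) * (\<bar>t\<bar> * B x t)"
      using C(1) by (intro mult_left_mono B) auto
    finally show ?thesis by (simp add: E_def mult_ac)
  qed
  moreover have "pexp_bounded E" unfolding E_def by (intro pexp_bounded_intros u u0 B)
  moreover have "pexp_bounded (\<lambda>x t. V (u x 0))" by (rule pexp_bounded_poly_lip[OF V u0])
  ultimately show ?case by auto
next
  case (Suc m)
  then obtain u' where u': "\<And>x t. (u x has_vector_derivative u' x t) (at t)" "taylor_class m u'" by auto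
  have D: "\<And>x. V differentiable (at x)" using Suc.prems by simp
  define w where "w x t = (\<Sum>i\<in>Basis. (u' x t \<bullet> i) *\<^sub>R frechet_derivative V (at (u x t)) i)" for x t
  have d: "((\<lambda>t. V (u x t)) has_vector_derivative w x t) (at t)" for x t
  proof -
    have "((V \<circ> u x) has_derivative
        frechet_derivative V (at (u x t)) \<circ> (\<lambda>h. h *\<^sub>R u' x t)) (at t)"
      using u'(1)[of x t, unfolded has_vector_derivative_def]
        frechet_derivative_works[of V "at (u x t)"] D
      by (intro diff_chain_at) auto
    moreover have "linear (frechet_derivative V (at (u x t)))"
      by (intro linear_frechet_derivative D)
    moreover have "w x t = frechet_derivative V (at (u x t)) (u' x t)"
      unfolding w_def by (rule frechet_derivative_Basis[symmetric, OF D])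
    ultimately show ?thesis
      by (simp add: has_vector_derivative_def o_def linear_scale)
  qed
  have tc: "taylor_class m w"
    unfolding w_def using Suc.prems
    by (intro taylor_class_sum taylor_class_scaleR taylor_class_inner u' Suc.IH
        taylor_class_Suc_D[OF Suc.prems(2)]) auto
  have "pexp_bounded (\<lambda>x t. V (u x 0))"
  proof (rule pexp_bounded_poly_lip[of V "\<lambda>x t. u x 0"])
    show "poly_lip V" using poly_smooth_mono[OF Suc.prems(1), of 0] by simp
    show "pexp_bounded (\<lambda>x t. u x 0)" using Suc.prems(2) by simp
  qed
  then show ?case by (rule taylor_class_SucI[OF _ d tc])
qed

section \<open>Taylor expansions with uniform remainders\<close>

lemma taylor_integrate:
  fixes u :: "real \<Rightarrow> 'b::real_normed_vector"
  assumes u: "\<And>s. (u has_vector_derivative u' s) (at s)"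
    and b: "\<And>s. norm (u' s - (\<Sum>i\<le>m. s ^ i *\<^sub>R a i)) \<le> \<bar>s\<bar> ^ Suc m * B \<bar>s\<bar>"
    and B: "\<And>r s::real. 0 \<le> r \<Longrightarrow> r \<le> s \<Longrightarrow> B r \<le> B s" "0 \<le> B 0"
  shows "norm (u t - (u 0 + (\<Sum>i\<le>m. (t ^ Suc i / real (Suc i)) *\<^sub>R a i))) \<le> \<bar>t\<bar> ^ Suc (Suc m) * B \<bar>t\<bar>"
proof -
  define v where "v t = u t - (\<Sum>i\<le>m. (t ^ Suc i / real (Suc i)) *\<^sub>R a i)" for t
  have d: "((\<lambda>t. t ^ Suc i / real (Suc i)) has_real_derivative s ^ i) (at s)" for i s
    by (rule derivative_eq_intros refl | simp)+
  have "norm (v t - v 0) \<le> (\<bar>t\<bar> ^ Suc m * B \<bar>t\<bar>) * \<bar>t\<bar>"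
  proof (rule norm_diff_le_of_derivative)
    show "(v has_vector_derivative u' s - (\<Sum>i\<le>m. s ^ i *\<^sub>R a i)) (at s)" for s
    proof -
      have "((\<lambda>t. \<Sum>i\<le>m. (t ^ Suc i / real (Suc i)) *\<^sub>R a i) has_vector_derivative (\<Sum>i\<le>m. s ^ i *\<^sub>R a i)) (at s)"
      proof (rule has_vector_derivative_sum)
        fix i
        show "((\<lambda>t. (t ^ Suc i / real (Suc i)) *\<^sub>R a i) has_vector_derivative s ^ i *\<^sub>R a i) (at s)"
          using has_vector_derivative_scaleR[OF d[of i s] has_vector_derivative_const[of "a i"]] by simp
      qed
      then show ?thesis unfolding v_def by (intro has_vector_derivative_diff u)
    qed
    fix s assume s: "\<bar>s\<bar> \<le> \<bar>t\<bar>"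
    have "0 \<le> B \<bar>s\<bar>" using B(1)[of 0 "\<bar>s\<bar>"] B(2) by simp
    then have "\<bar>s\<bar> ^ Suc m * B \<bar>s\<bar> \<le> \<bar>t\<bar> ^ Suc m * B \<bar>t\<bar>"
      using s B(1) by (intro mult_mono power_mono) auto
    then show "norm (u' s - (\<Sum>i\<le>m. s ^ i *\<^sub>R a i)) \<le> \<bar>t\<bar> ^ Suc m * B \<bar>t\<bar>"
      using b[of s] by linarith
  qed
  moreover have "v 0 = u 0" by (simp add: v_def)
  ultimately show ?thesis by (simp add: v_def algebra_simps)
qed

text \<open>Induction: the expansion of the time derivative is integrated, which raises the order of
  the remainder by one. The coefficients are only asserted to exist and to be polynomially bounded
  in x; no formula for them is ever needed.\<close>

lemma taylor_class_expansion:
  fixes u :: "'a::real_normed_vector \<Rightarrow> real \<Rightarrow> 'b::real_normed_vector"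
  assumes "taylor_class m u"
  obtains C q where "C \<ge> 0" "\<And>x. \<exists>a. (\<forall>i\<le>m. norm (a i) \<le> C * (1 + norm x) ^ q) \<and>
     (\<forall>t. norm (u x t - (\<Sum>i\<le>m. t ^ i *\<^sub>R a i)) \<le> \<bar>t\<bar> ^ Suc m * (C * ((1 + norm x) * exp \<bar>t\<bar>) ^ q))"
proof -
  have "\<exists>C\<ge>0. \<exists>q. \<forall>x. \<exists>a. (\<forall>i\<le>m. norm (a i) \<le> C * (1 + norm x) ^ q) \<and>
     (\<forall>t. norm (u x t - (\<Sum>i\<le>m. t ^ i *\<^sub>R a i)) \<le> \<bar>t\<bar> ^ Suc m * (C * ((1 + norm x) * exp \<bar>t\<bar>) ^ q))"
    using assms
  proof (induction m arbitrary: u)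
    case 0
    then obtain B where B: "pexp_bounded B" "\<And>x t. norm (u x t - u x 0) \<le> \<bar>t\<bar> * (B x t :: real)"
      and u0: "pexp_bounded (\<lambda>x t. u x 0)" by auto
    obtain C q where C: "C \<ge> 0" "\<And>x s t. \<bar>s\<bar> \<le> \<bar>t\<bar> \<Longrightarrow> norm (B x s) \<le> C * ((1 + norm x) * exp \<bar>t\<bar>) ^ q"
      using pexp_boundedE[OF B(1)] by metis
    obtain D r where D: "D \<ge> 0" "\<And>x s t. \<bar>s\<bar> \<le> \<bar>t\<bar> \<Longrightarrow> norm (u x 0) \<le> D * ((1 + norm x) * exp \<bar>t\<bar>) ^ r"
      using pexp_boundedE[OF u0] by metis
    have "norm (u x 0) \<le> (C + D) * (1 + norm x) ^ (q + r)" for x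
      using D(2)[of 0 0 x] weight_mono[of D "C + D" r "q + r" 0 0 x] C(1) D(1) by simp
    moreover have "norm (u x t - u x 0) \<le> \<bar>t\<bar> * ((C + D) * ((1 + norm x) * exp \<bar>t\<bar>) ^ (q + r))" for x t
    proof -
      have "B x t \<le> (C + D) * ((1 + norm x) * exp \<bar>t\<bar>) ^ (q + r)"
        using C(2)[of t t x] weight_mono[of C "C + D" q "q + r" t t x] C(1) D(1) by auto
      then show ?thesis using B(2)[of x t] by (meson abs_ge_zero mult_left_mono order_trans)
    qed
    ultimately show ?case using C(1) D(1)
      by (intro exI[of _ "C + D"] conjI exI[of _ "q + r"] allI exI[of _ "\<lambda>_. u _ 0"]) auto
  next
    case (Suc m)
    then obtain u' where u': "\<And>x t. (u x has_vector_derivative u' x t) (at t)" "taylor_class m u'"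
      and u0: "pexp_bounded (\<lambda>x t. u x 0)" by auto
    from Suc.IH[OF u'(2)] obtain C q where C: "C \<ge> 0" "\<And>x. \<exists>a. (\<forall>i\<le>m. norm (a i) \<le> C * (1 + norm x) ^ q) \<and>
     (\<forall>t. norm (u' x t - (\<Sum>i\<le>m. t ^ i *\<^sub>R a i)) \<le> \<bar>t\<bar> ^ Suc m * (C * ((1 + norm x) * exp \<bar>t\<bar>) ^ q))"
      by blast
    obtain D r where D: "D \<ge> 0" "\<And>x s t. \<bar>s\<bar> \<le> \<bar>t\<bar> \<Longrightarrow> norm (u x 0) \<le> D * ((1 + norm x) * exp \<bar>t\<bar>) ^ r"
      using pexp_boundedE[OF u0] by metis
    have "\<exists>a. (\<forall>i\<le>Suc m. norm (a i) \<le> (C + D) * (1 + norm x) ^ (q + r)) \<and>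
     (\<forall>t. norm (u x t - (\<Sum>i\<le>Suc m. t ^ i *\<^sub>R a i))
        \<le> \<bar>t\<bar> ^ Suc (Suc m) * ((C + D) * ((1 + norm x) * exp \<bar>t\<bar>) ^ (q + r)))" for x
    proof -
      obtain a where a: "\<And>i. i \<le> m \<Longrightarrow> norm (a i) \<le> C * (1 + norm x) ^ q"
        "\<And>t. norm (u' x t - (\<Sum>i\<le>m. t ^ i *\<^sub>R a i)) \<le> \<bar>t\<bar> ^ Suc m * (C * ((1 + norm x) * exp \<bar>t\<bar>) ^ q)"
        using C(2)[of x] by blast
      \<comment> \<open>Coefficients after integration: the initial value in degree 0, and those of
        the derivative shifted up by one degree and divided by it.\<close>
      define b where "b i = (case i of 0 \<Rightarrow> u x 0 | Suc j \<Rightarrow> (1 / real (Suc j)) *\<^sub>R a j)" for i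
      have "norm (b i) \<le> (C + D) * (1 + norm x) ^ (q + r)" if "i \<le> Suc m" for i
      proof (cases i)
        case 0
        then show ?thesis
          using D(2)[of 0 0 x] weight_mono[of D "C + D" r "q + r" 0 0 x] C(1) D(1) by (simp add: b_def)
      next
        case (Suc j)
        have "norm (b i) = norm (a j) / real (Suc j)" by (simp add: b_def Suc)
        also have "\<dots> \<le> norm (a j)" by (simp add: divide_le_eq algebra_simps)
        also have "\<dots> \<le> (C + D) * (1 + norm x) ^ (q + r)"
          using a(1)[of j] that Suc weight_mono[of C "C + D" q "q + r" 0 0 x] C(1) D(1) by simp
        finally show ?thesis .
      qed
      moreover have "norm (u x t - (\<Sum>i\<le>Suc m. t ^ i *\<^sub>R b i))
          \<le> \<bar>t\<bar> ^ Suc (Suc m) * ((C + D) * ((1 + norm x) * exp \<bar>t\<bar>) ^ (q + r))" for t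
      proof -
        have "norm (u x t - (u x 0 + (\<Sum>i\<le>m. (t ^ Suc i / real (Suc i)) *\<^sub>R a i)))
          \<le> \<bar>t\<bar> ^ Suc (Suc m) * (C * ((1 + norm x) * exp \<bar>t\<bar>) ^ q)"
          by (rule taylor_integrate[where B = "\<lambda>s. C * ((1 + norm x) * exp s) ^ q", OF u'(1)])
             (use a(2) C(1) in \<open>auto intro!: mult_left_mono power_mono\<close>)
        also have "u x 0 + (\<Sum>i\<le>m. (t ^ Suc i / real (Suc i)) *\<^sub>R a i) = (\<Sum>i\<le>Suc m. t ^ i *\<^sub>R b i)"
          by (subst sum.atMost_Suc_shift) (simp add: b_def)
        also have "\<bar>t\<bar> ^ Suc (Suc m) * (C * ((1 + norm x) * exp \<bar>t\<bar>) ^ q)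
            \<le> \<bar>t\<bar> ^ Suc (Suc m) * ((C + D) * ((1 + norm x) * exp \<bar>t\<bar>) ^ (q + r))"
          using C(1) D(1) by (intro mult_left_mono weight_mono) auto
        finally show ?thesis .
      qed
      ultimately show ?thesis by blast
    qed
    then show ?case using C(1) D(1) by (intro exI[of _ "C + D"] conjI exI[of _ "q + r"]) auto
  qed
  then show ?thesis using that by blast
qed

lemma taylor_class_flow_0:
  fixes V :: "'a::euclidean_space \<Rightarrow> 'a"
  assumes "lipschitz V"
  shows "taylor_class 0 (\<lambda>x t. flow V t x)"
proof -
  obtain K where K: "K > 0"
    "\<And>t x. norm (flow V t x - x) \<le> K * \<bar>t\<bar> * exp (K * \<bar>t\<bar>) * (1 + norm x)"
    using flow_growth[OF assms] by metis
  \<comment> \<open>A natural exponent above K turns \<open>exp (K |t|)\<close> into a power of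
    \<open>exp |t|\<close>; the successor makes it positive, so that \<open>1 + norm x\<close> is at
    most its own n-th power.\<close>
  define n where "n = Suc (nat \<lceil>K\<rceil>)"
  have n: "K \<le> real n" unfolding n_def by linarith
  have "norm (flow V t x - x) \<le> \<bar>t\<bar> * (K * ((1 + norm x) * exp \<bar>t\<bar>) ^ n)" for x t
  proof -
    have "exp (K * \<bar>t\<bar>) \<le> exp (real n * \<bar>t\<bar>)" using n by (simp add: mult_right_mono)
    also have "\<dots> = exp \<bar>t\<bar> ^ n" by (rule exp_of_nat_mult)
    finally have "exp (K * \<bar>t\<bar>) * (1 + norm x) \<le> exp \<bar>t\<bar> ^ n * (1 + norm x) ^ n"
      by (intro mult_mono self_le_power) (auto simp: n_def)
    then have "(K * \<bar>t\<bar>) * (exp (K * \<bar>t\<bar>) * (1 + norm x)) \<le> (K * \<bar>t\<bar>) * (exp \<bar>t\<bar> ^ n * (1 + norm x) ^ n)"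
      using K(1) by (intro mult_left_mono) auto
    then show ?thesis using K(2)[of t x] by (simp add: power_mult_distrib mult_ac)
  qed
  then show ?thesis
    by (auto simp: flow_0[OF assms] intro!: pexp_bounded_fst pexp_bounded_weight
        exI[of _ "\<lambda>x t. K * ((1 + norm x) * exp \<bar>t\<bar>) ^ n"])
qed

text \<open>Bootstrapping: if the flow belongs to a class, so does its time derivative, which is
  \<open>V\<close> along the flow; hence the flow belongs to the next class, as long as
  \<open>V\<close> is smooth enough.\<close>

lemma taylor_class_flow:
  fixes V :: "'a::euclidean_space \<Rightarrow> 'a"
  assumes V: "lipschitz V" and "poly_smooth m V"
  shows "taylor_class (Suc m) (\<lambda>x t. flow V t x)"
proof -
  have step: "taylor_class (Suc k) (\<lambda>x t. flow V t x)"
    if "taylor_class k (\<lambda>x t. flow V t x)" "k \<le> m" for k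
    by (rule taylor_class_SucI[OF _ flow_has_vector_derivative[OF V]
          taylor_class_compose[OF poly_smooth_mono[OF assms(2) that(2)] that(1)]])
       (simp add: flow_0[OF V] pexp_bounded_fst)
  have "k \<le> Suc m \<Longrightarrow> taylor_class k (\<lambda>x t. flow V t x)" for k
  proof (induction k)
    case 0
    show ?case by (rule taylor_class_flow_0[OF V])
  next
    case (Suc k)
    then show ?case by (intro step) auto
  qed
  then show ?thesis by blast
qed

section \<open>Local errors of the Runge--Kutta steps\<close>

lemma time_le_weight: "\<bar>t\<bar> \<le> (1 + norm x) * exp \<bar>t::real\<bar>"
proof -
  have "\<bar>t\<bar> \<le> exp \<bar>t\<bar>" using exp_ge_add_one_self[of "\<bar>t\<bar>"] by linarith
  then have "1 * \<bar>t\<bar> \<le> (1 + norm x) * exp \<bar>t\<bar>" by (intro mult_mono) auto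
  then show ?thesis by simp
qed

text \<open>\<open>Psi2\<close> is the trapezoidal rule for \<open>V\<close> along the flow with the
  right endpoint replaced by an Euler step. The Euler step is off by O(t^2), which the Lipschitz
  constant and the factor t/2 turn into O(t^3), the order of the trapezoidal defect.\<close>

lemma Psi2_local_error:
  fixes V :: "'a::euclidean_space \<Rightarrow> 'a"
  assumes V: "lipschitz V" and sm: "poly_smooth 1 V"
  obtains C q where "C \<ge> 0" "\<And>x t. norm (flow V t x - Psi2 V t x) \<le> C * \<bar>t\<bar> ^ 3 * ((1 + norm x) * exp \<bar>t\<bar>) ^ q"
proof -
  obtain L where L: "L > 0" "L-lipschitz_on UNIV V" using lipschitz_obtain[OF V] .
  have "taylor_class 1 (\<lambda>x t. V (flow V t x))"
    by (intro taylor_class_compose[OF sm] taylor_class_mono[OF taylor_class_flow[OF V sm]]) simp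
  then obtain C q where C: "C \<ge> 0" "\<And>x. \<exists>a. (\<forall>i\<le>1. norm (a i) \<le> C * (1 + norm x) ^ q) \<and>
     (\<forall>t. norm (V (flow V t x) - (\<Sum>i\<le>1. t ^ i *\<^sub>R a i)) \<le> \<bar>t\<bar> ^ Suc 1 * (C * ((1 + norm x) * exp \<bar>t\<bar>) ^ q))"
    using taylor_class_expansion by blast
  have "norm (flow V t x - Psi2 V t x) \<le> ((2 + 2 * L) * C) * \<bar>t\<bar> ^ 3 * ((1 + norm x) * exp \<bar>t\<bar>) ^ Suc q" for x t
  proof -
    define B where "B s = C * ((1 + norm x) * exp s) ^ q" for s
    obtain a where a: "\<And>i. i \<le> 1 \<Longrightarrow> norm (a i) \<le> C * (1 + norm x) ^ q"
      "\<And>t. norm (V (flow V t x) - (\<Sum>i\<le>1. t ^ i *\<^sub>R a i)) \<le> \<bar>t\<bar> ^ Suc 1 * B \<bar>t\<bar>"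
      using C(2)[of x] unfolding B_def by blast
    have B0: "0 \<le> B s" for s using C(1) by (simp add: B_def)
    have Bm: "B r \<le> B s" if "r \<le> s" for r s
      unfolding B_def using that C(1) by (intro mult_left_mono power_mono) auto
    have a0: "a 0 = V x" using a(2)[of 0] by (simp add: flow_0[OF V])
    have g: "norm (V (flow V t x) - (V x + t *\<^sub>R a 1)) \<le> \<bar>t\<bar>^2 * B \<bar>t\<bar>"
      using a(2)[of t] by (simp add: a0 power2_eq_square)
    have f: "norm (flow V t x - (x + t *\<^sub>R V x + (t^2/2) *\<^sub>R a 1)) \<le> \<bar>t\<bar>^3 * B \<bar>t\<bar>"
      using taylor_integrate[OF flow_has_vector_derivative[OF V] a(2) Bm B0, of t]
      by (simp add: a0 flow_0[OF V] power2_eq_square eval_nat_numeral algebra_simps)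
    have a1: "norm (a 1) \<le> B \<bar>t\<bar>"
      using a(1)[of 1] Bm[of 0 "\<bar>t\<bar>"] by (simp add: B_def)
    define \<delta> where "\<delta> = V (x + t *\<^sub>R V x) - V (flow V t x)"
    have "norm \<delta> \<le> L * norm (x + t *\<^sub>R V x - flow V t x)"
      using lipschitz_onD[OF L(2), of "x + t *\<^sub>R V x" "flow V t x"] by (simp add: \<delta>_def dist_norm)
    also have "norm (x + t *\<^sub>R V x - flow V t x) \<le> \<bar>t\<bar>^3 * B \<bar>t\<bar> + (t^2/2) * B \<bar>t\<bar>"
    proof -
      have "x + t *\<^sub>R V x - flow V t x = - (flow V t x - (x + t *\<^sub>R V x + (t^2/2) *\<^sub>R a 1)) - (t^2/2) *\<^sub>R a 1"
        by simp
      also have "norm \<dots> \<le> \<bar>t\<bar>^3 * B \<bar>t\<bar> + (t^2/2) * norm (a 1)"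
        by (rule order_trans[OF norm_triangle_ineq4]) (use f in \<open>simp add: norm_minus_commute\<close>)
      also have "\<dots> \<le> \<bar>t\<bar>^3 * B \<bar>t\<bar> + (t^2/2) * B \<bar>t\<bar>" using a1 by (intro add_left_mono mult_left_mono) auto
      finally show ?thesis .
    qed
    finally have \<delta>: "norm \<delta> \<le> L * (\<bar>t\<bar>^3 * B \<bar>t\<bar> + (t^2/2) * B \<bar>t\<bar>)" using L(1) by (simp add: mult_left_mono)
    have "flow V t x - Psi2 V t x = (flow V t x - (x + t *\<^sub>R V x + (t^2/2) *\<^sub>R a 1))
        - (t/2) *\<^sub>R (V (flow V t x) - (V x + t *\<^sub>R a 1)) - (t/2) *\<^sub>R \<delta>"
      unfolding Psi2_def \<delta>_def
      by (rule euclidean_eqI) (simp add: inner_simps algebra_simps power2_eq_square)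
    also have "norm \<dots> \<le> \<bar>t\<bar>^3 * B \<bar>t\<bar> + (\<bar>t\<bar>/2) * (\<bar>t\<bar>^2 * B \<bar>t\<bar>) + (\<bar>t\<bar>/2) * (L * (\<bar>t\<bar>^3 * B \<bar>t\<bar> + (t^2/2) * B \<bar>t\<bar>))"
      by (intro order_trans[OF norm_triangle_ineq4] add_mono f)
         (use g \<delta> in \<open>auto intro!: mult_left_mono simp: mult_left_mono\<close>)
    also have "\<dots> = \<bar>t\<bar>^3 * B \<bar>t\<bar> * (3/2 + L/4 + L / 2 * \<bar>t\<bar>)"
      by (simp add: algebra_simps power2_eq_square power3_eq_cube)
    \<comment> \<open>The surplus power of |t| is swallowed by one more power of the weight, whence
      the exponent \<open>Suc q\<close>.\<close>
    also have "\<dots> \<le> \<bar>t\<bar>^3 * B \<bar>t\<bar> * ((2 + 2 * L) * ((1 + norm x) * exp \<bar>t\<bar>))"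
    proof (rule mult_left_mono)
      have "3/2 + L/4 + L / 2 * \<bar>t\<bar> \<le> 3/2 * ((1 + norm x) * exp \<bar>t\<bar>) + L/4 * ((1 + norm x) * exp \<bar>t\<bar>) + L/2 * ((1 + norm x) * exp \<bar>t\<bar>)"
        using weight_ge_1[of x t] time_le_weight[of t x] L(1)
          mult_left_mono[OF weight_ge_1[of x t], of "L/4"]
        by (intro add_mono mult_left_mono) auto
      also have "\<dots> = (3/2 + 3 * L/4) * ((1 + norm x) * exp \<bar>t\<bar>)" by (simp add: algebra_simps)
      also have "\<dots> \<le> (2 + 2 * L) * ((1 + norm x) * exp \<bar>t\<bar>)" using L(1) by (intro mult_right_mono) auto
      finally show "3/2 + L/4 + L / 2 * \<bar>t\<bar> \<le> (2 + 2 * L) * ((1 + norm x) * exp \<bar>t\<bar>)" .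
    qed (use B0 in auto)
    finally show ?thesis by (simp add: B_def mult_ac)
  qed
  then show ?thesis using that[of "(2 + 2 * L) * C" "Suc q"] L C by auto
qed

section \<open>Calculus of orders at time 0, for a fixed starting point\<close>

definition big_o_at_0 :: "nat \<Rightarrow> (real \<Rightarrow> 'a::real_normed_vector) \<Rightarrow> bool" where
  "big_o_at_0 k r \<longleftrightarrow> (\<exists>C\<ge>0. \<forall>t. \<bar>t\<bar> \<le> 1 \<longrightarrow> norm (r t) \<le> C * \<bar>t\<bar> ^ k)"

lemma big_o_at_0_dominated:
  assumes "big_o_at_0 k r" "K \<ge> 0" "\<And>t. \<bar>t\<bar> \<le> 1 \<Longrightarrow> norm (u t) \<le> K * norm (r t)"
  shows "big_o_at_0 k u"
proof -
  obtain C where C: "C \<ge> 0" "\<And>t. \<bar>t\<bar> \<le> 1 \<Longrightarrow> norm (r t) \<le> C * \<bar>t\<bar> ^ k"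
    using assms(1) unfolding big_o_at_0_def by blast
  have "norm (u t) \<le> (K * C) * \<bar>t\<bar> ^ k" if "\<bar>t\<bar> \<le> 1" for t
    using assms(3)[OF that] mult_left_mono[OF C(2)[OF that] assms(2)] by (simp add: mult_ac)
  then show ?thesis unfolding big_o_at_0_def using C(1) assms(2) by (intro exI[of _ "K * C"]) auto
qed

lemma big_o_at_0_product:
  assumes "big_o_at_0 j r" "big_o_at_0 k s" "K \<ge> 0"
    "\<And>t. \<bar>t\<bar> \<le> 1 \<Longrightarrow> norm (u t) \<le> K * norm (r t) * norm (s t)"
  shows "big_o_at_0 (j + k) u"
proof -
  obtain C where C: "C \<ge> 0" "\<And>t. \<bar>t\<bar> \<le> 1 \<Longrightarrow> norm (r t) \<le> C * \<bar>t\<bar> ^ j"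
    using assms(1) unfolding big_o_at_0_def by blast
  obtain D where D: "D \<ge> 0" "\<And>t. \<bar>t\<bar> \<le> 1 \<Longrightarrow> norm (s t) \<le> D * \<bar>t\<bar> ^ k"
    using assms(2) unfolding big_o_at_0_def by blast
  have "norm (u t) \<le> (K * C * D) * \<bar>t\<bar> ^ (j + k)" if "\<bar>t\<bar> \<le> 1" for t
  proof -
    have "norm (u t) \<le> K * (norm (r t) * norm (s t))" using assms(4)[OF that] by (simp add: mult_ac)
    also have "\<dots> \<le> K * ((C * \<bar>t\<bar> ^ j) * (D * \<bar>t\<bar> ^ k))"
      using C D that assms(3) by (intro mult_left_mono mult_mono) auto
    finally show ?thesis by (simp add: power_add mult_ac)
  qed
  then show ?thesis unfolding big_o_at_0_def using C(1) D(1) assms(3)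
    by (intro exI[of _ "K * C * D"]) auto
qed

lemma big_o_at_0_add:
  assumes "big_o_at_0 k r" "big_o_at_0 k s"
  shows "big_o_at_0 k (\<lambda>t. r t + s t)"
proof -
  obtain C where C: "C \<ge> 0" "\<And>t. \<bar>t\<bar> \<le> 1 \<Longrightarrow> norm (r t) \<le> C * \<bar>t\<bar> ^ k"
    using assms(1) unfolding big_o_at_0_def by blast
  obtain D where D: "D \<ge> 0" "\<And>t. \<bar>t\<bar> \<le> 1 \<Longrightarrow> norm (s t) \<le> D * \<bar>t\<bar> ^ k"
    using assms(2) unfolding big_o_at_0_def by blast
  have "norm (r t + s t) \<le> (C + D) * \<bar>t\<bar> ^ k" if "\<bar>t\<bar> \<le> 1" for t
    using norm_triangle_mono[OF C(2)[OF that] D(2)[OF that]] by (simp add: algebra_simps)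
  then show ?thesis unfolding big_o_at_0_def using C(1) D(1) by (intro exI[of _ "C + D"]) auto
qed

lemma big_o_at_0_scale:
  "big_o_at_0 k r \<Longrightarrow> big_o_at_0 k (\<lambda>t. c *\<^sub>R r t)"
  by (rule big_o_at_0_dominated[of k r "\<bar>c\<bar>"]) auto

lemma big_o_at_0_minus: "big_o_at_0 k r \<Longrightarrow> big_o_at_0 k (\<lambda>t. - r t)"
  by (rule big_o_at_0_dominated[of k r 1]) auto

lemma big_o_at_0_diff:
  "big_o_at_0 k r \<Longrightarrow> big_o_at_0 k s \<Longrightarrow> big_o_at_0 k (\<lambda>t. r t - s t)"
  using big_o_at_0_add[OF _ big_o_at_0_minus, of k r s] by simp

lemma big_o_at_0_monom: "big_o_at_0 k (\<lambda>t. (c * t ^ k) *\<^sub>R a)"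
  unfolding big_o_at_0_def
  by (rule exI[of _ "\<bar>c\<bar> * norm a"]) (auto simp: abs_mult power_abs)

lemma big_o_at_0_const: "big_o_at_0 0 (\<lambda>t. a)"
  unfolding big_o_at_0_def by (rule exI[of _ "norm a"]) auto

lemma big_o_at_0_time: "big_o_at_0 k r \<Longrightarrow> big_o_at_0 (Suc k) (\<lambda>t. (c * t) *\<^sub>R r t)"
  using big_o_at_0_product[OF big_o_at_0_monom[of 1 1 "1::real"], of k r "\<bar>c\<bar>" "\<lambda>t. (c * t) *\<^sub>R r t"]
  by (simp add: abs_mult)

lemma big_o_at_0_le:
  assumes "big_o_at_0 k r" "j \<le> k"
  shows "big_o_at_0 j r"
proof -
  obtain C where C: "C \<ge> 0" "\<And>t. \<bar>t\<bar> \<le> 1 \<Longrightarrow> norm (r t) \<le> C * \<bar>t\<bar> ^ k"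
    using assms(1) unfolding big_o_at_0_def by blast
  have "norm (r t) \<le> C * \<bar>t\<bar> ^ j" if "\<bar>t\<bar> \<le> 1" for t
    using C(2)[OF that] mult_left_mono[OF power_decreasing[OF assms(2), of "\<bar>t\<bar>"] C(1)] that by simp
  then show ?thesis unfolding big_o_at_0_def using C(1) by blast
qed

lemma big_o_at_0_half:
  assumes "big_o_at_0 k r"
  shows "big_o_at_0 k (\<lambda>t. r (t / 2))"
proof -
  obtain C where C: "C \<ge> 0" "\<And>t. \<bar>t\<bar> \<le> 1 \<Longrightarrow> norm (r t) \<le> C * \<bar>t\<bar> ^ k"
    using assms(1) unfolding big_o_at_0_def by blast
  have "norm (r (t/2)) \<le> C * \<bar>t\<bar> ^ k" if "\<bar>t\<bar> \<le> 1" for t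
  proof -
    have "norm (r (t/2)) \<le> C * \<bar>t/2\<bar> ^ k" using C(2)[of "t/2"] that by simp
    also have "\<dots> \<le> C * \<bar>t\<bar> ^ k" using C(1) by (intro mult_left_mono power_mono) auto
    finally show ?thesis .
  qed
  then show ?thesis unfolding big_o_at_0_def using C(1) by blast
qed

lemma big_o_at_0_bound:
  assumes "big_o_at_0 k b"
  obtains R where "\<And>t. \<bar>t\<bar> \<le> 1 \<Longrightarrow> norm (b t) \<le> R"
  using big_o_at_0_le[OF assms, of 0] unfolding big_o_at_0_def by auto

text \<open>On a ball the polynomially growing Lipschitz constants of the basis derivatives are
  bounded. One constant then serves the three estimates used in the order calculus: boundedness,
  Lipschitz dependence on the base point, and a quadratic linearization error.\<close>

lemma frechet_derivative_locally_lipschitz: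
  fixes V :: "'a::euclidean_space \<Rightarrow> 'b::real_normed_vector"
  assumes "poly_smooth 1 V"
  obtains K where "K \<ge> 0"
    "\<And>b v. norm b \<le> R \<Longrightarrow> norm (frechet_derivative V (at b) v) \<le> K * norm v"
    "\<And>b c v. norm b \<le> R \<Longrightarrow> norm c \<le> R \<Longrightarrow>
      norm (frechet_derivative V (at b) v - frechet_derivative V (at c) v) \<le> K * norm (b - c) * norm v"
    "\<And>b c. norm b \<le> R \<Longrightarrow> norm c \<le> R \<Longrightarrow>
      norm (V c - V b - frechet_derivative V (at b) (c - b)) \<le> K * norm (c - b) ^ 2"
proof -
  have D: "\<And>x. V differentiable (at x)"
    and P: "\<And>h. poly_lip (\<lambda>x. frechet_derivative V (at x) h)" using assms by auto
  define d where "d i x = frechet_derivative V (at x) i" for i x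
  have "\<forall>i. \<exists>C q. C > 0 \<and> (\<forall>x y. norm (d i x - d i y) \<le> C * (1 + norm x ^ q + norm y ^ q) * norm (x - y))"
    using P unfolding poly_lip_def d_def by metis
  then obtain C q where C: "\<And>i. C i > 0"
    "\<And>i x y. norm (d i x - d i y) \<le> C i * (1 + norm x ^ q i + norm y ^ q i) * norm (x - y)"
    by metis
  define S where "S = \<bar>R\<bar>"
  define k where "k i = C i * (1 + S ^ q i + S ^ q i)" for i
  define A where "A = (\<Sum>i\<in>(Basis::'a set). k i)"
  have k0: "k i \<ge> 0" for i using C(1)[of i] by (simp add: k_def S_def)
  have kA: "k i \<le> A" if "i \<in> Basis" for i
    unfolding A_def by (rule member_le_sum) (use that k0 in auto)
  have A0: "A \<ge> 0" unfolding A_def by (intro sum_nonneg k0)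
  have dA: "norm (d i b - d i c) \<le> A * norm (b - c)" if "i \<in> Basis" "norm b \<le> R" "norm c \<le> R" for i b and c :: 'a
  proof -
    have "norm b ^ q i \<le> S ^ q i" "norm c ^ q i \<le> S ^ q i"
      using that by (auto simp: S_def intro!: power_mono)
    then have "C i * (1 + norm b ^ q i + norm c ^ q i) * norm (b - c) \<le> k i * norm (b - c)"
      unfolding k_def using C(1)[of i] by (intro mult_right_mono mult_left_mono) auto
    also have "\<dots> \<le> A * norm (b - c)" by (intro mult_right_mono kA that) auto
    finally show ?thesis using C(2)[of i b c] by linarith
  qed
  have J: "frechet_derivative V (at b) v = (\<Sum>i\<in>Basis. (v \<bullet> i) *\<^sub>R d i b)" for b v :: 'a
    unfolding d_def by (rule frechet_derivative_Basis[OF D])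
  define n where "n = real DIM('a)"
  define M where "M = (\<Sum>i\<in>(Basis::'a set). norm (d i 0))"
  have M0: "M \<ge> 0" by (simp add: M_def sum_nonneg)
  have n0: "n \<ge> 0" by (simp add: n_def)
  \<comment> \<open>\<open>M + A * S\<close> bounds the basis derivatives on the ball and
    \<open>A\<close> their Lipschitz constants; summing over the basis costs the dimension
    \<open>n\<close>.\<close>
  define K where "K = n * (M + A * S + A)"
  have K0: "K \<ge> 0" using n0 A0 M0 by (simp add: K_def S_def)
  have KA: "n * A \<le> K" unfolding K_def using n0 A0 M0 by (intro mult_left_mono) (auto simp: S_def)
  have b2: "norm (frechet_derivative V (at b) v - frechet_derivative V (at c) v) \<le> K * norm (b - c) * norm v"
    if "norm b \<le> R" "norm c \<le> R" for b c v
  proof -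
    have "frechet_derivative V (at b) v - frechet_derivative V (at c) v = (\<Sum>i\<in>Basis. (v \<bullet> i) *\<^sub>R (d i b - d i c))"
      by (simp add: J sum_subtractf scaleR_diff_right)
    also have "norm \<dots> \<le> n * (A * norm (b - c)) * norm v"
      unfolding n_def by (rule norm_Basis_sum_le) (rule dA[OF _ that])
    also have "\<dots> = (n * A) * (norm (b - c) * norm v)" by simp
    also have "\<dots> \<le> K * (norm (b - c) * norm v)" by (rule mult_right_mono[OF KA]) auto
    finally show ?thesis by (simp add: mult_ac)
  qed
  show ?thesis
  proof (rule that[OF K0 _ b2])
    fix b v :: 'a assume b: "norm b \<le> R"
    then have R0: "0 \<le> R" using norm_ge_zero order_trans by blast
    have "norm (d i b) \<le> M + A * S" if "i \<in> Basis" for i :: 'a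
    proof -
      have "norm (d i b) \<le> norm (d i 0) + norm (d i b - d i 0)"
        by (metis add.commute diff_add_cancel norm_triangle_ineq)
      also have "norm (d i 0) \<le> M" unfolding M_def by (rule member_le_sum) (use that in auto)
      also have "norm (d i b - d i 0) \<le> A * norm (b - 0)" using b R0 by (intro dA that) auto
      also have "\<dots> \<le> A * S" using b A0 by (intro mult_left_mono) (auto simp: S_def)
      finally show ?thesis by simp
    qed
    then have "norm (frechet_derivative V (at b) v) \<le> n * (M + A * S) * norm v"
      unfolding J n_def by (rule norm_Basis_sum_le)
    also have "\<dots> \<le> K * norm v"
      unfolding K_def using n0 A0 by (intro mult_right_mono mult_left_mono) auto
    finally show "norm (frechet_derivative V (at b) v) \<le> K * norm v" .
  next
    fix b c :: 'a assume bc: "norm b \<le> R" "norm c \<le> R"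
    have "norm (V c - V b - frechet_derivative V (at b) (c - b)) \<le> norm (c - b) * (K * norm (c - b))"
    proof (rule differentiable_bound_linearization[of b c "closed_segment b c"])
      show "b + t *\<^sub>R (c - b) \<in> closed_segment b c" if "t \<in> {0..1}" for t
        using that by (auto simp: closed_segment_def algebra_simps intro!: exI[of _ t])
      show "(V has_derivative frechet_derivative V (at z)) (at z within closed_segment b c)" for z
        using D frechet_derivative_works has_derivative_at_withinI by blast
      fix z assume z: "z \<in> closed_segment b c"
      have zR: "norm z \<le> R"
        using z bc closed_segment_subset[of b "cball 0 R" c] by (auto simp: convex_cball)
      have zb: "norm (z - b) \<le> norm (c - b)"
        using segment_bound1[OF z] by (simp add: norm_minus_commute)
      show "onorm (frechet_derivative V (at z) - frechet_derivative V (at b)) \<le> K * norm (c - b)"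
      proof (rule onorm_le)
        fix v
        have "norm ((frechet_derivative V (at z) - frechet_derivative V (at b)) v) \<le> K * norm (z - b) * norm v"
          using b2[OF zR bc(1), of v] by simp
        also have "\<dots> \<le> K * norm (c - b) * norm v"
          using zb K0 by (intro mult_right_mono mult_left_mono) auto
        finally show "norm ((frechet_derivative V (at z) - frechet_derivative V (at b)) v) \<le> K * norm (c - b) * norm v" .
      qed
    qed auto
    then show "norm (V c - V b - frechet_derivative V (at b) (c - b)) \<le> K * norm (c - b) ^ 2"
      by (simp add: power2_eq_square mult_ac)
  qed
qed

lemma big_o_at_0_frechet:
  fixes V :: "'a::euclidean_space \<Rightarrow> 'b::real_normed_vector"
  assumes V: "poly_smooth 1 V" and b: "big_o_at_0 0 b" and e: "big_o_at_0 k e"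
  shows "big_o_at_0 k (\<lambda>t. frechet_derivative V (at (b t)) (e t))"
proof -
  obtain R where R: "\<And>t. \<bar>t\<bar> \<le> 1 \<Longrightarrow> norm (b t) \<le> R" using big_o_at_0_bound[OF b] by blast
  obtain K where K: "K \<ge> 0" "\<And>b v. norm b \<le> R \<Longrightarrow> norm (frechet_derivative V (at b) v) \<le> K * norm v"
    using frechet_derivative_locally_lipschitz[OF V, of R] by metis
  show ?thesis by (rule big_o_at_0_dominated[OF e K(1)]) (intro K(2) R)
qed

lemma big_o_at_0_frechet_diff:
  fixes V :: "'a::euclidean_space \<Rightarrow> 'b::real_normed_vector"
  assumes V: "poly_smooth 1 V" and b: "big_o_at_0 0 b" and c: "big_o_at_0 0 c"
    and bc: "big_o_at_0 j (\<lambda>t. b t - c t)" and e: "big_o_at_0 k e"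
  shows "big_o_at_0 (j + k) (\<lambda>t. frechet_derivative V (at (b t)) (e t) - frechet_derivative V (at (c t)) (e t))"
proof -
  obtain R where R: "\<And>t. \<bar>t\<bar> \<le> 1 \<Longrightarrow> norm (b t) \<le> R" using big_o_at_0_bound[OF b] by blast
  obtain S where S: "\<And>t. \<bar>t\<bar> \<le> 1 \<Longrightarrow> norm (c t) \<le> S" using big_o_at_0_bound[OF c] by blast
  obtain K where K: "K \<ge> 0" "\<And>b c v. norm b \<le> max R S \<Longrightarrow> norm c \<le> max R S \<Longrightarrow>
      norm (frechet_derivative V (at b) v - frechet_derivative V (at c) v) \<le> K * norm (b - c) * norm v"
    using frechet_derivative_locally_lipschitz[OF V, of "max R S"] by metis
  show ?thesis
    by (rule big_o_at_0_product[OF bc e K(1)]) (intro K(2), auto simp: le_max_iff_disj R S)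
qed

lemma big_o_at_0_linearize:
  fixes V :: "'a::euclidean_space \<Rightarrow> 'b::real_normed_vector"
  assumes V: "poly_smooth 1 V" and b: "big_o_at_0 0 b" and e: "big_o_at_0 k e"
  shows "big_o_at_0 (k + k) (\<lambda>t. V (b t + e t) - V (b t) - frechet_derivative V (at (b t)) (e t))"
proof -
  have c: "big_o_at_0 0 (\<lambda>t. b t + e t)" using big_o_at_0_add[OF b big_o_at_0_le[OF e, of 0]] by simp
  obtain R where R: "\<And>t. \<bar>t\<bar> \<le> 1 \<Longrightarrow> norm (b t) \<le> R" using big_o_at_0_bound[OF b] by blast
  obtain S where S: "\<And>t. \<bar>t\<bar> \<le> 1 \<Longrightarrow> norm (b t + e t) \<le> S" using big_o_at_0_bound[OF c] by blast
  obtain K where K: "K \<ge> 0" "\<And>b c. norm b \<le> max R S \<Longrightarrow> norm c \<le> max R S \<Longrightarrow>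
      norm (V c - V b - frechet_derivative V (at b) (c - b)) \<le> K * norm (c - b) ^ 2"
    using frechet_derivative_locally_lipschitz[OF V, of "max R S"] by metis
  show ?thesis
  proof (rule big_o_at_0_product[OF e e K(1)])
    fix t :: real assume "\<bar>t\<bar> \<le> 1"
    then show "norm (V (b t + e t) - V (b t) - frechet_derivative V (at (b t)) (e t)) \<le> K * norm (e t) * norm (e t)"
      using K(2)[of "b t" "b t + e t"] R[of t] S[of t] by (simp add: le_max_iff_disj power2_eq_square mult_ac)
  qed
qed

text \<open>Coefficients are peeled off from below: the constant term is the limit at 0, and the
  rest is divided by t. The bound is required only for nonzero t because that is all the division
  leaves.\<close>

lemma poly_coeffs_eq_0:
  fixes a :: "nat \<Rightarrow> 'a::real_normed_vector"
  assumes "\<And>t. 0 < \<bar>t\<bar> \<Longrightarrow> \<bar>t\<bar> \<le> 1 \<Longrightarrow> norm (\<Sum>i\<le>m. t ^ i *\<^sub>R a i) \<le> C * \<bar>t\<bar> ^ k" "i < k" "i \<le> m"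
  shows "a i = 0"
  using assms
proof (induction k arbitrary: m a i)
  case 0
  then show ?case by simp
next
  case (Suc k)
  define p where "p t = (\<Sum>i\<le>m. t ^ i *\<^sub>R a i)" for t
  have p0: "p 0 = a 0" by (simp add: p_def power_0_left if_distrib[of "\<lambda>x. x *\<^sub>R _"] sum.delta cong: if_cong)
  have "isCont p 0" unfolding p_def by (intro continuous_intros)
  then have "(p \<longlongrightarrow> a 0) (at 0)" by (simp add: isCont_def p0)
  moreover have "(p \<longlongrightarrow> 0) (at 0)"
  proof (rule Lim_null_comparison)
    show "\<forall>\<^sub>F t in at 0. norm (p t) \<le> C * \<bar>t\<bar> ^ Suc k"
      unfolding eventually_at p_def using Suc.prems(1) by (intro exI[of _ 1]) (auto simp: dist_norm)
    have "((\<lambda>t. C * \<bar>t\<bar> ^ Suc k) \<longlongrightarrow> C * \<bar>0\<bar> ^ Suc k) (at 0)" by (intro tendsto_intros)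
    then show "((\<lambda>t. C * \<bar>t\<bar> ^ Suc k) \<longlongrightarrow> 0) (at (0::real))" by simp
  qed
  ultimately have a0: "a 0 = 0" by (rule LIM_unique)
  show ?case
  proof (cases i)
    case 0
    then show ?thesis using a0 by simp
  next
    case (Suc j)
    then obtain n where n: "m = Suc n" using Suc.prems(3) by (cases m) auto
    have "a (Suc j) = 0"
    proof (rule Suc.IH[where m = n and a = "\<lambda>i. a (Suc i)"])
      fix t :: real assume t: "0 < \<bar>t\<bar>" "\<bar>t\<bar> \<le> 1"
      have "(\<Sum>i\<le>m. t ^ i *\<^sub>R a i) = t *\<^sub>R (\<Sum>i\<le>n. t ^ i *\<^sub>R a (Suc i))"
        unfolding n by (subst sum.atMost_Suc_shift) (simp add: a0 scaleR_sum_right)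
      then have "\<bar>t\<bar> * norm (\<Sum>i\<le>n. t ^ i *\<^sub>R a (Suc i)) \<le> \<bar>t\<bar> * (C * \<bar>t\<bar> ^ k)"
        using Suc.prems(1)[OF t] by (simp add: mult_ac)
      then show "norm (\<Sum>i\<le>n. t ^ i *\<^sub>R a (Suc i)) \<le> C * \<bar>t\<bar> ^ k"
        using t(1) by simp
    qed (use Suc.prems Suc n in auto)
    then show ?thesis using Suc by simp
  qed
qed

text \<open>Classical order 4: every stage is compared with the derivative of the exact solution at the
  corresponding node, the quadrature defect being that of Simpson's rule. The stage errors e2, e3, e4
  cancel to leading order in the combination 2 e2 + 2 e3 + e4.\<close>

lemma Psi4_order_4:
  fixes V :: "'a::euclidean_space \<Rightarrow> 'a"
  assumes V: "lipschitz V" and sm: "poly_smooth 3 V"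
  shows "big_o_at_0 5 (\<lambda>t. flow V t x - Psi4 V t x)"
proof -
  have sm1: "poly_smooth 1 V" by (rule poly_smooth_mono[OF sm]) simp
  have "taylor_class 3 (\<lambda>x t. V (flow V t x))"
    by (intro taylor_class_compose[OF sm] taylor_class_mono[OF taylor_class_flow[OF V sm]]) simp
  then obtain C q where C: "C \<ge> 0" "\<And>x. \<exists>a. (\<forall>i\<le>3. norm (a i) \<le> C * (1 + norm x) ^ q) \<and>
     (\<forall>t. norm (V (flow V t x) - (\<Sum>i\<le>3. t ^ i *\<^sub>R a i)) \<le> \<bar>t\<bar> ^ Suc 3 * (C * ((1 + norm x) * exp \<bar>t\<bar>) ^ q))"
    using taylor_class_expansion by blast
  define B where "B s = C * ((1 + norm x) * exp s) ^ q" for s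
  obtain a where a: "\<And>t. norm (V (flow V t x) - (\<Sum>i\<le>3. t ^ i *\<^sub>R a i)) \<le> \<bar>t\<bar> ^ Suc 3 * B \<bar>t\<bar>"
    using C(2)[of x] unfolding B_def by blast
  have B0: "0 \<le> B s" for s using C(1) by (simp add: B_def)
  have Bm: "B r \<le> B s" if "r \<le> s" for r s
    unfolding B_def using that C(1) by (intro mult_left_mono power_mono) auto
  define f where "f t = flow V t x" for t
  define g where "g t = V (f t)" for t
  \<comment> \<open>The vectors \<open>a i\<close> are Taylor coefficients of \<open>g = V\<close>
    along the flow. Integration gives those of the flow itself as \<open>a i / (i + 1)\<close> in
    degree i + 1, so \<open>r5\<close> brings in no new coefficients.\<close>
  define r4 where "r4 t = g t - (a 0 + t *\<^sub>R a 1 + t^2 *\<^sub>R a 2 + t^3 *\<^sub>R a 3)" for t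
  define r5 where "r5 t = f t - (x + t *\<^sub>R a 0 + (t^2/2) *\<^sub>R a 1 + (t^3/3) *\<^sub>R a 2 + (t^4/4) *\<^sub>R a 3)" for t
  have s3: "(\<Sum>i\<le>3. h i) = h 0 + h 1 + h 2 + h (3::nat)" for h :: "nat \<Rightarrow> 'a"
    by (simp add: eval_nat_numeral)
  have n4: "norm (r4 t) \<le> \<bar>t\<bar> ^ 4 * B \<bar>t\<bar>" for t
    using a[of t] by (simp add: s3 r4_def g_def f_def)
  have n5: "norm (r5 t) \<le> \<bar>t\<bar> ^ 5 * B \<bar>t\<bar>" for t
    using taylor_integrate[OF flow_has_vector_derivative[OF V] a Bm B0, of t]
    by (simp add: s3 r5_def f_def flow_0[OF V] eval_nat_numeral add_ac)
  have le1: "c * B \<bar>t\<bar> \<le> B 1 * c" if "\<bar>t\<bar> \<le> 1" "0 \<le> c" for t c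
    using mult_left_mono[OF Bm[OF that(1)] that(2)] by (simp add: mult_ac)
  have r4: "big_o_at_0 4 r4" unfolding big_o_at_0_def
    by (rule exI[of _ "B 1"]) (intro conjI allI impI B0 order_trans[OF n4 le1], auto)
  have r5: "big_o_at_0 5 r5" unfolding big_o_at_0_def
    by (rule exI[of _ "B 1"]) (intro conjI allI impI B0 order_trans[OF n5 le1], auto)
  have f: "f t = x + t *\<^sub>R a 0 + (t^2/2) *\<^sub>R a 1 + (t^3/3) *\<^sub>R a 2 + (t^4/4) *\<^sub>R a 3 + r5 t" for t
    by (simp add: r5_def)
  have g: "g t = a 0 + t *\<^sub>R a 1 + t^2 *\<^sub>R a 2 + t^3 *\<^sub>R a 3 + r4 t" for t
    by (simp add: r4_def)
  have a0: "a 0 = V x" using n4[of 0] by (simp add: r4_def g_def f_def flow_0[OF V])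
  define k2 where "k2 t = V (x + (t/2) *\<^sub>R V x)" for t
  define k3 where "k3 t = V (x + (t/2) *\<^sub>R k2 t)" for t
  define k4 where "k4 t = V (x + t *\<^sub>R k3 t)" for t
  \<comment> \<open>The exact value at the midpoint. Every stage error is linearized with the
    derivative at this one point, so that linear combinations of stage errors can be formed inside a
    single linear map.\<close>
  define b where "b t = f (t/2)" for t
  define J where "J c v = frechet_derivative V (at c) v" for c v
  have r4h: "big_o_at_0 4 (\<lambda>t. r4 (t/2))" by (rule big_o_at_0_half[OF r4])
  have r5h: "big_o_at_0 4 (\<lambda>t. r5 (t/2))" by (rule big_o_at_0_le[OF big_o_at_0_half[OF r5]]) simp
  have r54: "big_o_at_0 4 r5" by (rule big_o_at_0_le[OF r5]) simp
  note mon = big_o_at_0_le[OF big_o_at_0_monom]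
  have fO: "big_o_at_0 1 (\<lambda>t. f t - x)"
  proof -
    have "big_o_at_0 1 (\<lambda>t. (1 * t^1) *\<^sub>R a 0 + ((1/2) * t^2) *\<^sub>R a 1 + ((1/3) * t^3) *\<^sub>R a 2 + ((1/4) * t^4) *\<^sub>R a 3 + r5 t)"
      by (intro big_o_at_0_add mon big_o_at_0_le[OF r5]) auto
    then show ?thesis by (simp add: f)
  qed
  have bO: "big_o_at_0 1 (\<lambda>t. b t - x)" using big_o_at_0_half[OF fO] by (simp add: b_def)
  have f0: "big_o_at_0 0 f"
    using big_o_at_0_add[OF big_o_at_0_le[OF fO, of 0] big_o_at_0_const[of x]] by simp
  have b0: "big_o_at_0 0 b" unfolding b_def by (rule big_o_at_0_half[OF f0])
  have fb: "big_o_at_0 1 (\<lambda>t. f t - b t)" using big_o_at_0_diff[OF fO bO] by simp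
  define e2 where "e2 t = x + (t/2) *\<^sub>R V x - b t" for t
  define \<delta>2 where "\<delta>2 t = k2 t - g (t/2)" for t
  define \<rho>2 where "\<rho>2 t = e2 t + (t^2/8) *\<^sub>R a 1 + (t^3/24) *\<^sub>R a 2" for t
  have \<rho>2: "big_o_at_0 4 \<rho>2"
  proof -
    have "big_o_at_0 4 (\<lambda>t. ((-1/64) * t^4) *\<^sub>R a 3 - r5 (t/2))"
      by (intro big_o_at_0_diff big_o_at_0_monom r5h)
    moreover have "\<rho>2 t = ((-1/64) * t^4) *\<^sub>R a 3 - r5 (t/2)" for t
      unfolding \<rho>2_def e2_def b_def f a0[symmetric]
      by (rule euclidean_eqI) (simp add: inner_simps algebra_simps power_divide)
    ultimately show ?thesis by presburger
  qed
  have e2: "e2 t = ((-1/8) * t^2) *\<^sub>R a 1 + ((-1/24) * t^3) *\<^sub>R a 2 + \<rho>2 t" for t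
    by (simp add: \<rho>2_def)
  have e2O: "big_o_at_0 2 e2" unfolding e2
    by (intro big_o_at_0_add mon big_o_at_0_le[OF \<rho>2]) auto
  define \<epsilon>2 where "\<epsilon>2 t = \<delta>2 t - J (b t) (e2 t)" for t
  have \<epsilon>2: "big_o_at_0 4 \<epsilon>2"
    using big_o_at_0_linearize[OF sm1 b0 e2O]
    by (simp add: \<epsilon>2_def[abs_def] \<delta>2_def J_def e2_def k2_def g_def b_def)
  have \<delta>2: "\<delta>2 t = J (b t) (e2 t) + \<epsilon>2 t" for t by (simp add: \<epsilon>2_def)
  have JO: "big_o_at_0 k (\<lambda>t. J (b t) (e t))" if "big_o_at_0 k e" for k e
    unfolding J_def by (rule big_o_at_0_frechet[OF sm1 b0 that])
  have \<delta>2O: "big_o_at_0 2 \<delta>2" unfolding \<delta>2 by (intro big_o_at_0_add JO e2O big_o_at_0_le[OF \<epsilon>2]) simp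
  define e3 where "e3 t = x + (t/2) *\<^sub>R k2 t - b t" for t
  define \<delta>3 where "\<delta>3 t = k3 t - g (t/2)" for t
  define \<rho>3 where "\<rho>3 t = e3 t - (t/2) *\<^sub>R \<delta>2 t - (t^2/8) *\<^sub>R a 1 - (t^3/12) *\<^sub>R a 2" for t
  have \<rho>3: "big_o_at_0 4 \<rho>3"
  proof -
    have "big_o_at_0 4 (\<lambda>t. ((3/64) * t^4) *\<^sub>R a 3 + ((1/2) * t) *\<^sub>R r4 (t/2) - r5 (t/2))"
      by (intro big_o_at_0_diff big_o_at_0_add big_o_at_0_monom r5h
          big_o_at_0_le[OF big_o_at_0_time[OF r4h]]) simp
    moreover have "\<rho>3 t = ((3/64) * t^4) *\<^sub>R a 3 + ((1/2) * t) *\<^sub>R r4 (t/2) - r5 (t/2)" for t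
      unfolding \<rho>3_def e3_def \<delta>2_def b_def f g a0[symmetric]
      by (rule euclidean_eqI) (simp add: inner_simps algebra_simps power_divide eval_nat_numeral)
    ultimately show ?thesis by presburger
  qed
  have e3: "e3 t = ((1/2) * t) *\<^sub>R \<delta>2 t + ((1/8) * t^2) *\<^sub>R a 1 + ((1/12) * t^3) *\<^sub>R a 2 + \<rho>3 t" for t
    by (simp add: \<rho>3_def)
  have e3O: "big_o_at_0 2 e3" unfolding e3
    by (intro big_o_at_0_add mon big_o_at_0_le[OF \<rho>3] big_o_at_0_le[OF big_o_at_0_time[OF \<delta>2O]]) auto
  define \<epsilon>3 where "\<epsilon>3 t = \<delta>3 t - J (b t) (e3 t)" for t
  have \<epsilon>3: "big_o_at_0 4 \<epsilon>3"
    using big_o_at_0_linearize[OF sm1 b0 e3O]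
    by (simp add: \<epsilon>3_def[abs_def] \<delta>3_def J_def e3_def k3_def g_def b_def)
  have \<delta>3: "\<delta>3 t = J (b t) (e3 t) + \<epsilon>3 t" for t by (simp add: \<epsilon>3_def)
  have lJ: "linear (J c)" for c
    unfolding J_def using sm1 linear_frechet_derivative[of V "at c"] by (simp add: eta_contract_eq)
  \<comment> \<open>The t^2 terms of \<open>e2\<close> and \<open>e3\<close> are -1/8 and 1/8 times
    \<open>a 1\<close>; their cancellation gains one order.\<close>
  have e23: "big_o_at_0 3 (\<lambda>t. e2 t + e3 t)"
  proof -
    have "big_o_at_0 3 (\<lambda>t. ((1/24) * t^3) *\<^sub>R a 2 + ((1/2) * t) *\<^sub>R \<delta>2 t + \<rho>2 t + \<rho>3 t)"
      by (intro big_o_at_0_add mon big_o_at_0_le[OF \<rho>3] big_o_at_0_le[OF \<rho>2]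
          big_o_at_0_le[OF big_o_at_0_time[OF \<delta>2O]]) auto
    moreover have "e2 t + e3 t = ((1/24) * t^3) *\<^sub>R a 2 + ((1/2) * t) *\<^sub>R \<delta>2 t + \<rho>2 t + \<rho>3 t" for t
      unfolding e2 e3 by (rule euclidean_eqI) (simp add: inner_simps algebra_simps)
    ultimately show ?thesis by presburger
  qed
  have \<delta>23: "big_o_at_0 3 (\<lambda>t. \<delta>2 t + \<delta>3 t)"
  proof -
    have "big_o_at_0 3 (\<lambda>t. J (b t) (e2 t + e3 t) + (\<epsilon>2 t + \<epsilon>3 t))"
      by (intro big_o_at_0_add JO e23 big_o_at_0_le[OF \<epsilon>2] big_o_at_0_le[OF \<epsilon>3]) auto
    then show ?thesis by (simp add: \<delta>2 \<delta>3 linear_add[OF lJ] add_ac)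
  qed
  have \<delta>3O: "big_o_at_0 2 \<delta>3" unfolding \<delta>3 by (intro big_o_at_0_add JO e3O big_o_at_0_le[OF \<epsilon>3]) simp
  define e4 where "e4 t = x + t *\<^sub>R k3 t - f t" for t
  define \<delta>4 where "\<delta>4 t = k4 t - g t" for t
  define \<rho>4 where "\<rho>4 t = e4 t - t *\<^sub>R \<delta>3 t + (t^3/12) *\<^sub>R a 2" for t
  have \<rho>4: "big_o_at_0 4 \<rho>4"
  proof -
    have "big_o_at_0 4 (\<lambda>t. ((-1/8) * t^4) *\<^sub>R a 3 + (1 * t) *\<^sub>R r4 (t/2) - r5 t)"
      by (intro big_o_at_0_diff big_o_at_0_add big_o_at_0_monom r54
          big_o_at_0_le[OF big_o_at_0_time[OF r4h]]) simp
    moreover have "\<rho>4 t = ((-1/8) * t^4) *\<^sub>R a 3 + (1 * t) *\<^sub>R r4 (t/2) - r5 t" for t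
      unfolding \<rho>4_def e4_def \<delta>3_def f g a0[symmetric]
      by (rule euclidean_eqI) (simp add: inner_simps algebra_simps power_divide eval_nat_numeral)
    ultimately show ?thesis by presburger
  qed
  have e4: "e4 t = (1 * t) *\<^sub>R \<delta>3 t + ((-1/12) * t^3) *\<^sub>R a 2 + \<rho>4 t" for t
    by (simp add: \<rho>4_def)
  have e4O: "big_o_at_0 3 e4" unfolding e4
    by (intro big_o_at_0_add mon big_o_at_0_le[OF \<rho>4] big_o_at_0_le[OF big_o_at_0_time[OF \<delta>3O]]) auto
  define \<epsilon>4 where "\<epsilon>4 t = \<delta>4 t - J (b t) (e4 t)" for t
  have \<epsilon>4: "big_o_at_0 4 \<epsilon>4"
  proof -
    \<comment> \<open>The last stage sits at the full time, so its natural linearization point is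
      \<open>f t\<close>. Moving to the midpoint costs the product of \<open>f - b = O(t)\<close>
      and \<open>e4 = O(t^3)\<close>.\<close>
    have "big_o_at_0 6 (\<lambda>t. \<delta>4 t - J (f t) (e4 t))"
      using big_o_at_0_linearize[OF sm1 f0 e4O] by (simp add: \<delta>4_def J_def e4_def k4_def g_def)
    moreover have "big_o_at_0 4 (\<lambda>t. J (f t) (e4 t) - J (b t) (e4 t))"
      using big_o_at_0_frechet_diff[OF sm1 f0 b0 fb e4O] by (simp add: J_def)
    ultimately have "big_o_at_0 4 (\<lambda>t. (\<delta>4 t - J (f t) (e4 t)) + (J (f t) (e4 t) - J (b t) (e4 t)))"
      by (intro big_o_at_0_add) (auto elim: big_o_at_0_le)
    then show ?thesis by (simp add: \<epsilon>4_def[abs_def])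
  qed
  have \<delta>4: "\<delta>4 t = J (b t) (e4 t) + \<epsilon>4 t" for t by (simp add: \<epsilon>4_def)
  \<comment> \<open>In degree 3 the coefficients of \<open>a 2\<close> add up to 2 (-1/24) + 2/12 -
    1/12 = 0. What is left of lower order is t times \<open>\<delta>2 + \<delta>3\<close>, which is
    O(t^4) by the preceding cancellation.\<close>
  have "big_o_at_0 4 (\<lambda>t. (1 * t) *\<^sub>R (\<delta>2 t + \<delta>3 t) + 2 *\<^sub>R \<rho>2 t + 2 *\<^sub>R \<rho>3 t + \<rho>4 t)"
    by (intro big_o_at_0_add big_o_at_0_scale \<rho>2 \<rho>3 \<rho>4 big_o_at_0_le[OF big_o_at_0_time[OF \<delta>23]]) simp
  moreover have "2 *\<^sub>R e2 t + 2 *\<^sub>R e3 t + e4 t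
      = (1 * t) *\<^sub>R (\<delta>2 t + \<delta>3 t) + 2 *\<^sub>R \<rho>2 t + 2 *\<^sub>R \<rho>3 t + \<rho>4 t" for t
    unfolding e2 e3 e4 by (rule euclidean_eqI) (simp add: inner_simps algebra_simps)
  ultimately have e234: "big_o_at_0 4 (\<lambda>t. 2 *\<^sub>R e2 t + 2 *\<^sub>R e3 t + e4 t)" by presburger
  have "big_o_at_0 4 (\<lambda>t. J (b t) (2 *\<^sub>R e2 t + 2 *\<^sub>R e3 t + e4 t) + 2 *\<^sub>R \<epsilon>2 t + 2 *\<^sub>R \<epsilon>3 t + \<epsilon>4 t)"
    by (intro big_o_at_0_add big_o_at_0_scale JO[OF e234] \<epsilon>2 \<epsilon>3 \<epsilon>4)
  moreover have "2 *\<^sub>R \<delta>2 t + 2 *\<^sub>R \<delta>3 t + \<delta>4 t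
      = J (b t) (2 *\<^sub>R e2 t + 2 *\<^sub>R e3 t + e4 t) + 2 *\<^sub>R \<epsilon>2 t + 2 *\<^sub>R \<epsilon>3 t + \<epsilon>4 t" for t
    by (simp add: \<delta>2 \<delta>3 \<delta>4 linear_add[OF lJ] linear_scale[OF lJ] scaleR_add_right)
  ultimately have \<delta>O: "big_o_at_0 4 (\<lambda>t. 2 *\<^sub>R \<delta>2 t + 2 *\<^sub>R \<delta>3 t + \<delta>4 t)" by presburger
  \<comment> \<open>Simpson's rule with weights 1, 4, 1 is exact on cubics, so the polynomial parts
    disappear from the difference; only the remainders and t/6 times the combined stage defects
    survive.\<close>
  have "big_o_at_0 5 (\<lambda>t. r5 t - ((1/6) * t) *\<^sub>R (4 *\<^sub>R r4 (t/2) + r4 t)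
      - ((1/6) * t) *\<^sub>R (2 *\<^sub>R \<delta>2 t + 2 *\<^sub>R \<delta>3 t + \<delta>4 t))"
    by (intro big_o_at_0_diff r5 big_o_at_0_le[OF big_o_at_0_time[of 4]] big_o_at_0_add
        big_o_at_0_scale r4 r4h \<delta>O[simplified]) (simp_all add: \<delta>O)
  moreover have "flow V t x - Psi4 V t x = r5 t - ((1/6) * t) *\<^sub>R (4 *\<^sub>R r4 (t/2) + r4 t)
      - ((1/6) * t) *\<^sub>R (2 *\<^sub>R \<delta>2 t + 2 *\<^sub>R \<delta>3 t + \<delta>4 t)" for t
  proof -
    have "flow V t x = f t" "V x = a 0" by (simp_all add: f_def a0)
    moreover have "Psi4 V t x = x + (t/6) *\<^sub>R (a 0 + 2 *\<^sub>R k2 t + 2 *\<^sub>R k3 t + k4 t)"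
      by (simp add: Psi4_def k2_def k3_def k4_def a0)
    ultimately show ?thesis
      unfolding \<delta>2_def \<delta>3_def \<delta>4_def f[of t] g
      by (simp only:) (rule euclidean_eqI, simp add: inner_simps algebra_simps power_divide eval_nat_numeral)
  qed
  ultimately show ?thesis by presburger
qed

lemma taylor_class_Psi4:
  fixes V :: "'a::euclidean_space \<Rightarrow> 'a"
  assumes sm: "poly_smooth m V"
  shows "taylor_class m (\<lambda>x t. Psi4 V t x)"
proof -
  have x: "taylor_class m (\<lambda>x t. x)" by (intro taylor_class_const pexp_bounded_fst)
  have t: "taylor_class m (\<lambda>x t. c * t)" for c :: real by (rule taylor_class_time)
  have two: "taylor_class m (\<lambda>x t. 2 :: real)" by (intro taylor_class_const pexp_bounded_const)
  note V = taylor_class_compose[OF sm]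
  have "taylor_class m (\<lambda>x t. x + (1/6 * t) *\<^sub>R (V x + 2 *\<^sub>R V (x + (1/2 * t) *\<^sub>R V x)
      + 2 *\<^sub>R V (x + (1/2 * t) *\<^sub>R V (x + (1/2 * t) *\<^sub>R V x))
      + V (x + (1 * t) *\<^sub>R V (x + (1/2 * t) *\<^sub>R V (x + (1/2 * t) *\<^sub>R V x)))))"
    by (intro taylor_class_add taylor_class_scaleR x t two V)
  then show ?thesis by (simp add: Psi4_def)
qed

text \<open>Two kinds of information meet. The Taylor class bounds the coefficients and the degree 6
  remainder uniformly in x, without locating the first nonzero coefficient. The order calculus, with
  constants that depend on x in an uncontrolled way, shows that the coefficients below degree 5
  vanish. Vanishing is insensitive to constants, so the uniform bounds survive.\<close>

lemma Psi4_local_error: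
  fixes V :: "'a::euclidean_space \<Rightarrow> 'a"
  assumes V: "lipschitz V" and sm: "poly_smooth 5 V"
  obtains C q where "C \<ge> 0" "\<And>x. \<exists>c. norm c \<le> C * (1 + norm x) ^ q \<and>
    (\<forall>t. norm (flow V t x - Psi4 V t x - t ^ 5 *\<^sub>R c) \<le> C * \<bar>t\<bar> ^ 6 * ((1 + norm x) * exp \<bar>t\<bar>) ^ q)"
proof -
  have "taylor_class 5 (\<lambda>x t. flow V t x + (-1) *\<^sub>R Psi4 V t x)"
    by (intro taylor_class_add taylor_class_scaleR taylor_class_Psi4 sm
        taylor_class_mono[OF taylor_class_flow[OF V sm]] taylor_class_const pexp_bounded_const) simp
  then obtain C q where C: "C \<ge> 0" "\<And>x. \<exists>a. (\<forall>i\<le>5. norm (a i) \<le> C * (1 + norm x) ^ q) \<and>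
     (\<forall>t. norm (flow V t x + (-1) *\<^sub>R Psi4 V t x - (\<Sum>i\<le>5. t ^ i *\<^sub>R a i)) \<le> \<bar>t\<bar> ^ Suc 5 * (C * ((1 + norm x) * exp \<bar>t\<bar>) ^ q))"
    using taylor_class_expansion by blast
  have "\<exists>c. norm c \<le> C * (1 + norm x) ^ q \<and>
    (\<forall>t. norm (flow V t x - Psi4 V t x - t ^ 5 *\<^sub>R c) \<le> C * \<bar>t\<bar> ^ 6 * ((1 + norm x) * exp \<bar>t\<bar>) ^ q)" for x
  proof -
    obtain a where a: "\<And>i. i \<le> 5 \<Longrightarrow> norm (a i) \<le> C * (1 + norm x) ^ q"
     "\<And>t. norm (flow V t x - Psi4 V t x - (\<Sum>i\<le>5. t ^ i *\<^sub>R a i)) \<le> C * \<bar>t\<bar> ^ 6 * ((1 + norm x) * exp \<bar>t\<bar>) ^ q"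
      using C(2)[of x] by (auto simp: mult_ac)
    have "poly_smooth 3 V" by (rule poly_smooth_mono[OF sm]) simp
    then obtain D where D: "D \<ge> 0" "\<And>t. \<bar>t\<bar> \<le> 1 \<Longrightarrow> norm (flow V t x - Psi4 V t x) \<le> D * \<bar>t\<bar> ^ 5"
      using Psi4_order_4[OF V, of x] unfolding big_o_at_0_def by blast
    define E where "E = C * ((1 + norm x) * exp 1) ^ q"
    have a0: "a i = 0" if "i < 5" for i
    proof (rule poly_coeffs_eq_0[where m = 5 and k = 5 and a = a and C = "D + E"])
      fix t :: real assume t: "0 < \<bar>t\<bar>" "\<bar>t\<bar> \<le> 1"
      have "C * ((1 + norm x) * exp \<bar>t\<bar>) ^ q \<le> E"
        unfolding E_def using t C(1) by (intro mult_left_mono power_mono) auto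
      moreover have "\<bar>t\<bar> ^ 6 \<le> \<bar>t\<bar> ^ 5" using t by (intro power_decreasing) auto
      ultimately have "\<bar>t\<bar> ^ 6 * (C * ((1 + norm x) * exp \<bar>t\<bar>) ^ q) \<le> \<bar>t\<bar> ^ 5 * E"
        using C(1) by (intro mult_mono) auto
      then have "norm (flow V t x - Psi4 V t x - (\<Sum>i\<le>5. t ^ i *\<^sub>R a i)) \<le> E * \<bar>t\<bar> ^ 5"
        using a(2)[of t] by (simp add: mult_ac)
      moreover have "norm (\<Sum>i\<le>5. t ^ i *\<^sub>R a i) \<le> norm (flow V t x - Psi4 V t x)
          + norm (flow V t x - Psi4 V t x - (\<Sum>i\<le>5. t ^ i *\<^sub>R a i))"
        using norm_triangle_sub[of "\<Sum>i\<le>5. t ^ i *\<^sub>R a i" "flow V t x - Psi4 V t x"]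
        by (simp add: norm_minus_commute)
      ultimately show "norm (\<Sum>i\<le>5. t ^ i *\<^sub>R a i) \<le> (D + E) * \<bar>t\<bar> ^ 5"
        using D(2)[OF t(2)] by (simp add: algebra_simps)
    qed (use that in auto)
    have "(\<Sum>i\<le>5. t ^ i *\<^sub>R a i) = t ^ 5 *\<^sub>R a 5" for t
      using a0 by (subst sum.remove[of _ 5]) (auto intro!: sum.neutral)
    then show ?thesis using a by (intro exI[of _ "a 5"]) auto
  qed
  then show ?thesis using that C(1) by blast
qed

section \<open>Gaussian increments and the Lyapunov function\<close>

abbreviation std_gauss :: "real measure" where
  "std_gauss \<equiv> density lborel (\<lambda>x. ennreal (std_normal_density x))"

definition gauss_exp_abs :: "real \<Rightarrow> real" where
  "gauss_exp_abs K = (\<integral>x. std_normal_density x * exp (K * \<bar>x\<bar>) \<partial>lborel)"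

text \<open>Completing the square turns \<open>exp (c * x)\<close> times the standard density into a
  multiple of a shifted normal density; the absolute value is split into the two signs.\<close>

lemma integrable_gauss_exp_abs: "integrable lborel (\<lambda>x. std_normal_density x * exp (K * \<bar>x\<bar>))"
proof -
  have eq: "std_normal_density x * exp (c * x) = exp (c\<^sup>2 / 2) * normal_density c 1 x" for c x :: real
    by (simp add: normal_density_def exp_add[symmetric] power2_eq_square field_simps)
  have i: "integrable lborel (\<lambda>x. std_normal_density x * exp (c * x))" for c
    unfolding eq by (intro integrable_mult_right integrable_normal_density) simp
  have "integrable lborel (\<lambda>x. std_normal_density x * exp (K * x) + std_normal_density x * exp (- K * x))"
    by (intro Bochner_Integration.integrable_add i)
  then show ?thesis
  proof (rule Bochner_Integration.integrable_bound)
    show "(\<lambda>x. std_normal_density x * exp (K * \<bar>x\<bar>)) \<in> borel_measurable lborel" by measurable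
    have "exp (K * \<bar>x\<bar>) \<le> exp (K * x) + exp (- K * x)" for x :: real
      by (cases "0 \<le> x") auto
    then have "std_normal_density x * exp (K * \<bar>x\<bar>)
        \<le> std_normal_density x * exp (K * x) + std_normal_density x * exp (- K * x)" for x
      by (simp add: distrib_left[symmetric] mult_left_mono)
    then show "AE x in lborel. norm (std_normal_density x * exp (K * \<bar>x\<bar>))
      \<le> norm (std_normal_density x * exp (K * x) + std_normal_density x * exp (- K * x))"
      by (auto simp: abs_mult)
  qed
qed

lemma gauss_exp_abs_nonneg: "0 \<le> gauss_exp_abs K"
  unfolding gauss_exp_abs_def by (intro Bochner_Integration.integral_nonneg) auto

text \<open>The first and fifth Gaussian moments vanish, so \<alpha> and \<beta> leave no trace in
  the bound, however large they are. This is the only place where the terms of size sqrt h are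
  averaged away.\<close>

lemma std_gauss_nn_integral_le:
  assumes F: "\<And>x. F x \<le> A + \<alpha> * x + \<beta> * x ^ 5 + B * exp (K * \<bar>x\<bar>)" "\<And>x. 0 \<le> F x"
  shows "(\<integral>\<^sup>+ x. ennreal (F x) \<partial>std_gauss) \<le> ennreal (A + B * gauss_exp_abs K)"
proof -
  define U where "U x = A + \<alpha> * x + \<beta> * x ^ 5 + B * exp (K * \<bar>x\<bar>)" for x
  have U0: "0 \<le> U x" for x using F[of x] by (simp add: U_def)
  have i0: "has_bochner_integral lborel std_normal_density 1"
    using std_normal_moment_even[of 0] by simp
  have i1: "has_bochner_integral lborel (\<lambda>x. std_normal_density x * x) 0"
    using std_normal_moment_odd[of 0] by simp
  have i5: "has_bochner_integral lborel (\<lambda>x. std_normal_density x * x ^ 5) 0"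
    using std_normal_moment_odd[of 2] by simp
  have iK: "has_bochner_integral lborel (\<lambda>x. std_normal_density x * exp (K * \<bar>x\<bar>)) (gauss_exp_abs K)"
    unfolding gauss_exp_abs_def by (rule has_bochner_integral_integrable[OF integrable_gauss_exp_abs])
  have "has_bochner_integral lborel (\<lambda>x. A * std_normal_density x + \<alpha> * (std_normal_density x * x)
      + \<beta> * (std_normal_density x * x ^ 5) + B * (std_normal_density x * exp (K * \<bar>x\<bar>)))
      (A * 1 + \<alpha> * 0 + \<beta> * 0 + B * gauss_exp_abs K)"
    by (intro has_bochner_integral_add has_bochner_integral_mult_right i0 i1 i5 iK)
  then have iU: "has_bochner_integral lborel (\<lambda>x. std_normal_density x * U x) (A + B * gauss_exp_abs K)"
    by (simp add: U_def algebra_simps)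
  have "(\<integral>\<^sup>+ x. ennreal (F x) \<partial>std_gauss) \<le> (\<integral>\<^sup>+ x. ennreal (U x) \<partial>std_gauss)"
    using F by (intro nn_integral_mono ennreal_leI) (simp add: U_def)
  also have "\<dots> = (\<integral>\<^sup>+ x. ennreal (std_normal_density x) * ennreal (U x) \<partial>lborel)"
    unfolding U_def by (rule nn_integral_density) measurable
  also have "\<dots> = (\<integral>\<^sup>+ x. ennreal (std_normal_density x * U x) \<partial>lborel)"
    using U0 by (simp add: ennreal_mult)
  also have "\<dots> = ennreal (A + B * gauss_exp_abs K)"
    using iU U0 by (subst nn_integral_eq_integral)
      (auto simp: has_bochner_integral_iff)
  finally show ?thesis .
qed

section \<open>Expansions of powers of the norm\<close>

lemma power_second_order_le:
  fixes x t R :: real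
  assumes "0 \<le> x" "x \<le> R" "0 \<le> t" "t \<le> R"
  shows "x ^ (n + 2) \<le> t ^ (n + 2) + real (n + 2) * t ^ (n + 1) * (x - t) + (real (n + 2))\<^sup>2 * R ^ n * (x - t)\<^sup>2"
proof (induction n)
  case 0
  have "x\<^sup>2 = t\<^sup>2 + 2 * t * (x - t) + (x - t)\<^sup>2" by (simp add: power2_eq_square algebra_simps)
  moreover have "0 \<le> (x - t)\<^sup>2" by simp
  ultimately have "x\<^sup>2 \<le> t\<^sup>2 + 2 * t * (x - t) + 4 * (x - t)\<^sup>2" by linarith
  then show ?case by (simp add: power2_eq_square)
next
  case (Suc n)
  define c where "c = (real (n + 2))\<^sup>2"
  have "x * x ^ (n + 2) \<le> x * (t ^ (n + 2) + real (n + 2) * t ^ (n + 1) * (x - t) + c * R ^ n * (x - t)\<^sup>2)"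
    unfolding c_def by (rule mult_left_mono[OF Suc assms(1)])
  also have "\<dots> = t ^ (n + 3) + real (n + 3) * t ^ (n + 2) * (x - t)
      + (real (n + 2) * t ^ (n + 1) + c * x * R ^ n) * (x - t)\<^sup>2"
    by (simp add: algebra_simps power2_eq_square eval_nat_numeral)
  also have "\<dots> \<le> t ^ (n + 3) + real (n + 3) * t ^ (n + 2) * (x - t)
      + (real (n + 2) * R ^ (n + 1) + c * R * R ^ n) * (x - t)\<^sup>2"
    using assms by (intro add_left_mono mult_right_mono add_mono mult_left_mono power_mono) (auto simp: c_def)
  also have "\<dots> = t ^ (n + 3) + real (n + 3) * t ^ (n + 2) * (x - t)
      + (real (n + 2) + c) * (R ^ (n + 1) * (x - t)\<^sup>2)"
    by (simp add: algebra_simps)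
  also have "\<dots> \<le> t ^ (n + 3) + real (n + 3) * t ^ (n + 2) * (x - t)
      + (real (n + 3))\<^sup>2 * (R ^ (n + 1) * (x - t)\<^sup>2)"
  proof (intro add_left_mono mult_right_mono)
    \<comment> \<open>The crude constant (n + 2)^2 is chosen for this inequality, which lets the
      induction close.\<close>
    show "real (n + 2) + c \<le> (real (n + 3))\<^sup>2" by (simp add: c_def power2_eq_square algebra_simps)
    show "0 \<le> R ^ (n + 1) * (x - t)\<^sup>2" using assms by simp
  qed
  finally show ?case by (simp add: eval_nat_numeral mult.assoc add.commute)
qed

text \<open>Convexity of the power function. It serves as the lower bound for |y - z|^(2r), which
  enters the Lyapunov function with a negative sign.\<close>

lemma power_tangent_le:
  fixes x t :: real
  assumes "0 \<le> x" "0 \<le> t"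
  shows "t ^ Suc k + real (Suc k) * t ^ k * (x - t) \<le> x ^ Suc k"
proof (induction k)
  case (Suc k)
  have "x * (t ^ Suc k + real (Suc k) * t ^ k * (x - t)) \<le> x * x ^ Suc k"
    by (rule mult_left_mono[OF Suc assms(1)])
  moreover have "x * (t ^ Suc k + real (Suc k) * t ^ k * (x - t))
      = t ^ Suc (Suc k) + real (Suc (Suc k)) * t ^ Suc k * (x - t) + real (Suc k) * t ^ k * (x - t)\<^sup>2"
    by (simp add: algebra_simps power2_eq_square)
  moreover have "0 \<le> real (Suc k) * t ^ k * (x - t)\<^sup>2" using assms by simp
  ultimately show ?case by simp
qed simp

lemma norm_add_square: "(norm (e + \<Delta>))\<^sup>2 = (norm e)\<^sup>2 + (2 * (e \<bullet> \<Delta>) + (norm \<Delta>)\<^sup>2)"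
  for e :: "'a::real_inner"
  by (simp add: power2_norm_eq_inner inner_simps inner_commute)

lemma norm_power_add_ge:
  fixes e \<Delta> :: "'a::real_inner"
  shows "norm e ^ (2 * Suc k) + 2 * real (Suc k) * norm e ^ (2 * k) * (e \<bullet> \<Delta>) \<le> norm (e + \<Delta>) ^ (2 * Suc k)"
proof -
  have "((norm e)\<^sup>2) ^ Suc k + real (Suc k) * ((norm e)\<^sup>2) ^ k * ((norm (e + \<Delta>))\<^sup>2 - (norm e)\<^sup>2)
      \<le> ((norm (e + \<Delta>))\<^sup>2) ^ Suc k"
    by (rule power_tangent_le) auto
  moreover have "real (Suc k) * ((norm e)\<^sup>2) ^ k * (2 * (e \<bullet> \<Delta>))
      \<le> real (Suc k) * ((norm e)\<^sup>2) ^ k * ((norm (e + \<Delta>))\<^sup>2 - (norm e)\<^sup>2)"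
    by (intro mult_left_mono) (auto simp: norm_add_square)
  ultimately have "((norm e)\<^sup>2) ^ Suc k + real (Suc k) * ((norm e)\<^sup>2) ^ k * (2 * (e \<bullet> \<Delta>)) \<le> ((norm (e + \<Delta>))\<^sup>2) ^ Suc k"
    by linarith
  then show ?thesis unfolding power_mult by (simp only: mult_ac)
qed

text \<open>The expansion is made in the squared norm, where it stays polynomial and causes no
  trouble at e = 0. The first-order term is kept as an exact inner product so that its odd part can
  be averaged later. The remainder is expressed through b, which dominates both e and the scale of
  the increment, and is homogeneous in b of the same degree as the power itself.\<close>

lemma norm_power_add_le:
  fixes e \<Delta> :: "'a::real_inner"
  assumes e: "norm e \<le> b" and D: "norm \<Delta> \<le> b * \<delta>" "0 \<le> \<delta>"
  shows "norm (e + \<Delta>) ^ (2 * (n + 2)) \<le> norm e ^ (2 * (n + 2))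
    + 2 * real (n + 2) * norm e ^ (2 * (n + 1)) * (e \<bullet> \<Delta>)
    + 5 * (real (n + 2))\<^sup>2 * b ^ (2 * (n + 2)) * \<delta>\<^sup>2 * (1 + \<delta>) ^ (2 * (n + 1))"
proof -
  have b: "0 \<le> b" using e norm_ge_zero order_trans by blast
  define t where "t = (norm e)\<^sup>2"
  define u where "u = 2 * (e \<bullet> \<Delta>) + (norm \<Delta>)\<^sup>2"
  define R where "R = (b * (1 + \<delta>))\<^sup>2"
  define N where "N = real (n + 2)"
  have N: "2 \<le> N" by (simp add: N_def)
  have "norm (e + \<Delta>) \<le> b + b * \<delta>" by (rule norm_triangle_mono[OF e D(1)])
  then have xR: "(norm (e + \<Delta>))\<^sup>2 \<le> R" unfolding R_def by (intro power_mono) (auto simp: algebra_simps)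
  have "norm e \<le> b * (1 + \<delta>)" using e b D(2) mult_left_mono[of 1 "1 + \<delta>" b] by simp
  then have tR: "t \<le> R" unfolding R_def t_def by (intro power_mono) auto
  have tb: "t \<le> b\<^sup>2" unfolding t_def using e by (intro power_mono) auto
  have D2: "(norm \<Delta>)\<^sup>2 \<le> b\<^sup>2 * \<delta>\<^sup>2"
    using power_mono[OF D(1), of 2] by (simp add: power_mult_distrib)
  have "\<bar>e \<bullet> \<Delta>\<bar> \<le> b * (b * \<delta>)"
    by (rule order_trans[OF Cauchy_Schwarz_ineq2]) (intro mult_mono e D, use b in auto)
  then have "\<bar>u\<bar> \<le> 2 * b\<^sup>2 * \<delta> * (1 + \<delta>)"
  proof -
    have "\<bar>u\<bar> \<le> 2 * \<bar>e \<bullet> \<Delta>\<bar> + (norm \<Delta>)\<^sup>2"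
      unfolding u_def by (rule order_trans[OF abs_triangle_ineq]) (simp add: abs_mult)
    moreover have "0 \<le> b\<^sup>2 * \<delta>\<^sup>2" by simp
    ultimately have "\<bar>u\<bar> \<le> 2 * (b * (b * \<delta>)) + 2 * (b\<^sup>2 * \<delta>\<^sup>2)"
      using D2 \<open>\<bar>e \<bullet> \<Delta>\<bar> \<le> b * (b * \<delta>)\<close> by linarith
    then show ?thesis by (simp add: algebra_simps power2_eq_square)
  qed
  then have "\<bar>u\<bar>\<^sup>2 \<le> (2 * b\<^sup>2 * \<delta> * (1 + \<delta>))\<^sup>2" by (intro power_mono) auto
  then have u2: "u\<^sup>2 \<le> 4 * (b ^ 4 * (\<delta>\<^sup>2 * (1 + \<delta>)\<^sup>2))" by (simp add: power_mult_distrib mult_ac flip: power_mult)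
  have xt: "(norm (e + \<Delta>))\<^sup>2 - t = u" by (simp add: norm_add_square t_def u_def)
  \<comment> \<open>Common majorant of the quadratic terms: \<open>u^2\<close> contributes four
    times \<open>N^2 * Q\<close> and the squared increment once, whence the 5.\<close>
  define Q where "Q = b ^ (2 * (n + 2)) * \<delta>\<^sup>2 * (1 + \<delta>) ^ (2 * (n + 1))"
  have Q0: "0 \<le> Q" using b D(2) by (simp add: Q_def)
  have "((norm (e + \<Delta>))\<^sup>2) ^ (n + 2) \<le> t ^ (n + 2) + N * t ^ (n + 1) * u + N\<^sup>2 * R ^ n * u\<^sup>2"
    using power_second_order_le[of "(norm (e + \<Delta>))\<^sup>2" R t n] xR tR unfolding xt N_def by (simp add: t_def)
  also have "N\<^sup>2 * R ^ n * u\<^sup>2 \<le> N\<^sup>2 * R ^ n * (4 * (b ^ 4 * (\<delta>\<^sup>2 * (1 + \<delta>)\<^sup>2)))"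
    by (intro mult_left_mono u2) (auto simp: R_def)
  also have "\<dots> = 4 * N\<^sup>2 * Q"
  proof -
    have "((b * w)\<^sup>2) ^ n * (b ^ 4 * w\<^sup>2) = b ^ (2 * (n + 2)) * w ^ (2 * (n + 1))" for w
    proof -
      have "((b * w)\<^sup>2) ^ n = b ^ (2 * n) * w ^ (2 * n)"
        by (simp only: power_mult[symmetric] power_mult_distrib)
      moreover have "2 * (n + 2) = 2 * n + 4" "2 * (n + 1) = 2 * n + 2" by simp_all
      then have "b ^ (2 * (n + 2)) = b ^ (2 * n) * b ^ 4" "w ^ (2 * (n + 1)) = w ^ (2 * n) * w\<^sup>2"
        by (simp_all only: power_add)
      ultimately show ?thesis by (simp only: mult_ac)
    qed
    then have "R ^ n * (b ^ 4 * (1 + \<delta>)\<^sup>2) = b ^ (2 * (n + 2)) * (1 + \<delta>) ^ (2 * (n + 1))"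
      unfolding R_def .
    then have "Q = \<delta>\<^sup>2 * (R ^ n * (b ^ 4 * (1 + \<delta>)\<^sup>2))" unfolding Q_def by (simp only: mult_ac)
    then show ?thesis by (simp only: mult_ac)
  qed
  also have "N * t ^ (n + 1) * u = 2 * N * t ^ (n + 1) * (e \<bullet> \<Delta>) + N * t ^ (n + 1) * (norm \<Delta>)\<^sup>2"
    by (simp add: u_def algebra_simps)
  also have "N * t ^ (n + 1) * (norm \<Delta>)\<^sup>2 \<le> N\<^sup>2 * Q"
  proof -
    have "t ^ (n + 1) * (norm \<Delta>)\<^sup>2 \<le> (b\<^sup>2) ^ (n + 1) * (b\<^sup>2 * \<delta>\<^sup>2)"
      using tb D2 by (intro mult_mono power_mono) (auto simp: t_def)
    also have "\<dots> = b ^ (2 * (n + 2)) * \<delta>\<^sup>2 * 1" 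
    proof -
      have "2 * (n + 2) = 2 * (n + 1) + 2" by simp
      then have "b ^ (2 * (n + 2)) = (b\<^sup>2) ^ (n + 1) * b\<^sup>2" by (simp only: power_add power_mult)
      then show ?thesis by (simp only: mult_1_right mult.assoc)
    qed
    also have "\<dots> \<le> Q" unfolding Q_def
      by (rule mult_left_mono[OF one_le_power]) (use b D(2) in auto)
    finally have "N * (t ^ (n + 1) * (norm \<Delta>)\<^sup>2) \<le> N * Q" using N by (intro mult_left_mono) auto
    also have "\<dots> \<le> N\<^sup>2 * Q" using N Q0 by (intro mult_right_mono) (auto simp: power2_eq_square)
    finally show ?thesis by (simp add: mult_ac)
  qed
  finally have "((norm (e + \<Delta>))\<^sup>2) ^ (n + 2) \<le> t ^ (n + 2) + 2 * N * t ^ (n + 1) * (e \<bullet> \<Delta>) + 5 * N\<^sup>2 * Q"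
    by linarith
  then show ?thesis unfolding t_def Q_def N_def power_mult[symmetric] by (simp only: mult_ac)
qed

text \<open>An increment over a time step h, as a function of a standard normal variable: it is of size
  \<open>sqrt h\<close> and, up to a remainder of size h, it consists of odd terms, which have mean zero.\<close>

definition gauss_increment :: "real \<Rightarrow> real \<Rightarrow> real \<Rightarrow> real \<Rightarrow> (real \<Rightarrow> 'a::real_normed_vector) \<Rightarrow> bool" where
  "gauss_increment K C h b \<Delta> \<longleftrightarrow> (\<exists>v1 v5. \<forall>\<xi>. norm (\<Delta> \<xi>) \<le> C * b * sqrt h * exp (K * \<bar>\<xi>\<bar>) \<and>
     norm (\<Delta> \<xi> - \<xi> *\<^sub>R v1 - \<xi> ^ 5 *\<^sub>R v5) \<le> C * b * h * exp (K * \<bar>\<xi>\<bar>))"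

lemma gauss_increment_mono:
  assumes "gauss_increment K C h b \<Delta>" "K \<le> K'" "C \<le> C'" "b \<le> b'" "0 \<le> C" "0 \<le> b" "0 \<le> h"
  shows "gauss_increment K' C' h b' \<Delta>"
proof -
  have "C * b * sqrt h * exp (K * \<bar>\<xi>\<bar>) \<le> C' * b' * sqrt h * exp (K' * \<bar>\<xi>\<bar>)"
    "C * b * h * exp (K * \<bar>\<xi>\<bar>) \<le> C' * b' * h * exp (K' * \<bar>\<xi>\<bar>)" for \<xi>
    using assms by (auto intro!: mult_mono mult_right_mono)
  then show ?thesis using assms(1) unfolding gauss_increment_def by (meson order_trans)
qed

lemma gauss_increment_inner:
  fixes \<Delta> :: "real \<Rightarrow> 'a::real_inner"
  assumes "gauss_increment K C h b \<Delta>" "norm e \<le> b"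
  obtains \<alpha> \<beta> where "\<And>\<xi>. \<bar>e \<bullet> \<Delta> \<xi> - (\<alpha> * \<xi> + \<beta> * \<xi> ^ 5)\<bar> \<le> norm e * (C * b * h * exp (K * \<bar>\<xi>\<bar>))"
proof -
  obtain v1 v5 where v: "\<And>\<xi>. norm (\<Delta> \<xi> - \<xi> *\<^sub>R v1 - \<xi> ^ 5 *\<^sub>R v5) \<le> C * b * h * exp (K * \<bar>\<xi>\<bar>)"
    using assms(1) unfolding gauss_increment_def by blast
  have "\<bar>e \<bullet> \<Delta> \<xi> - ((e \<bullet> v1) * \<xi> + (e \<bullet> v5) * \<xi> ^ 5)\<bar> \<le> norm e * (C * b * h * exp (K * \<bar>\<xi>\<bar>))" for \<xi>
  proof -
    have "e \<bullet> \<Delta> \<xi> - ((e \<bullet> v1) * \<xi> + (e \<bullet> v5) * \<xi> ^ 5) = e \<bullet> (\<Delta> \<xi> - \<xi> *\<^sub>R v1 - \<xi> ^ 5 *\<^sub>R v5)"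
      by (simp add: inner_simps mult_ac)
    then show ?thesis
      by (simp only:) (rule order_trans[OF Cauchy_Schwarz_ineq2 mult_left_mono[OF v norm_ge_zero]])
  qed
  then show ?thesis by (rule that)
qed

text \<open>Up to odd terms and a loss of order h, the power behaves like a submartingale. This is
  the direction required by the term \<open>- a * s\<close> of the Lyapunov function.\<close>

lemma gauss_increment_power_ge:
  fixes \<Delta> :: "real \<Rightarrow> 'a::real_inner"
  assumes G: "gauss_increment K C h b \<Delta>" and e: "norm e \<le> b" and "0 \<le> h" "0 \<le> C" "1 \<le> r" "K \<le> K'"
  obtains \<alpha> \<beta> where "\<And>\<xi>. norm e ^ (2 * r) + \<alpha> * \<xi> + \<beta> * \<xi> ^ 5 - (2 * real r * C) * h * b ^ (2 * r) * exp (K' * \<bar>\<xi>\<bar>)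
     \<le> norm (e + \<Delta> \<xi>) ^ (2 * r)"
proof -
  obtain k where r: "r = Suc k" using \<open>1 \<le> r\<close> by (cases r) auto
  obtain \<alpha> \<beta> where ab: "\<And>\<xi>. \<bar>e \<bullet> \<Delta> \<xi> - (\<alpha> * \<xi> + \<beta> * \<xi> ^ 5)\<bar> \<le> norm e * (C * b * h * exp (K * \<bar>\<xi>\<bar>))"
    using gauss_increment_inner[OF G e] by blast
  have b: "0 \<le> b" using e norm_ge_zero order_trans by blast
  define c where "c = 2 * real r * norm e ^ (2 * k)"
  have c: "0 \<le> c" by (simp add: c_def)
  have "norm e ^ (2 * r) + c * \<alpha> * \<xi> + c * \<beta> * \<xi> ^ 5 - (2 * real r * C) * h * b ^ (2 * r) * exp (K' * \<bar>\<xi>\<bar>)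
     \<le> norm (e + \<Delta> \<xi>) ^ (2 * r)" for \<xi>
  proof -
    have "norm e ^ (2 * k) * norm e \<le> b ^ (2 * k) * b" using e b by (intro mult_mono power_mono) auto
    then have "(norm e ^ (2 * k) * norm e) * (C * b * h * exp (K * \<bar>\<xi>\<bar>)) \<le> (b ^ (2 * k) * b) * (C * b * h * exp (K' * \<bar>\<xi>\<bar>))"
      using assms b by (rule_tac mult_mono) (auto intro!: mult_left_mono mult_right_mono mult_nonneg_nonneg)
    then have "2 * real r * ((norm e ^ (2 * k) * norm e) * (C * b * h * exp (K * \<bar>\<xi>\<bar>)))
        \<le> 2 * real r * ((b ^ (2 * k) * b) * (C * b * h * exp (K' * \<bar>\<xi>\<bar>)))"
      by (rule mult_left_mono) simp
    then have "c * (norm e * (C * b * h * exp (K * \<bar>\<xi>\<bar>))) \<le> (2 * real r * C) * h * b ^ (2 * r) * exp (K' * \<bar>\<xi>\<bar>)"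
      by (simp add: c_def r mult_ac)
    moreover have "c * ((\<alpha> * \<xi> + \<beta> * \<xi> ^ 5) - norm e * (C * b * h * exp (K * \<bar>\<xi>\<bar>))) \<le> c * (e \<bullet> \<Delta> \<xi>)"
      using ab[of \<xi>] c by (intro mult_left_mono) (auto simp: abs_le_iff)
    moreover have "norm e ^ (2 * r) + c * (e \<bullet> \<Delta> \<xi>) \<le> norm (e + \<Delta> \<xi>) ^ (2 * r)"
      using norm_power_add_ge[of e k "\<Delta> \<xi>"] by (simp add: c_def r)
    ultimately show ?thesis by (simp add: algebra_simps)
  qed
  then show ?thesis by (rule that)
qed

lemma gauss_increment_power_le:
  fixes \<Delta> :: "real \<Rightarrow> 'a::real_inner"
  assumes G: "gauss_increment K C h b \<Delta>" and e: "norm e \<le> b" and h: "0 \<le> h" "h \<le> H" and C: "0 \<le> C"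
    and m: "2 \<le> m" and K: "0 \<le> K" "2 * real m * K \<le> K'"
  obtains \<alpha> \<beta> where "\<And>\<xi>. norm (e + \<Delta> \<xi>) ^ (2 * m) \<le> norm e ^ (2 * m) + \<alpha> * \<xi> + \<beta> * \<xi> ^ 5
     + (2 * real m * C + 5 * (real m)\<^sup>2 * C\<^sup>2 * (1 + C * sqrt H) ^ (2 * m)) * h * b ^ (2 * m) * exp (K' * \<bar>\<xi>\<bar>)"
proof -
  obtain n where mn: "m = n + 2" using m by (metis add.commute le_Suc_ex)
  obtain \<alpha> \<beta> where ab: "\<And>\<xi>. \<bar>e \<bullet> \<Delta> \<xi> - (\<alpha> * \<xi> + \<beta> * \<xi> ^ 5)\<bar> \<le> norm e * (C * b * h * exp (K * \<bar>\<xi>\<bar>))"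
    using gauss_increment_inner[OF G e] by blast
  have D: "norm (\<Delta> \<xi>) \<le> b * (C * sqrt h * exp (K * \<bar>\<xi>\<bar>))" for \<xi>
    using G unfolding gauss_increment_def by (auto simp: mult_ac)
  have b: "0 \<le> b" using e norm_ge_zero order_trans by blast
  define c where "c = 2 * real m * norm e ^ (2 * (n + 1))"
  have c: "0 \<le> c" by (simp add: c_def)
  have "norm (e + \<Delta> \<xi>) ^ (2 * m) \<le> norm e ^ (2 * m) + c * \<alpha> * \<xi> + c * \<beta> * \<xi> ^ 5
     + (2 * real m * C + 5 * (real m)\<^sup>2 * C\<^sup>2 * (1 + C * sqrt H) ^ (2 * m)) * h * b ^ (2 * m) * exp (K' * \<bar>\<xi>\<bar>)" for \<xi>
  proof -
    \<comment> \<open>The relative increment is at most a multiple of \<open>M\<close>, and the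
      expansion contains it up to the power 2 m; the rate \<open>K'\<close> is at least 2 m K so
      that \<open>E\<close> dominates \<open>M ^ (2 * m)\<close>.\<close>
    define M where "M = exp (K * \<bar>\<xi>\<bar>)"
    define E where "E = exp (K' * \<bar>\<xi>\<bar>)"
    have M1: "1 \<le> M" using K by (simp add: M_def)
    have ME: "M ^ (2 * m) \<le> E"
    proof -
      have "M ^ (2 * m) = exp (real (2 * m) * (K * \<bar>\<xi>\<bar>))" unfolding M_def by (rule exp_of_nat_mult[symmetric])
      also have "\<dots> = exp ((2 * real m * K) * \<bar>\<xi>\<bar>)" by (simp add: mult_ac)
      also have "\<dots> \<le> E" unfolding E_def using K by (auto intro!: mult_right_mono)
      finally show ?thesis .
    qed
    have M1E: "M \<le> E"
      using self_le_power[OF M1, of "2 * m"] m ME by linarith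
    define \<delta> where "\<delta> = C * sqrt h * M"
    have \<delta>0: "0 \<le> \<delta>" using C h M1 by (simp add: \<delta>_def)
    have \<delta>2: "\<delta>\<^sup>2 = C\<^sup>2 * h * M\<^sup>2" using h by (simp add: \<delta>_def power_mult_distrib)
    have \<delta>1: "1 + \<delta> \<le> (1 + C * sqrt H) * M"
    proof -
      have "C * sqrt h * M \<le> C * sqrt H * M" using C h M1 by (intro mult_right_mono mult_left_mono) auto
      then show ?thesis using M1 by (simp add: \<delta>_def algebra_simps)
    qed
    have S1: "1 \<le> 1 + C * sqrt H" using C h by simp
    have "(1 + \<delta>) ^ (2 * (n + 1)) \<le> ((1 + C * sqrt H) * M) ^ (2 * (n + 1))"
      using \<delta>1 \<delta>0 by (intro power_mono) auto
    also have "\<dots> = (1 + C * sqrt H) ^ (2 * (n + 1)) * M ^ (2 * (n + 1))" by (rule power_mult_distrib)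
    also have "\<dots> \<le> (1 + C * sqrt H) ^ (2 * m) * M ^ (2 * (n + 1))"
      using S1 M1 by (intro mult_right_mono power_increasing) (auto simp: mn)
    finally have "\<delta>\<^sup>2 * (1 + \<delta>) ^ (2 * (n + 1)) \<le> (C\<^sup>2 * h * M\<^sup>2) * ((1 + C * sqrt H) ^ (2 * m) * M ^ (2 * (n + 1)))"
      unfolding \<delta>2 using h by (intro mult_left_mono) auto
    also have "\<dots> = C\<^sup>2 * (1 + C * sqrt H) ^ (2 * m) * h * M ^ (2 * m)"
      by (simp add: mn power_add mult_ac power2_eq_square)
    also have "\<dots> \<le> C\<^sup>2 * (1 + C * sqrt H) ^ (2 * m) * h * E"
      using h S1 by (intro mult_left_mono ME) auto
    finally have "5 * (real m)\<^sup>2 * b ^ (2 * m) * (\<delta>\<^sup>2 * (1 + \<delta>) ^ (2 * (n + 1)))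
        \<le> 5 * (real m)\<^sup>2 * b ^ (2 * m) * (C\<^sup>2 * (1 + C * sqrt H) ^ (2 * m) * h * E)"
      using b by (intro mult_left_mono) auto
    then have q: "5 * (real m)\<^sup>2 * b ^ (2 * m) * \<delta>\<^sup>2 * (1 + \<delta>) ^ (2 * (n + 1))
        \<le> 5 * (real m)\<^sup>2 * C\<^sup>2 * (1 + C * sqrt H) ^ (2 * m) * h * b ^ (2 * m) * E"
      by (simp only: mult_ac)
    have "norm e ^ (2 * (n + 1)) * norm e \<le> b ^ (2 * (n + 1)) * b" using e b by (intro mult_mono power_mono) auto
    then have "(norm e ^ (2 * (n + 1)) * norm e) * (C * b * h * M) \<le> (b ^ (2 * (n + 1)) * b) * (C * b * h * E)"
    proof (rule mult_mono)
      show "C * b * h * M \<le> C * b * h * E" using h C b M1E by (intro mult_left_mono) auto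
      show "0 \<le> C * b * h * M" using h C b M1 by simp
    qed (use b in auto)
    then have "2 * real m * ((norm e ^ (2 * (n + 1)) * norm e) * (C * b * h * M))
        \<le> 2 * real m * ((b ^ (2 * (n + 1)) * b) * (C * b * h * E))"
      by (rule mult_left_mono) simp
    then have l: "c * (norm e * (C * b * h * M)) \<le> 2 * real m * C * h * b ^ (2 * m) * E"
      by (simp add: c_def mn mult_ac)
    have "c * (e \<bullet> \<Delta> \<xi>) \<le> c * ((\<alpha> * \<xi> + \<beta> * \<xi> ^ 5) + norm e * (C * b * h * M))"
      using ab[of \<xi>] c by (intro mult_left_mono) (auto simp: abs_le_iff M_def)
    moreover have "norm (e + \<Delta> \<xi>) ^ (2 * m) \<le> norm e ^ (2 * m) + c * (e \<bullet> \<Delta> \<xi>)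
        + 5 * (real m)\<^sup>2 * b ^ (2 * m) * \<delta>\<^sup>2 * (1 + \<delta>) ^ (2 * (n + 1))"
      using norm_power_add_le[OF e, of "\<Delta> \<xi>" \<delta> n] D[of \<xi>] \<delta>0
      unfolding c_def mn \<delta>_def M_def by simp
    ultimately have "norm (e + \<Delta> \<xi>) ^ (2 * m) \<le> norm e ^ (2 * m) + c * (\<alpha> * \<xi> + \<beta> * \<xi> ^ 5)
        + 2 * real m * C * h * b ^ (2 * m) * E + 5 * (real m)\<^sup>2 * C\<^sup>2 * (1 + C * sqrt H) ^ (2 * m) * h * b ^ (2 * m) * E"
      using q l by (simp add: distrib_left)
    then show ?thesis unfolding E_def[symmetric] by (simp add: algebra_simps)
  qed
  then show ?thesis by (rule that)
qed

text \<open>The state \<open>(a, y, z)\<close> consists of the running maximum \<open>a\<close> of \<open>norm (y - z) ^ (2 * r)\<close>, the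
  exact scheme and the approximate one. The first three terms are the square completed in Doob's
  \<open>L\<^sup>2\<close> maximal inequality: they bound \<open>a\<^sup>2 / 4\<close> from above and do not increase in mean, up to the
  drift, when the maximum is updated.\<close>

definition lyapunov :: "nat \<Rightarrow> nat \<Rightarrow> real \<Rightarrow> real \<times> 'a \<times> 'a::real_normed_vector \<Rightarrow> real" where
  "lyapunov r m \<kappa> = (\<lambda>(a, y, z). a\<^sup>2 / 2 - a * norm (y - z) ^ (2 * r) + norm (y - z) ^ (4 * r)
     + \<kappa> * (1 + norm z ^ (2 * m)))"

text \<open>Two ways of completing the square: a^2/2 - a s + s^2 equals a^2/4 + (a/2 - s)^2 and also
  s^2/2 + (a - s)^2/2.\<close>

lemma lyapunov_ge:
  assumes "0 \<le> \<kappa>"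
  shows "a\<^sup>2 \<le> 4 * lyapunov r m \<kappa> (a, y, z)"
    "norm (y - z) ^ (4 * r) \<le> 2 * lyapunov r m \<kappa> (a, y, z)"
    "\<kappa> * (1 + norm z ^ (2 * m)) \<le> lyapunov r m \<kappa> (a, y, z)"
    "0 \<le> lyapunov r m \<kappa> (a, y, z)"
proof -
  define s where "s = norm (y - z) ^ (2 * r)"
  have s2: "norm (y - z) ^ (4 * r) = s\<^sup>2" by (simp add: s_def power_mult[symmetric] mult.commute)
  define k where "k = \<kappa> * (1 + norm z ^ (2 * m))"
  have k: "0 \<le> k" using assms by (simp add: k_def)
  have eq: "lyapunov r m \<kappa> (a, y, z) = a\<^sup>2 / 2 - a * s + s\<^sup>2 + k"
    by (simp add: lyapunov_def s2 s_def k_def)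
  have "0 \<le> (a - 2 * s)\<^sup>2" "0 \<le> (a - s)\<^sup>2" by simp_all
  then have "a * s \<le> a\<^sup>2 / 4 + s\<^sup>2" "a * s \<le> a\<^sup>2 / 2 + s\<^sup>2 / 2"
    by (simp_all add: power2_eq_square algebra_simps)
  moreover have "0 \<le> a\<^sup>2" "0 \<le> s\<^sup>2" by simp_all
  ultimately have "a\<^sup>2 \<le> 4 * (a\<^sup>2 / 2 - a * s + s\<^sup>2 + k) \<and> s\<^sup>2 \<le> 2 * (a\<^sup>2 / 2 - a * s + s\<^sup>2 + k)
    \<and> k \<le> a\<^sup>2 / 2 - a * s + s\<^sup>2 + k" using k by argo
  note * = this[THEN conjunct1] this[THEN conjunct2, THEN conjunct1] this[THEN conjunct2, THEN conjunct2]
  show "a\<^sup>2 \<le> 4 * lyapunov r m \<kappa> (a, y, z)"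
    "norm (y - z) ^ (4 * r) \<le> 2 * lyapunov r m \<kappa> (a, y, z)"
    "\<kappa> * (1 + norm z ^ (2 * m)) \<le> lyapunov r m \<kappa> (a, y, z)"
    unfolding eq s2 k_def[symmetric] by (rule *)+
  then show "0 \<le> lyapunov r m \<kappa> (a, y, z)" using k unfolding k_def by (rule_tac order_trans)
qed

text \<open>\<gamma> stands for the local error at z relative to the step; the hypothesis on
  \<open>\<gamma> ^ (4 * r)\<close> says that the moment part of the Lyapunov function pays for it.
  The new y is written as the new z plus the new difference, so that only these two increments have
  to be expanded. \<open>D\<close> does not depend on the step size or the state.\<close>

lemma lyapunov_gauss_step:
  fixes K C H G :: real
  assumes K: "0 \<le> K" and C: "0 \<le> C" and H: "0 \<le> H" and G: "0 \<le> G" and r: "1 \<le> r" and m: "2 \<le> m"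
  obtains D where "D \<ge> 0" "\<And>h \<kappa> \<gamma> a (y::'a::real_inner) z \<Delta> \<Gamma>. 0 \<le> h \<Longrightarrow> h \<le> H \<Longrightarrow> 0 \<le> \<kappa> \<Longrightarrow> 0 \<le> \<gamma> \<Longrightarrow> 0 \<le> a \<Longrightarrow>
     \<gamma> ^ (4 * r) \<le> G * \<kappa> * (1 + norm z ^ (2 * m)) \<Longrightarrow>
     gauss_increment K C h (norm (y - z) + \<gamma>) \<Delta> \<Longrightarrow> gauss_increment K C h (1 + norm z) \<Gamma> \<Longrightarrow>
     (\<integral>\<^sup>+ \<xi>. ennreal (lyapunov r m \<kappa> (max a (norm (y - z + \<Delta> \<xi>) ^ (2 * r)), z + \<Gamma> \<xi> + (y - z + \<Delta> \<xi>), z + \<Gamma> \<xi>)) \<partial>std_gauss)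
       \<le> ennreal ((1 + D * h) * lyapunov r m \<kappa> (a, y, z))"
proof -
  \<comment> \<open>An exponential rate that survives raising an increment to the power 4 r, for the
    square of s, and to the power 2 m, for the moments of z.\<close>
  define K' where "K' = max (4 * real r * K) (2 * real m * K)"
  define D1 where "D1 = 2 * real r * C"
  define B where "B n = 2 * real n * C + 5 * (real n)\<^sup>2 * C\<^sup>2 * (1 + C * sqrt H) ^ (2 * n)" for n
  have B0: "0 \<le> B n" for n using C H by (simp add: B_def)
  have D10: "0 \<le> D1" using C by (simp add: D1_def)
  \<comment> \<open>From \<open>b ^ (4 * r)\<close> being at most 2^(4r) times the sum of |e|^(4r),
    at most twice the Lyapunov value, and \<open>\<gamma> ^ (4 * r)\<close>, at most G times
    it.\<close>
  define P where "P = 2 ^ (4 * r) * (2 + G)"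
  define D where "D = (D1 * (4 + P) + B (2 * r) * P + B m * 2 ^ (2 * m)) * gauss_exp_abs K'"
  have P0: "0 \<le> P" using G by (simp add: P_def)
  have D0: "0 \<le> D" unfolding D_def using D10 B0 P0 gauss_exp_abs_nonneg by auto
  show ?thesis
  proof (rule that[OF D0])
    fix h \<kappa> \<gamma> a :: real and y z :: 'a and \<Delta> \<Gamma> :: "real \<Rightarrow> 'a"
    assume h: "0 \<le> h" "h \<le> H" and \<kappa>: "0 \<le> \<kappa>" and \<gamma>: "0 \<le> \<gamma>" and a: "0 \<le> a"
      and \<gamma>G: "\<gamma> ^ (4 * r) \<le> G * \<kappa> * (1 + norm z ^ (2 * m))"
      and \<Delta>: "gauss_increment K C h (norm (y - z) + \<gamma>) \<Delta>"
      and \<Gamma>: "gauss_increment K C h (1 + norm z) \<Gamma>"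
    define e where "e = y - z"
    define b where "b = norm e + \<gamma>"
    have eb: "norm e \<le> b" using \<gamma> by (simp add: b_def)
    have b0: "0 \<le> b" using \<gamma> by (simp add: b_def)
    have \<Delta>: "gauss_increment K C h b \<Delta>" using \<Delta> by (simp add: b_def e_def)
    define L where "L = lyapunov r m \<kappa> (a, y, z)"
    define E where "E \<xi> = exp (K' * \<bar>\<xi>\<bar>)" for \<xi>
    have "4 * real r * K \<le> K'" "2 * real m * K \<le> K'" by (simp_all add: K'_def)
    moreover have "1 * K \<le> 4 * real r * K" using r K by (intro mult_right_mono) auto
    ultimately have K': "K \<le> K'" "2 * real (2 * r) * K \<le> K'" "2 * real m * K \<le> K'" by auto
    obtain \<alpha>1 \<beta>1 where 1: "\<And>\<xi>. norm e ^ (2 * r) + \<alpha>1 * \<xi> + \<beta>1 * \<xi> ^ 5 - D1 * h * b ^ (2 * r) * E \<xi>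
        \<le> norm (e + \<Delta> \<xi>) ^ (2 * r)"
      using gauss_increment_power_ge[OF \<Delta> eb h(1) C r K'(1)] unfolding D1_def E_def by metis
    obtain \<alpha>2 \<beta>2 where 2: "\<And>\<xi>. norm (e + \<Delta> \<xi>) ^ (2 * (2 * r)) \<le> norm e ^ (2 * (2 * r)) + \<alpha>2 * \<xi> + \<beta>2 * \<xi> ^ 5
        + B (2 * r) * h * b ^ (2 * (2 * r)) * E \<xi>"
      using gauss_increment_power_le[OF \<Delta> eb h C _ K(1) K'(2)] r unfolding B_def E_def by (metis mult_2 add_mono one_add_one)
    have "norm z \<le> 1 + norm z" by simp
    from gauss_increment_power_le[OF \<Gamma> this h C m K(1) K'(3)]
    obtain \<alpha>3 \<beta>3 where 3: "\<And>\<xi>. norm (z + \<Gamma> \<xi>) ^ (2 * m) \<le> norm z ^ (2 * m) + \<alpha>3 * \<xi> + \<beta>3 * \<xi> ^ 5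
        + B m * h * (1 + norm z) ^ (2 * m) * E \<xi>"
      unfolding B_def E_def by metis
    define Q where "Q = h * (a * D1 * b ^ (2 * r) + B (2 * r) * b ^ (4 * r) + \<kappa> * B m * (1 + norm z) ^ (2 * m))"
    define F where "F \<xi> = lyapunov r m \<kappa> (max a (norm (y - z + \<Delta> \<xi>) ^ (2 * r)), z + \<Gamma> \<xi> + (y - z + \<Delta> \<xi>), z + \<Gamma> \<xi>)" for \<xi>
    have F: "F \<xi> \<le> L + (\<alpha>2 - a * \<alpha>1 + \<kappa> * \<alpha>3) * \<xi> + (\<beta>2 - a * \<beta>1 + \<kappa> * \<beta>3) * \<xi> ^ 5 + Q * exp (K' * \<bar>\<xi>\<bar>)" for \<xi>
    proof -
      define s where "s = norm (e + \<Delta> \<xi>) ^ (2 * r)"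
      have s2: "norm (e + \<Delta> \<xi>) ^ (4 * r) = s\<^sup>2" by (simp add: s_def power_mult[symmetric] mult.commute)
      have f0: "F \<xi> = (max a s)\<^sup>2 / 2 - max a s * s + s\<^sup>2 + \<kappa> * (1 + norm (z + \<Gamma> \<xi>) ^ (2 * m))"
        unfolding s2[symmetric] unfolding s_def e_def F_def lyapunov_def
        by (simp only: split add_diff_cancel_left')
      \<comment> \<open>As a function of a, the expression a^2/2 - a s is smallest at a = s, so
        raising a to the maximum cannot increase it. From here on a is the old maximum, independent
        of \<xi>, and multiplies the lower bound for s.\<close>
      have f1: "(max a s)\<^sup>2 / 2 - max a s * s \<le> a\<^sup>2 / 2 - a * s"
      proof (cases "a \<le> s")
        case True
        have "0 \<le> (a - s)\<^sup>2" by simp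
        then show ?thesis using True by (simp add: max_def power2_eq_square algebra_simps)
      qed (simp add: max_def)
      have f2: "a * (norm e ^ (2 * r) + \<alpha>1 * \<xi> + \<beta>1 * \<xi> ^ 5 - D1 * h * b ^ (2 * r) * E \<xi>) \<le> a * s"
        unfolding s_def by (rule mult_left_mono[OF 1 a])
      have f3: "s\<^sup>2 \<le> norm e ^ (4 * r) + \<alpha>2 * \<xi> + \<beta>2 * \<xi> ^ 5 + B (2 * r) * h * b ^ (4 * r) * E \<xi>"
        using 2[of \<xi>] by (simp add: s2[symmetric])
      have f4: "\<kappa> * (1 + norm (z + \<Gamma> \<xi>) ^ (2 * m))
          \<le> \<kappa> * (1 + (norm z ^ (2 * m) + \<alpha>3 * \<xi> + \<beta>3 * \<xi> ^ 5 + B m * h * (1 + norm z) ^ (2 * m) * E \<xi>))"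
        by (intro mult_left_mono add_left_mono 3 \<kappa>)
      have "F \<xi> \<le> a\<^sup>2 / 2 - a * (norm e ^ (2 * r) + \<alpha>1 * \<xi> + \<beta>1 * \<xi> ^ 5 - D1 * h * b ^ (2 * r) * E \<xi>)
          + (norm e ^ (4 * r) + \<alpha>2 * \<xi> + \<beta>2 * \<xi> ^ 5 + B (2 * r) * h * b ^ (4 * r) * E \<xi>)
          + \<kappa> * (1 + (norm z ^ (2 * m) + \<alpha>3 * \<xi> + \<beta>3 * \<xi> ^ 5 + B m * h * (1 + norm z) ^ (2 * m) * E \<xi>))"
        unfolding f0 using add_mono[OF add_mono[OF order_trans[OF f1 diff_left_mono[OF f2]] f3] f4] .
      then show ?thesis unfolding E_def[symmetric]
        by (simp add: L_def lyapunov_def Q_def e_def algebra_simps)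
    qed
    have F0: "0 \<le> F \<xi>" for \<xi> unfolding F_def by (rule lyapunov_ge(4)[OF \<kappa>])
    have L: "a\<^sup>2 \<le> 4 * L" "norm e ^ (4 * r) \<le> 2 * L" "\<kappa> * (1 + norm z ^ (2 * m)) \<le> L" "0 \<le> L"
      unfolding L_def e_def using lyapunov_ge[OF \<kappa>] by blast+
    have b4: "b ^ (4 * r) \<le> P * L"
    proof -
      have "b ^ (4 * r) \<le> 2 ^ (4 * r) * (norm e ^ (4 * r) + \<gamma> ^ (4 * r))"
        unfolding b_def using \<gamma> by (intro power_add_le) auto
      also have "\<dots> \<le> 2 ^ (4 * r) * (2 * L + G * L)"
      proof (intro mult_left_mono add_mono L)
        have "\<gamma> ^ (4 * r) \<le> G * (\<kappa> * (1 + norm z ^ (2 * m)))" using \<gamma>G by (simp add: mult_ac)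
        also have "\<dots> \<le> G * L" by (intro mult_left_mono L G)
        finally show "\<gamma> ^ (4 * r) \<le> G * L" .
      qed simp
      finally show ?thesis by (simp add: P_def algebra_simps)
    qed
    have ab: "a * b ^ (2 * r) \<le> (4 + P) * L"
    proof -
      have "(b ^ (2 * r))\<^sup>2 = b ^ (4 * r)" by (simp add: power_mult[symmetric] mult.commute)
      moreover have "0 \<le> (a - b ^ (2 * r))\<^sup>2" by simp
      ultimately have "2 * (a * b ^ (2 * r)) \<le> a\<^sup>2 + b ^ (4 * r)" by (simp add: power2_eq_square algebra_simps)
      also have "\<dots> \<le> 4 * L + P * L" by (intro add_mono L b4)
      finally have "2 * (a * b ^ (2 * r)) \<le> (4 + P) * L" by (simp add: algebra_simps)
      moreover have "0 \<le> a * b ^ (2 * r)" using a b0 by simp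
      ultimately show ?thesis by linarith
    qed
    have zb: "\<kappa> * (1 + norm z) ^ (2 * m) \<le> 2 ^ (2 * m) * L"
    proof -
      have "\<kappa> * (1 + norm z) ^ (2 * m) \<le> \<kappa> * (2 ^ (2 * m) * (1 ^ (2 * m) + norm z ^ (2 * m)))"
        by (intro mult_left_mono power_add_le \<kappa>) auto
      also have "\<dots> = 2 ^ (2 * m) * (\<kappa> * (1 + norm z ^ (2 * m)))" by simp
      also have "\<dots> \<le> 2 ^ (2 * m) * L" by (intro mult_left_mono L) simp
      finally show ?thesis .
    qed
    have "Q = h * (D1 * (a * b ^ (2 * r)) + B (2 * r) * b ^ (4 * r) + B m * (\<kappa> * (1 + norm z) ^ (2 * m)))"
      by (simp add: Q_def mult_ac)
    also have "\<dots> \<le> h * (D1 * ((4 + P) * L) + B (2 * r) * (P * L) + B m * (2 ^ (2 * m) * L))"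
      by (intro mult_left_mono add_mono ab b4 zb B0 D10 h)
    also have "\<dots> = h * (D1 * (4 + P) + B (2 * r) * P + B m * 2 ^ (2 * m)) * L" by (simp add: algebra_simps)
    finally have "Q * gauss_exp_abs K' \<le> h * (D1 * (4 + P) + B (2 * r) * P + B m * 2 ^ (2 * m)) * L * gauss_exp_abs K'"
      by (rule mult_right_mono[OF _ gauss_exp_abs_nonneg])
    then have "L + Q * gauss_exp_abs K' \<le> (1 + D * h) * L"
      by (simp add: D_def algebra_simps)
    then show "(\<integral>\<^sup>+ \<xi>. ennreal (F \<xi>) \<partial>std_gauss) \<le> ennreal ((1 + D * h) * lyapunov r m \<kappa> (a, y, z))"
      unfolding L_def[symmetric] by (intro order_trans[OF std_gauss_nn_integral_le[OF F F0]] ennreal_leI)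
  qed
qed

section \<open>One step of the two schemes\<close>

lemma power_abs_exp_le:
  assumes "real n + c \<le> K"
  shows "\<bar>\<xi>::real\<bar> ^ n * exp (c * \<bar>\<xi>\<bar>) \<le> exp (K * \<bar>\<xi>\<bar>)"
proof -
  have "\<bar>\<xi>\<bar> \<le> exp \<bar>\<xi>\<bar>" using exp_ge_add_one_self[of "\<bar>\<xi>\<bar>"] by linarith
  then have "\<bar>\<xi>\<bar> ^ n \<le> exp \<bar>\<xi>\<bar> ^ n" by (intro power_mono) auto
  then have "\<bar>\<xi>\<bar> ^ n * exp (c * \<bar>\<xi>\<bar>) \<le> exp (real n * \<bar>\<xi>\<bar>) * exp (c * \<bar>\<xi>\<bar>)"
    by (simp add: exp_of_nat_mult)
  also have "\<dots> = exp ((real n + c) * \<bar>\<xi>\<bar>)" by (simp add: exp_add[symmetric] algebra_simps)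
  also have "\<dots> \<le> exp (K * \<bar>\<xi>\<bar>)" using assms by (simp add: mult_right_mono)
  finally show ?thesis .
qed

text \<open>Turns a bound at time t = sqrt h \<xi> into an explicit power of sqrt h; the rate of the
  exponential is bounded through H, uniformly in h.\<close>

lemma scaled_power_exp_le:
  assumes h: "0 \<le> h" "h \<le> H" and c: "0 \<le> c" and K: "real n + c * sqrt H \<le> K"
  shows "\<bar>sqrt h * \<xi>\<bar> ^ n * exp (c * \<bar>sqrt h * \<xi>\<bar>) \<le> sqrt h ^ n * exp (K * \<bar>\<xi>\<bar>)"
proof -
  have "exp (c * \<bar>sqrt h * \<xi>\<bar>) \<le> exp ((c * sqrt H) * \<bar>\<xi>\<bar>)"
    using h c by (auto simp: abs_mult mult.assoc intro!: mult_left_mono mult_right_mono)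
  then have "\<bar>\<xi>\<bar> ^ n * exp (c * \<bar>sqrt h * \<xi>\<bar>) \<le> \<bar>\<xi>\<bar> ^ n * exp ((c * sqrt H) * \<bar>\<xi>\<bar>)"
    by (intro mult_left_mono) auto
  also have "\<dots> \<le> exp (K * \<bar>\<xi>\<bar>)" by (rule power_abs_exp_le[OF K])
  finally have "sqrt h ^ n * (\<bar>\<xi>\<bar> ^ n * exp (c * \<bar>sqrt h * \<xi>\<bar>)) \<le> sqrt h ^ n * exp (K * \<bar>\<xi>\<bar>)"
    using h by (intro mult_left_mono) auto
  then show ?thesis using h by (simp add: abs_mult power_mult_distrib mult_ac)
qed

text \<open>Each stage differs from \<open>V z\<close> by at most a Lipschitz factor times the
  previous stage, and the nested factors are majorized by an exponential. The term linear in t is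
  removed because it is odd; only the rest must be of size t^2.\<close>

lemma Psi4_growth:
  fixes V :: "'a::real_normed_vector \<Rightarrow> 'a"
  assumes L: "L-lipschitz_on UNIV V"
  shows "norm (Psi4 V t z - z - t *\<^sub>R V z) \<le> L * t\<^sup>2 * exp (L * \<bar>t\<bar>) * norm (V z)"
proof -
  define l where "l = L * \<bar>t\<bar>"
  have l0: "0 \<le> l" using lipschitz_on_nonneg[OF L] by (simp add: l_def)
  have e1: "1 + s \<le> exp s" for s :: real by (rule exp_ge_add_one_self)
  have V: "norm (V (z + c *\<^sub>R w) - V z) \<le> L * \<bar>c\<bar> * norm w" for c w
    using lipschitz_onD[OF L, of "z + c *\<^sub>R w" z] by (simp add: dist_norm mult_ac)
  define k where "k = norm (V z)"
  have k: "0 \<le> k" by (simp add: k_def)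
  define k2 where "k2 = V (z + (t/2) *\<^sub>R V z)"
  define k3 where "k3 = V (z + (t/2) *\<^sub>R k2)"
  define k4 where "k4 = V (z + t *\<^sub>R k3)"
  have tri: "norm a \<le> k + norm (a - V z)" for a
    unfolding k_def by (metis add.commute diff_add_cancel norm_triangle_ineq)
  have h: "exp (l / 2) \<le> exp l" using l0 by simp
  have d2: "norm (k2 - V z) \<le> (l / 2) * k" unfolding k2_def k_def l_def using V[of "t/2" "V z"] by simp
  have "norm k2 \<le> (1 + l / 2) * k" using tri[of k2] d2 by (simp add: algebra_simps)
  also have "\<dots> \<le> exp (l / 2) * k" by (intro mult_right_mono e1 k)
  finally have n2: "norm k2 \<le> exp (l / 2) * k" .
  have "norm (k3 - V z) \<le> (l / 2) * norm k2" unfolding k3_def l_def using V[of "t/2" k2] by simp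
  also have "\<dots> \<le> (l / 2) * (exp (l / 2) * k)" using l0 n2 by (intro mult_left_mono) auto
  finally have d3: "norm (k3 - V z) \<le> (l / 2) * (exp (l / 2) * k)" .
  have "norm k3 \<le> (1 + (l / 2) * exp (l / 2)) * k" using tri[of k3] d3 by (simp add: algebra_simps)
  also have "\<dots> \<le> exp l * k"
  proof (rule mult_right_mono[OF _ k])
    have "1 + (l / 2) * exp (l / 2) \<le> (1 + l / 2) * exp (l / 2)" using l0 by (simp add: algebra_simps)
    also have "\<dots> \<le> exp (l / 2) * exp (l / 2)" by (intro mult_right_mono e1) auto
    finally show "1 + (l / 2) * exp (l / 2) \<le> exp l" by (simp add: exp_add[symmetric])
  qed
  finally have n3: "norm k3 \<le> exp l * k" .
  have "norm (k4 - V z) \<le> l * norm k3" unfolding k4_def l_def using V[of t k3] by simp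
  also have "\<dots> \<le> l * (exp l * k)" using l0 n3 by (intro mult_left_mono) auto
  finally have d4: "norm (k4 - V z) \<le> l * (exp l * k)" .
  have d2': "norm (k2 - V z) \<le> l * (exp l * k)"
  proof (rule order_trans[OF d2])
    have "(l / 2) * k \<le> l * (1 * k)" using l0 k by simp
    also have "\<dots> \<le> l * (exp l * k)" using l0 k by (intro mult_left_mono mult_right_mono) auto
    finally show "(l / 2) * k \<le> l * (exp l * k)" .
  qed
  have d3': "norm (k3 - V z) \<le> l * (exp l * k)"
    by (rule order_trans[OF d3], intro mult_mono mult_right_mono h) (use l0 k in auto)
  define Q where "Q = l * (exp l * k)"
  have "Psi4 V t z - z - t *\<^sub>R V z = (t/6) *\<^sub>R (2 *\<^sub>R (k2 - V z) + 2 *\<^sub>R (k3 - V z) + (k4 - V z))"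
  proof -
    have "t *\<^sub>R V z = (t/6) *\<^sub>R (6 *\<^sub>R V z)" by simp
    moreover have "Psi4 V t z - z = (t/6) *\<^sub>R (V z + 2 *\<^sub>R k2 + 2 *\<^sub>R k3 + k4)"
      by (simp add: Psi4_def k2_def k3_def k4_def)
    moreover have "V z + 2 *\<^sub>R k2 + 2 *\<^sub>R k3 + k4 - 6 *\<^sub>R V z
        = 2 *\<^sub>R (k2 - V z) + 2 *\<^sub>R (k3 - V z) + (k4 - V z)"
      using scaleR_add_left[of 2 2 "V z"] scaleR_add_left[of 4 1 "V z"] scaleR_add_left[of 5 1 "V z"]
      by (simp add: scaleR_diff_right)
    ultimately show ?thesis by (simp only: scaleR_diff_right[symmetric])
  qed
  also have "norm \<dots> \<le> (\<bar>t\<bar>/6) * (2 * Q + 2 * Q + Q)"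
    using d2' d3' d4 unfolding norm_scaleR Q_def
    by (intro mult_mono norm_triangle_mono) auto
  also have "\<dots> \<le> \<bar>t\<bar> * Q" using l0 k by (simp add: Q_def)
  finally show ?thesis by (simp add: Q_def l_def k_def power2_eq_square mult_ac)
qed

text \<open>The two parts are the stability-plus-consistency estimate for the difference of an exact and an
  approximate step, and the growth estimate for the approximate step.\<close>

definition step_estimate :: "real \<Rightarrow> real \<Rightarrow> real \<Rightarrow> nat \<Rightarrow> (real \<Rightarrow> real \<Rightarrow> 'a::real_normed_vector \<Rightarrow> 'a) \<Rightarrow>
    (real \<Rightarrow> real \<Rightarrow> 'a \<Rightarrow> 'a) \<Rightarrow> bool" where
  "step_estimate H K C q F G \<longleftrightarrow> (\<forall>h y z. 0 \<le> h \<longrightarrow> h \<le> H \<longrightarrow>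
     gauss_increment K C h (norm (y - z) + h\<^sup>2 * (1 + norm z) ^ q) (\<lambda>\<xi>. F h (sqrt h * \<xi>) y - G h (sqrt h * \<xi>) z - (y - z)) \<and>
     gauss_increment K C h (1 + norm z) (\<lambda>\<xi>. G h (sqrt h * \<xi>) z - z))"

lemma step_estimate_mono:
  assumes "step_estimate H K C q F G" "K \<le> K'" "0 \<le> C" "C \<le> C'" "q \<le> q'"
  shows "step_estimate H K' C' q' F G"
  unfolding step_estimate_def
proof (intro allI impI conjI)
  fix h :: real and y z :: 'a assume h: "0 \<le> h" "h \<le> H"
  have "(1 + norm z) ^ q \<le> (1 + norm z) ^ q'" using assms by (intro power_increasing) auto
  then have "norm (y - z) + h\<^sup>2 * (1 + norm z) ^ q \<le> norm (y - z) + h\<^sup>2 * (1 + norm z) ^ q'"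
    by (intro add_left_mono mult_left_mono) auto
  moreover have g: "gauss_increment K C h (norm (y - z) + h\<^sup>2 * (1 + norm z) ^ q) (\<lambda>\<xi>. F h (sqrt h * \<xi>) y - G h (sqrt h * \<xi>) z - (y - z))"
    "gauss_increment K C h (1 + norm z) (\<lambda>\<xi>. G h (sqrt h * \<xi>) z - z)"
    using assms(1) h unfolding step_estimate_def by blast+
  ultimately show "gauss_increment K' C' h (norm (y - z) + h\<^sup>2 * (1 + norm z) ^ q') (\<lambda>\<xi>. F h (sqrt h * \<xi>) y - G h (sqrt h * \<xi>) z - (y - z))"
    by (intro gauss_increment_mono[OF g(1)] assms h) auto
  show "gauss_increment K' C' h (1 + norm z) (\<lambda>\<xi>. G h (sqrt h * \<xi>) z - z)"
    by (intro gauss_increment_mono[OF g(2)] assms h) auto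
qed

text \<open>Both odd coefficients are 0. A deterministic step of size h also counts as one of size
  sqrt h at the price of the factor sqrt H.\<close>

lemma gauss_increment_deterministic:
  assumes "norm u \<le> C * b * h" "0 \<le> C" "0 \<le> b" "0 \<le> h" "h \<le> H"
  shows "gauss_increment 0 (C * (1 + sqrt H)) h b (\<lambda>\<xi>. u)"
proof -
  have H: "0 \<le> sqrt H" using assms by simp
  have "C * b * h = C * b * sqrt h * sqrt h" using assms by simp
  also have "\<dots> \<le> C * b * sqrt h * (1 + sqrt H)"
    using assms by (intro mult_left_mono) (auto intro: order_trans[of _ "sqrt H"])
  finally have 1: "norm u \<le> (C * (1 + sqrt H)) * b * sqrt h" using assms(1) by (simp add: mult_ac)
  have "C * b * h * 1 \<le> C * b * h * (1 + sqrt H)" using assms H by (intro mult_left_mono) auto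
  then have 2: "norm u \<le> (C * (1 + sqrt H)) * b * h" using assms(1) by (simp add: mult_ac)
  show ?thesis unfolding gauss_increment_def using 1 2
    by (intro exI[of _ 0]) auto
qed

text \<open>The local error h^3 splits as h times h^2 (1 + |z|)^q, the same source term as for the
  diffusion substeps. The Gaussian argument is ignored, so that drift substeps fit the same
  scheme.\<close>

lemma step_estimate_Psi2:
  fixes V :: "'a::euclidean_space \<Rightarrow> 'a"
  assumes V: "lipschitz V" and sm: "poly_smooth 1 V" and H: "0 \<le> H"
  obtains K C q where "0 \<le> K" "0 \<le> C" "step_estimate H K C q (\<lambda>h w. flow V (h/2)) (\<lambda>h w. Psi2 V (h/2))"
proof -
  obtain L where L: "L > 0" "L-lipschitz_on UNIV V" using lipschitz_obtain[OF V] .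
  obtain c q where c: "c \<ge> 0" "\<And>x t. norm (flow V t x - Psi2 V t x) \<le> c * \<bar>t\<bar> ^ 3 * ((1 + norm x) * exp \<bar>t\<bar>) ^ q"
    using Psi2_local_error[OF V sm] by blast
  define k where "k = L + norm (V 0)"
  have k: "k > 0" using L by (simp add: k_def add_pos_nonneg)
  have Vk: "norm (V x) \<le> k * (1 + norm x)" for x unfolding k_def by (rule lipschitz_growth[OF L(2)])
  define C where "C = L * exp (L * H) + c * exp H ^ q + (1 + L * H) * k"
  have C: "0 \<le> C" using L(1) H c k by (simp add: C_def)
  have "step_estimate H 0 (C * (1 + sqrt H)) q (\<lambda>h w. flow V (h/2)) (\<lambda>h w. Psi2 V (h/2))"
    unfolding step_estimate_def
  proof (intro allI impI conjI)
    fix h :: real and y z :: 'a assume h: "0 \<le> h" "h \<le> H"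
    define t where "t = h / 2"
    have t: "0 \<le> t" "t \<le> h" "t \<le> H" "\<bar>t\<bar> = t" using h by (auto simp: t_def)
    define g where "g = (1 + norm z) ^ q"
    have g: "0 \<le> g" by (simp add: g_def)
    have "norm (flow V t y - flow V t z - (y - z)) \<le> L * t * exp (L * t) * norm (y - z)"
      using flow_increment_diff_bound[OF L(2), of t y z] t by simp
    also have "\<dots> \<le> L * h * exp (L * H) * norm (y - z)"
      using t L(1) h by (intro mult_right_mono mult_mono) auto
    finally have 1: "norm (flow V t y - flow V t z - (y - z)) \<le> L * exp (L * H) * norm (y - z) * h"
      by (simp add: mult_ac)
    have "norm (flow V t z - Psi2 V t z) \<le> c * t ^ 3 * (g * exp t ^ q)"
      using c(2)[of t z] t by (simp add: g_def power_mult_distrib)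
    also have "\<dots> \<le> c * h ^ 3 * (g * exp H ^ q)"
      using t c(1) g h by (intro mult_mono mult_left_mono power_mono) auto
    finally have 2: "norm (flow V t z - Psi2 V t z) \<le> c * exp H ^ q * (h\<^sup>2 * g) * h"
      by (simp add: mult_ac power3_eq_cube power2_eq_square)
    have "norm (flow V t y - Psi2 V t z - (y - z)) \<le> norm (flow V t y - flow V t z - (y - z)) + norm (flow V t z - Psi2 V t z)"
      using norm_triangle_ineq[of "flow V t y - flow V t z - (y - z)" "flow V t z - Psi2 V t z"] by (simp add: algebra_simps)
    also have "\<dots> \<le> (L * exp (L * H)) * norm (y - z) * h + (c * exp H ^ q) * (h\<^sup>2 * g) * h"
      using 1 2 by simp
    also have "\<dots> \<le> C * norm (y - z) * h + C * (h\<^sup>2 * g) * h"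
      using h g L(1) H c(1) k by (intro add_mono mult_right_mono) (auto simp: C_def)
    finally have "norm (flow V t y - Psi2 V t z - (y - z)) \<le> C * (norm (y - z) + h\<^sup>2 * g) * h"
      by (simp add: algebra_simps)
    then show "gauss_increment 0 (C * (1 + sqrt H)) h (norm (y - z) + h\<^sup>2 * (1 + norm z) ^ q)
        (\<lambda>\<xi>. flow V (h/2) y - Psi2 V (h/2) z - (y - z))"
      unfolding t_def g_def using C h by (intro gauss_increment_deterministic) auto
    have "norm (V (z + t *\<^sub>R V z)) \<le> norm (V z) + norm (V (z + t *\<^sub>R V z) - V z)"
      by (metis add.commute diff_add_cancel norm_triangle_ineq)
    also have "norm (V (z + t *\<^sub>R V z) - V z) \<le> L * (t * norm (V z))"
      using lipschitz_onD[OF L(2), of "z + t *\<^sub>R V z" z] t by (simp add: dist_norm)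
    also have "\<dots> \<le> L * (H * norm (V z))" using t L(1) by (intro mult_left_mono mult_right_mono) auto
    finally have n: "norm (V (z + t *\<^sub>R V z)) \<le> (1 + L * H) * norm (V z)" by (simp add: algebra_simps)
    have n0: "norm (V z) \<le> (1 + L * H) * norm (V z)"
      using L(1) H mult_right_mono[of 1 "1 + L * H" "norm (V z)"] by simp
    have "Psi2 V t z - z = (t/2) *\<^sub>R (V z + V (z + t *\<^sub>R V z))"
      by (simp add: Psi2_def scaleR_add_right)
    also have "norm \<dots> \<le> (t/2) * ((1 + L * H) * norm (V z) + (1 + L * H) * norm (V z))"
      unfolding norm_scaleR using t n n0 by (intro mult_mono norm_triangle_mono) auto
    also have "\<dots> = (1 + L * H) * norm (V z) * t" by simp
    also have "\<dots> \<le> (1 + L * H) * (k * (1 + norm z)) * h"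
      using t Vk L(1) H k by (intro mult_mono mult_left_mono) auto
    also have "\<dots> \<le> C * (1 + norm z) * h"
      using h L(1) H c(1) k by (subst mult.assoc[symmetric], intro mult_right_mono) (auto simp: C_def)
    finally show "gauss_increment 0 (C * (1 + sqrt H)) h (1 + norm z) (\<lambda>\<xi>. Psi2 V (h/2) z - z)"
      unfolding t_def using C h by (intro gauss_increment_deterministic) auto
  qed
  then show ?thesis using C H by (intro that[of 0 "C * (1 + sqrt H)"]) auto
qed

lemma sqrt_power_5: "0 \<le> h \<Longrightarrow> sqrt h ^ 5 = h\<^sup>2 * sqrt h"
  by (simp add: eval_nat_numeral mult_ac)

lemma sqrt_power_6: "0 \<le> h \<Longrightarrow> sqrt h ^ 6 = h\<^sup>2 * h"
  by (simp add: eval_nat_numeral mult_ac)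

text \<open>The exact flow started at z is inserted between the two steps. Stability handles y
  against z. With t = sqrt h \<xi>, the local error consists of t^5 v, of size sqrt h times h^2 and
  odd in \<xi>, and a remainder t^6 of size h times h^2: precisely the two levels of a Gaussian
  increment.\<close>

lemma step_estimate_Psi4:
  fixes V :: "'a::euclidean_space \<Rightarrow> 'a"
  assumes V: "lipschitz V" and sm: "poly_smooth 5 V"
    and W: "lipschitz (\<lambda>x. frechet_derivative V (at x) (V x))" and H: "0 \<le> H"
  obtains K C q where "0 \<le> K" "0 \<le> C" "step_estimate H K C q (\<lambda>h w. flow V w) (\<lambda>h w. Psi4 V w)"
proof -
  obtain L where L: "L > 0" "L-lipschitz_on UNIV V" using lipschitz_obtain[OF V] .
  obtain B where B: "B > 0" "B-lipschitz_on UNIV (\<lambda>x. frechet_derivative V (at x) (V x))"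
    using lipschitz_obtain[OF W] .
  have D: "V differentiable (at x)" for x using poly_smooth_mono[OF sm, of 1] by simp
  obtain c q where c: "c \<ge> 0" "\<And>x. \<exists>v. norm v \<le> c * (1 + norm x) ^ q \<and>
    (\<forall>t. norm (flow V t x - Psi4 V t x - t ^ 5 *\<^sub>R v) \<le> c * \<bar>t\<bar> ^ 6 * ((1 + norm x) * exp \<bar>t\<bar>) ^ q)"
    using Psi4_local_error[OF V sm] by blast
  define k where "k = L + norm (V 0)"
  have k: "k > 0" using L by (simp add: k_def add_pos_nonneg)
  have Vk: "norm (V x) \<le> k * (1 + norm x)" for x unfolding k_def by (rule lipschitz_growth[OF L(2)])
  define S where "S = sqrt H"
  have S: "0 \<le> S" using H by (simp add: S_def)
  \<comment> \<open>6 covers the highest power of |\<xi>|; the rest covers the rates L of the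
    stability bounds and q of the weight, scaled by sqrt h.\<close>
  define K where "K = 6 + (L + real q) * S"
  define C where "C = L + B + c * (1 + S) + k * (1 + L + L * S)"
  have LS: "0 \<le> L * S" "0 \<le> real q * S" using L S by auto
  have K: "0 \<le> K" using LS by (simp add: K_def algebra_simps)
  have C0: "0 \<le> C" using L(1) B(1) c(1) k S by (simp add: C_def)
  have kC: "k * (1 + L + L * S) \<le> C" "L + B + c * (1 + S) \<le> C"
    using L(1) B(1) c(1) k S by (auto simp: C_def)
  have "step_estimate H K C q (\<lambda>h w. flow V w) (\<lambda>h w. Psi4 V w)"
    unfolding step_estimate_def
  proof (intro allI impI conjI)
    fix h :: real and y z :: 'a assume h: "0 \<le> h" "h \<le> H"
    define g where "g = (1 + norm z) ^ q"
    have g: "0 \<le> g" by (simp add: g_def)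
    define e where "e = norm (y - z)"
    have e: "0 \<le> e" by (simp add: e_def)
    define E where "E \<xi> = exp (K * \<bar>\<xi>\<bar>)" for \<xi>
    have E: "0 \<le> E \<xi>" for \<xi> by (simp add: E_def)
    have sS: "sqrt h \<le> S" using h by (simp add: S_def)
    have sq: "sqrt h * sqrt h = h" using h by simp
    have pe: "\<bar>sqrt h * \<xi>\<bar> ^ n * exp (a * \<bar>sqrt h * \<xi>\<bar>) \<le> sqrt h ^ n * E \<xi>"
      if "0 \<le> a" "real n + a * S \<le> K" for n a \<xi>
      unfolding E_def using scaled_power_exp_le[OF h that(1), of n K \<xi>] that(2) by (simp add: S_def)
    have K1: "real 1 + L * S \<le> K" "real 2 + L * S \<le> K" "real 6 + real q * S \<le> K" "real 5 + 0 * S \<le> K" "real 1 + 0 * S \<le> K"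
      using LS by (simp_all add: K_def algebra_simps)
    obtain v where v: "norm v \<le> c * g"
      "\<And>t. norm (flow V t z - Psi4 V t z - t ^ 5 *\<^sub>R v) \<le> c * \<bar>t\<bar> ^ 6 * ((1 + norm z) * exp \<bar>t\<bar>) ^ q"
      using c(2)[of z] unfolding g_def by blast
    define b where "b = e + h\<^sup>2 * g"
    have eb: "e \<le> b" "h\<^sup>2 * g \<le> b" "0 \<le> b" using e g by (auto simp: b_def)
    define \<Delta> where "\<Delta> \<xi> = flow V (sqrt h * \<xi>) y - Psi4 V (sqrt h * \<xi>) z - (y - z)" for \<xi>
    have r6: "norm (flow V (sqrt h * \<xi>) z - Psi4 V (sqrt h * \<xi>) z - (sqrt h * \<xi>) ^ 5 *\<^sub>R v)
        \<le> c * (h\<^sup>2 * g) * h * E \<xi>" for \<xi>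
    proof -
      have "norm (flow V (sqrt h * \<xi>) z - Psi4 V (sqrt h * \<xi>) z - (sqrt h * \<xi>) ^ 5 *\<^sub>R v)
          \<le> c * g * (\<bar>sqrt h * \<xi>\<bar> ^ 6 * exp (real q * \<bar>sqrt h * \<xi>\<bar>))"
        using v(2)[of "sqrt h * \<xi>"] unfolding power_mult_distrib[of "1 + norm z"] g_def[symmetric] exp_of_nat_mult
        by (simp only: mult_ac)
      also have "\<dots> \<le> c * g * (sqrt h ^ 6 * E \<xi>)"
        using c(1) g K1 by (intro mult_left_mono pe) auto
      finally show ?thesis using h by (simp add: sqrt_power_6 mult_ac)
    qed
    have "norm (\<Delta> \<xi>) \<le> C * b * sqrt h * E \<xi>" for \<xi>
    proof -
      have 1: "norm (flow V (sqrt h * \<xi>) y - flow V (sqrt h * \<xi>) z - (y - z)) \<le> L * b * (sqrt h * E \<xi>)"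
      proof -
        have "norm (flow V (sqrt h * \<xi>) y - flow V (sqrt h * \<xi>) z - (y - z))
            \<le> L * e * (\<bar>sqrt h * \<xi>\<bar> ^ 1 * exp (L * \<bar>sqrt h * \<xi>\<bar>))"
          using flow_increment_diff_bound[OF L(2), of "sqrt h * \<xi>" y z] by (simp add: e_def mult_ac)
        also have "\<dots> \<le> L * b * (sqrt h ^ 1 * E \<xi>)"
          using L(1) e eb K1 by (intro mult_mono mult_left_mono pe) auto
        finally show ?thesis by simp
      qed
      have 2: "norm ((sqrt h * \<xi>) ^ 5 *\<^sub>R v) \<le> c * b * (sqrt h * E \<xi>)"
      proof -
        have "norm ((sqrt h * \<xi>) ^ 5 *\<^sub>R v) = (\<bar>sqrt h * \<xi>\<bar> ^ 5 * exp (0 * \<bar>sqrt h * \<xi>\<bar>)) * norm v"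
          by (simp add: power_abs)
        also have "\<dots> \<le> (sqrt h ^ 5 * E \<xi>) * (c * g)"
          using h E K1 by (intro mult_mono pe v) auto
        also have "\<dots> = (c * (sqrt h * E \<xi>)) * (h\<^sup>2 * g)" using h by (simp add: sqrt_power_5 mult_ac)
        also have "\<dots> \<le> (c * (sqrt h * E \<xi>)) * b" using c(1) h E by (intro mult_left_mono eb) auto
        finally show ?thesis by (simp add: mult_ac)
      qed
      have 3: "norm (flow V (sqrt h * \<xi>) z - Psi4 V (sqrt h * \<xi>) z - (sqrt h * \<xi>) ^ 5 *\<^sub>R v) \<le> c * S * b * (sqrt h * E \<xi>)"
      proof (rule order_trans[OF r6])
        have "c * (h\<^sup>2 * g) * h * E \<xi> = (c * (sqrt h * E \<xi>)) * ((h\<^sup>2 * g) * sqrt h)"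
          proof -
          have "(c * (sqrt h * E \<xi>)) * ((h\<^sup>2 * g) * sqrt h) = c * (h\<^sup>2 * g) * (sqrt h * sqrt h) * E \<xi>"
            by (simp only: mult_ac)
          then show ?thesis unfolding sq by (rule sym)
        qed
        also have "\<dots> \<le> (c * (sqrt h * E \<xi>)) * (b * S)"
          using c(1) h E eb sS g by (intro mult_left_mono mult_mono) auto
        finally show "c * (h\<^sup>2 * g) * h * E \<xi> \<le> c * S * b * (sqrt h * E \<xi>)" by (simp add: mult_ac)
      qed
      have "\<Delta> \<xi> = (flow V (sqrt h * \<xi>) y - flow V (sqrt h * \<xi>) z - (y - z)) + (sqrt h * \<xi>) ^ 5 *\<^sub>R v
          + (flow V (sqrt h * \<xi>) z - Psi4 V (sqrt h * \<xi>) z - (sqrt h * \<xi>) ^ 5 *\<^sub>R v)"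
        by (simp add: \<Delta>_def)
      also have "norm \<dots> \<le> L * b * (sqrt h * E \<xi>) + c * b * (sqrt h * E \<xi>) + c * S * b * (sqrt h * E \<xi>)"
        by (intro norm_triangle_mono 1 2 3)
      also have "\<dots> = (L + c * (1 + S)) * (b * (sqrt h * E \<xi>))" by (simp add: algebra_simps)
      also have "\<dots> \<le> C * (b * (sqrt h * E \<xi>))"
        using kC(2) B(1) eb h E by (intro mult_right_mono) auto
      finally show ?thesis by (simp add: mult_ac)
    qed
    \<comment> \<open>The odd part is the linear stability term in \<open>V y - V z\<close> together
      with the leading local error. The second-order stability bound of the flow is what makes the
      remainder of size h |y - z|.\<close>
    moreover have "norm (\<Delta> \<xi> - \<xi> *\<^sub>R (sqrt h *\<^sub>R (V y - V z)) - \<xi> ^ 5 *\<^sub>R (sqrt h ^ 5 *\<^sub>R v)) \<le> C * b * h * E \<xi>" for \<xi>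
    proof -
      have 1: "norm (flow V (sqrt h * \<xi>) y - flow V (sqrt h * \<xi>) z - (y - z) - (sqrt h * \<xi>) *\<^sub>R (V y - V z)) \<le> B * b * (h * E \<xi>)"
      proof -
        have "norm (flow V (sqrt h * \<xi>) y - flow V (sqrt h * \<xi>) z - (y - z) - (sqrt h * \<xi>) *\<^sub>R (V y - V z))
            \<le> B * e * (\<bar>sqrt h * \<xi>\<bar> ^ 2 * exp (L * \<bar>sqrt h * \<xi>\<bar>))"
          using flow_second_order_diff_bound[OF L(2) D B(2), of "sqrt h * \<xi>" y z] by (simp add: e_def mult_ac)
        also have "\<dots> \<le> B * b * (sqrt h ^ 2 * E \<xi>)"
          using B(1) L(1) e eb K1 by (intro mult_mono mult_left_mono pe) auto
        finally show ?thesis using h by simp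
      qed
      have 2: "norm (flow V (sqrt h * \<xi>) z - Psi4 V (sqrt h * \<xi>) z - (sqrt h * \<xi>) ^ 5 *\<^sub>R v) \<le> c * b * (h * E \<xi>)"
      proof (rule order_trans[OF r6])
        have "c * (h\<^sup>2 * g) * (h * E \<xi>) \<le> c * b * (h * E \<xi>)"
          using c(1) h E by (intro mult_right_mono mult_left_mono eb) auto
        then show "c * (h\<^sup>2 * g) * h * E \<xi> \<le> c * b * (h * E \<xi>)" by (simp add: mult_ac)
      qed
      have "\<Delta> \<xi> - \<xi> *\<^sub>R (sqrt h *\<^sub>R (V y - V z)) - \<xi> ^ 5 *\<^sub>R (sqrt h ^ 5 *\<^sub>R v)
          = (flow V (sqrt h * \<xi>) y - flow V (sqrt h * \<xi>) z - (y - z) - (sqrt h * \<xi>) *\<^sub>R (V y - V z))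
          + (flow V (sqrt h * \<xi>) z - Psi4 V (sqrt h * \<xi>) z - (sqrt h * \<xi>) ^ 5 *\<^sub>R v)"
        by (simp add: \<Delta>_def power_mult_distrib mult.commute)
      also have "norm \<dots> \<le> B * b * (h * E \<xi>) + c * b * (h * E \<xi>)"
        by (intro norm_triangle_mono 1 2)
      also have "\<dots> = (B + c) * (b * (h * E \<xi>))" by (simp add: algebra_simps)
      also have "\<dots> \<le> C * (b * (h * E \<xi>))"
      proof (rule mult_right_mono)
        have "0 \<le> c * S" using c(1) S by simp
        then show "B + c \<le> C" using kC(2) L(1) by (simp add: algebra_simps)
      qed (use eb h E in auto)
      finally show ?thesis by (simp add: mult_ac)
    qed
    ultimately show "gauss_increment K C h (norm (y - z) + h\<^sup>2 * (1 + norm z) ^ q)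
        (\<lambda>\<xi>. flow V (sqrt h * \<xi>) y - Psi4 V (sqrt h * \<xi>) z - (y - z))"
      unfolding gauss_increment_def \<Delta>_def b_def e_def g_def E_def by blast
    define a where "a = 1 + norm z"
    have a: "0 \<le> a" by (simp add: a_def)
    define \<Gamma> where "\<Gamma> \<xi> = Psi4 V (sqrt h * \<xi>) z - z" for \<xi>
    have g2: "norm (\<Gamma> \<xi> - (sqrt h * \<xi>) *\<^sub>R V z) \<le> (k * L) * a * (h * E \<xi>)" for \<xi>
    proof -
      have "norm (\<Gamma> \<xi> - (sqrt h * \<xi>) *\<^sub>R V z) \<le> L * (\<bar>sqrt h * \<xi>\<bar> ^ 2 * exp (L * \<bar>sqrt h * \<xi>\<bar>)) * norm (V z)"
        using Psi4_growth[OF L(2), of "sqrt h * \<xi>" z] by (simp add: \<Gamma>_def mult_ac)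
      also have "\<dots> \<le> L * (sqrt h ^ 2 * E \<xi>) * (k * a)"
        unfolding a_def using L(1) Vk K1 h E by (intro mult_mono mult_left_mono pe) auto
      finally show ?thesis using h by (simp add: mult_ac)
    qed
    have "norm (\<Gamma> \<xi>) \<le> C * a * sqrt h * E \<xi>" for \<xi>
    proof -
      have "norm ((sqrt h * \<xi>) *\<^sub>R V z) = (\<bar>sqrt h * \<xi>\<bar> ^ 1 * exp (0 * \<bar>sqrt h * \<xi>\<bar>)) * norm (V z)" by simp
      also have "\<dots> \<le> (sqrt h ^ 1 * E \<xi>) * (k * a)"
        unfolding a_def using Vk K1 h E by (intro mult_mono pe) auto
      finally have 1: "norm ((sqrt h * \<xi>) *\<^sub>R V z) \<le> k * (a * (sqrt h * E \<xi>))" by (simp add: mult_ac)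
      have "(k * L) * a * (h * E \<xi>) = ((k * L) * (a * (sqrt h * E \<xi>))) * sqrt h"
      proof -
        have "((k * L) * (a * (sqrt h * E \<xi>))) * sqrt h = (k * L) * a * ((sqrt h * sqrt h) * E \<xi>)"
          by (simp only: mult_ac)
        then show ?thesis unfolding sq by (rule sym)
      qed
      also have "\<dots> \<le> ((k * L) * (a * (sqrt h * E \<xi>))) * S"
        using k L(1) a h E by (intro mult_left_mono sS) auto
      finally have 2: "norm (\<Gamma> \<xi> - (sqrt h * \<xi>) *\<^sub>R V z) \<le> k * L * S * (a * (sqrt h * E \<xi>))"
        using g2[of \<xi>] by (simp add: mult_ac)
      have "norm (\<Gamma> \<xi>) \<le> norm ((sqrt h * \<xi>) *\<^sub>R V z) + norm (\<Gamma> \<xi> - (sqrt h * \<xi>) *\<^sub>R V z)"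
        by (metis add.commute diff_add_cancel norm_triangle_ineq)
      also have "\<dots> \<le> (k * (1 + L * S)) * (a * (sqrt h * E \<xi>))" using 1 2 by (simp add: algebra_simps)
      also have "\<dots> \<le> C * (a * (sqrt h * E \<xi>))"
      proof (rule mult_right_mono)
        have "0 \<le> k * L" using k L(1) by simp
        then show "k * (1 + L * S) \<le> C" using kC(1) by (simp add: algebra_simps)
      qed (use a h E in auto)
      finally show ?thesis by (simp add: mult_ac)
    qed
    moreover have "norm (\<Gamma> \<xi> - \<xi> *\<^sub>R (sqrt h *\<^sub>R V z) - \<xi> ^ 5 *\<^sub>R 0) \<le> C * a * h * E \<xi>" for \<xi>
    proof -
      have "k * L \<le> C"
      proof -
        have "0 \<le> k * (L * S)" using k LS by simp
        then show ?thesis using kC(1) k by (simp add: algebra_simps)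
      qed
      then have "(k * L) * (a * (h * E \<xi>)) \<le> C * (a * (h * E \<xi>))" using a h E by (intro mult_right_mono) auto
      then show ?thesis using g2[of \<xi>] by (simp add: mult_ac)
    qed
    ultimately show "gauss_increment K C h (1 + norm z) (\<lambda>\<xi>. Psi4 V (sqrt h * \<xi>) z - z)"
      unfolding gauss_increment_def \<Gamma>_def a_def E_def by blast
  qed
  then show ?thesis using K C0 by (intro that)
qed

text \<open>The maximum is updated after every substep rather than only at grid times, so that all
  substeps have one form; this can only enlarge it.\<close>

definition paired_step :: "nat \<Rightarrow> ('a \<Rightarrow> 'a) \<Rightarrow> ('a \<Rightarrow> 'a) \<Rightarrow> real \<times> 'a \<times> 'a::real_normed_vector \<Rightarrow> real \<times> 'a \<times> 'a" where
  "paired_step r F G = (\<lambda>(a, y, z). (max a (norm (F y - G z) ^ (2 * r)), F y, G z))"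

lemma paired_step_lyapunov:
  fixes r q :: nat
  assumes K: "0 \<le> K" and C: "0 \<le> C" and H: "0 \<le> H" and r: "1 \<le> r" and q: "1 \<le> q"
  obtains D where "D \<ge> 0" "\<And>h F G (s :: real \<times> 'a::real_inner \<times> 'a). 0 \<le> h \<Longrightarrow> h \<le> H \<Longrightarrow> 0 \<le> fst s \<Longrightarrow> step_estimate H K C q F G \<Longrightarrow>
     (\<integral>\<^sup>+ \<xi>. ennreal (lyapunov r (2 * r * q) (h ^ (8 * r)) (paired_step r (F h (sqrt h * \<xi>)) (G h (sqrt h * \<xi>)) s)) \<partial>std_gauss)
       \<le> ennreal ((1 + D * h) * lyapunov r (2 * r * q) (h ^ (8 * r)) s)"
proof -
  \<comment> \<open>This m makes the source match the moment part: (h^2 (1 + |z|)^q)^(4r) = h^(8r)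
    (1 + |z|)^(2m), and separating 1 from |z| costs the factor 2^(2m).\<close>
  define m where "m = 2 * r * q"
  have "1 * 1 \<le> r * q" using r q by (intro mult_mono) auto
  then have m: "2 \<le> m" by (simp add: m_def)
  have G: "0 \<le> (2::real) ^ (2 * m)" by simp
  obtain D where D: "D \<ge> 0" "\<And>h \<kappa> \<gamma> a (y::'a) z \<Delta> \<Gamma>. 0 \<le> h \<Longrightarrow> h \<le> H \<Longrightarrow> 0 \<le> \<kappa> \<Longrightarrow> 0 \<le> \<gamma> \<Longrightarrow> 0 \<le> a \<Longrightarrow>
     \<gamma> ^ (4 * r) \<le> 2 ^ (2 * m) * \<kappa> * (1 + norm z ^ (2 * m)) \<Longrightarrow>
     gauss_increment K C h (norm (y - z) + \<gamma>) \<Delta> \<Longrightarrow> gauss_increment K C h (1 + norm z) \<Gamma> \<Longrightarrow>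
     (\<integral>\<^sup>+ \<xi>. ennreal (lyapunov r m \<kappa> (max a (norm (y - z + \<Delta> \<xi>) ^ (2 * r)), z + \<Gamma> \<xi> + (y - z + \<Delta> \<xi>), z + \<Gamma> \<xi>)) \<partial>std_gauss)
       \<le> ennreal ((1 + D * h) * lyapunov r m \<kappa> (a, y, z))"
    by (rule lyapunov_gauss_step[OF K C H G r m]) (rule that, assumption+)
  show ?thesis
  proof (rule that[OF D(1)])
    fix h :: real and F G :: "real \<Rightarrow> real \<Rightarrow> 'a \<Rightarrow> 'a" and s :: "real \<times> 'a \<times> 'a"
    assume h: "0 \<le> h" "h \<le> H" and s: "0 \<le> fst s" and ok: "step_estimate H K C q F G"
    obtain a y z where ayz: "s = (a, y, z)" by (cases s) auto
    define \<gamma> where "\<gamma> = h\<^sup>2 * (1 + norm z) ^ q"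
    define \<Delta> where "\<Delta> \<xi> = F h (sqrt h * \<xi>) y - G h (sqrt h * \<xi>) z - (y - z)" for \<xi>
    define \<Gamma> where "\<Gamma> \<xi> = G h (sqrt h * \<xi>) z - z" for \<xi>
    have \<gamma>: "\<gamma> ^ (4 * r) \<le> 2 ^ (2 * m) * h ^ (8 * r) * (1 + norm z ^ (2 * m))"
    proof -
      have "(h\<^sup>2) ^ (4 * r) = h ^ (8 * r)" "((1 + norm z) ^ q) ^ (4 * r) = (1 + norm z) ^ (2 * m)"
        by (simp_all add: power_mult[symmetric] m_def mult_ac)
      then have "\<gamma> ^ (4 * r) = h ^ (8 * r) * (1 + norm z) ^ (2 * m)"
        by (simp add: \<gamma>_def power_mult_distrib)
      also have "\<dots> \<le> h ^ (8 * r) * (2 ^ (2 * m) * (1 ^ (2 * m) + norm z ^ (2 * m)))"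
        using h by (intro mult_left_mono power_add_le) auto
      finally show ?thesis by (simp add: mult_ac)
    qed
    have "gauss_increment K C h (norm (y - z) + \<gamma>) \<Delta>" "gauss_increment K C h (1 + norm z) \<Gamma>"
      using ok h unfolding step_estimate_def \<gamma>_def \<Delta>_def \<Gamma>_def by blast+
    from D(2)[OF h _ _ _ \<gamma> this, of a] h s
    have "(\<integral>\<^sup>+ \<xi>. ennreal (lyapunov r m (h ^ (8 * r)) (max a (norm (y - z + \<Delta> \<xi>) ^ (2 * r)), z + \<Gamma> \<xi> + (y - z + \<Delta> \<xi>), z + \<Gamma> \<xi>)) \<partial>std_gauss)
       \<le> ennreal ((1 + D * h) * lyapunov r m (h ^ (8 * r)) (a, y, z))" by (simp add: ayz \<gamma>_def)
    moreover have "paired_step r (F h (sqrt h * \<xi>)) (G h (sqrt h * \<xi>)) s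
        = (max a (norm (y - z + \<Delta> \<xi>) ^ (2 * r)), z + \<Gamma> \<xi> + (y - z + \<Delta> \<xi>), z + \<Gamma> \<xi>)" for \<xi>
      by (simp add: paired_step_def ayz \<Delta>_def \<Gamma>_def)
    ultimately show "(\<integral>\<^sup>+ \<xi>. ennreal (lyapunov r (2 * r * q) (h ^ (8 * r)) (paired_step r (F h (sqrt h * \<xi>)) (G h (sqrt h * \<xi>)) s)) \<partial>std_gauss)
       \<le> ennreal ((1 + D * h) * lyapunov r (2 * r * q) (h ^ (8 * r)) s)"
      by (simp add: m_def ayz)
  qed
qed

section \<open>The coupled Markov chain\<close>

definition diffusion_step :: "(nat \<Rightarrow> 'v::real_normed_vector \<Rightarrow> 'v) \<Rightarrow> nat \<Rightarrow> nat \<Rightarrow> real \<Rightarrow> real \<times> 'v \<times> 'v \<Rightarrow> real \<times> 'v \<times> 'v" where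
  "diffusion_step \<sigma> r j w = paired_step r (flow (\<sigma> j) w) (Psi4 (\<sigma> j) w)"

definition drift_step :: "(nat \<Rightarrow> 'v::real_normed_vector \<Rightarrow> 'v) \<Rightarrow> nat \<Rightarrow> real \<Rightarrow> real \<times> 'v \<times> 'v \<Rightarrow> real \<times> 'v \<times> 'v" where
  "drift_step \<sigma> r h = paired_step r (flow (\<sigma> 0) (h/2)) (Psi2 (\<sigma> 0) (h/2))"

definition full_step :: "(nat \<Rightarrow> 'v::real_normed_vector \<Rightarrow> 'v) \<Rightarrow> nat \<Rightarrow> real \<Rightarrow> nat list \<Rightarrow> (nat \<Rightarrow> real) \<Rightarrow>
    real \<times> 'v \<times> 'v \<Rightarrow> real \<times> 'v \<times> 'v" where
  "full_step \<sigma> r h js dw s =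
     drift_step \<sigma> r h (foldl (\<lambda>s j. diffusion_step \<sigma> r j (dw j) s) (drift_step \<sigma> r h s) js)"

definition step_order :: "nat \<Rightarrow> real \<Rightarrow> nat list" where
  "step_order d e = (if e = 1 then [1..<d+1] else rev [1..<d+1])"

text \<open>Paths and signs are plain arguments instead of random variables: the signs can be
  frozen, and the state can be regarded as a measurable function on a product space.\<close>

primrec nv_state :: "(nat \<Rightarrow> 'v::real_normed_vector \<Rightarrow> 'v) \<Rightarrow> nat \<Rightarrow> nat \<Rightarrow> real \<Rightarrow> nat \<Rightarrow> 'v \<Rightarrow>
    (nat \<Rightarrow> real \<Rightarrow> real) \<Rightarrow> (nat \<Rightarrow> real) \<Rightarrow> nat \<Rightarrow> real \<times> 'v \<times> 'v" where
  "nv_state \<sigma> d r T N x0 w e 0 = (0, x0, x0)"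
| "nv_state \<sigma> d r T N x0 w e (Suc k) = full_step \<sigma> r (T / real N) (step_order d (e (Suc k)))
     (\<lambda>j. w j (real (Suc k) * T / real N) - w j (real k * T / real N)) (nv_state \<sigma> d r T N x0 w e k)"

lemma paired_step_simps [simp]:
  "fst (paired_step r F G s) = max (fst s) (norm (F (fst (snd s)) - G (snd (snd s))) ^ (2 * r))"
  "fst (snd (paired_step r F G s)) = F (fst (snd s))"
  "snd (snd (paired_step r F G s)) = G (snd (snd s))"
  by (simp_all add: paired_step_def split: prod.splits)

lemma distinct_step_order: "distinct (step_order d e)"
  and set_step_order: "set (step_order d e) = {1..d}"
  and length_step_order: "length (step_order d e) = d"
  by (auto simp: step_order_def)

lemma foldl_diffusion_step_components:
  "fst (snd (foldl (\<lambda>s j. diffusion_step \<sigma> r j (dw j) s) s js)) = foldl (\<lambda>y j. flow (\<sigma> j) (dw j) y) (fst (snd s)) js"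
  "snd (snd (foldl (\<lambda>s j. diffusion_step \<sigma> r j (dw j) s) s js)) = foldl (\<lambda>y j. Psi4 (\<sigma> j) (dw j) y) (snd (snd s)) js"
  "fst s \<le> fst (foldl (\<lambda>s j. diffusion_step \<sigma> r j (dw j) s) s js)"
  by (induction js rule: rev_induct) (auto simp: diffusion_step_def)

lemma map_reflect_upt: "map (\<lambda>j. d + 1 - j) [1..<d+1] = rev [1..<d+1]"
  by (rule nth_equalityI) (auto simp: rev_nth simp del: upt_Suc)

text \<open>The approximate scheme needs the sign to be 1 or -1, since otherwise both indicators
  vanish, while the exact one reads every other value as -1. For -1 the reflected indices d + 1 - j
  run through the reversed list.\<close>

lemma full_step_components:
  "fst (snd (full_step \<sigma> r h (step_order d e) dw s)) = nv_step \<sigma> d h dw e (fst (snd s))"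
  "e = 1 \<or> e = -1 \<Longrightarrow> snd (snd (full_step \<sigma> r h (step_order d e) dw s)) = nv_hat_step \<sigma> d h dw e (snd (snd s))"
  "fst s \<le> fst (full_step \<sigma> r h js dw s)"
  "norm (fst (snd (full_step \<sigma> r h js dw s)) - snd (snd (full_step \<sigma> r h js dw s))) ^ (2 * r)
     \<le> fst (full_step \<sigma> r h js dw s)"
proof -
  show "fst (snd (full_step \<sigma> r h (step_order d e) dw s)) = nv_step \<sigma> d h dw e (fst (snd s))"
    by (simp add: full_step_def drift_step_def foldl_diffusion_step_components nv_step_def step_order_def)
  show "norm (fst (snd (full_step \<sigma> r h js dw s)) - snd (snd (full_step \<sigma> r h js dw s))) ^ (2 * r)
     \<le> fst (full_step \<sigma> r h js dw s)"
    by (simp add: full_step_def drift_step_def)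
  have "fst s \<le> fst (drift_step \<sigma> r h s)" by (simp add: drift_step_def)
  also note foldl_diffusion_step_components(3)
  also have "fst u \<le> fst (drift_step \<sigma> r h u)" for u by (simp add: drift_step_def)
  finally show "fst s \<le> fst (full_step \<sigma> r h js dw s)" by (simp add: full_step_def)
  show "snd (snd (full_step \<sigma> r h (step_order d e) dw s)) = nv_hat_step \<sigma> d h dw e (snd (snd s))"
    if "e = 1 \<or> e = -1"
    using that
  proof
    assume "e = 1"
    then show ?thesis
      by (simp add: full_step_def drift_step_def foldl_diffusion_step_components nv_hat_step_def step_order_def)
  next
    assume e: "e = -1"
    have "foldl (\<lambda>y j. Psi4 (\<sigma> j) (dw j) y) z (rev [1..<d+1])
        = foldl (\<lambda>y j. Psi4 (\<sigma> (d+1-j)) (dw (d+1-j)) y) z [1..<d+1]" for z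
      unfolding map_reflect_upt[symmetric] by (rule foldl_map)
    then show ?thesis using e
      by (simp add: full_step_def drift_step_def foldl_diffusion_step_components nv_hat_step_def step_order_def
          del: upt_Suc)
  qed
qed

lemma nv_state_schemes:
  assumes "\<And>k. 1 \<le> k \<Longrightarrow> \<eta> k \<omega> = 1 \<or> \<eta> k \<omega> = -1"
  shows "nv_scheme \<sigma> d T N W \<eta> x0 \<omega> k = fst (snd (nv_state \<sigma> d r T N x0 (\<lambda>j t. W j t \<omega>) (\<lambda>k. \<eta> k \<omega>) k))"
    "nv_hat_scheme \<sigma> d T N W \<eta> x0 \<omega> k = snd (snd (nv_state \<sigma> d r T N x0 (\<lambda>j t. W j t \<omega>) (\<lambda>k. \<eta> k \<omega>) k))"
proof (induction k)
  case (Suc k)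
  {
    case 1
    show ?case by (simp add: full_step_components Suc dW_def[abs_def])
  next
    case 2
    show ?case using assms[of "Suc k"] by (simp add: full_step_components Suc dW_def[abs_def])
  }
qed simp_all

lemma nv_state_max:
  assumes "r \<ge> 1" "k \<le> n"
  shows "norm (fst (snd (nv_state \<sigma> d r T N x0 w e k)) - snd (snd (nv_state \<sigma> d r T N x0 w e k))) ^ (2 * r)
     \<le> fst (nv_state \<sigma> d r T N x0 w e n)"
proof -
  have "norm (fst (snd (nv_state \<sigma> d r T N x0 w e k)) - snd (snd (nv_state \<sigma> d r T N x0 w e k))) ^ (2 * r)
     \<le> fst (nv_state \<sigma> d r T N x0 w e k)"
  proof (cases k)
    case 0
    then show ?thesis using assms(1) by (simp add: power_0_left)
  next
    case (Suc i)
    show ?thesis unfolding Suc nv_state.simps by (rule full_step_components(4))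
  qed
  also have "\<dots> \<le> fst (nv_state \<sigma> d r T N x0 w e n)"
    by (rule lift_Suc_mono_le[OF _ assms(2)]) (simp add: full_step_components)
  finally show ?thesis .
qed

lemma nv_state_nonneg: "0 \<le> fst (nv_state \<sigma> d r T N x0 w e n)"
proof -
  have "fst (nv_state \<sigma> d r T N x0 w e 0) \<le> fst (nv_state \<sigma> d r T N x0 w e n)"
    by (rule lift_Suc_mono_le[of "\<lambda>k. fst (nv_state \<sigma> d r T N x0 w e k)"]) (simp_all add: full_step_components)
  then show ?thesis by simp
qed

lemma full_step_cong:
  assumes "\<And>j. j \<in> set js \<Longrightarrow> dw j = dw' j"
  shows "full_step \<sigma> r h js dw s = full_step \<sigma> r h js dw' s"
  unfolding full_step_def using assms by (intro arg_cong[where f = "drift_step \<sigma> r h"] foldl_cong) auto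

text \<open>The state depends on finitely many grid values and signs. This permits replacing the
  whole path by its restriction to a time interval, which is how independence is formulated.\<close>

lemma nv_state_cong:
  assumes "\<And>j i. j \<in> {1..d} \<Longrightarrow> i \<le> k \<Longrightarrow> w j (real i * T / real N) = w' j (real i * T / real N)"
    "\<And>i. 1 \<le> i \<Longrightarrow> i \<le> k \<Longrightarrow> e i = e' i"
  shows "nv_state \<sigma> d r T N x0 w e k = nv_state \<sigma> d r T N x0 w' e' k"
  using assms
proof (induction k)
  case (Suc k)
  have "nv_state \<sigma> d r T N x0 w e k = nv_state \<sigma> d r T N x0 w' e' k"
    by (rule Suc.IH) (use Suc.prems in auto)
  moreover have "e (Suc k) = e' (Suc k)" using Suc.prems(2) by simp
  moreover have "w j (real (Suc k) * T / real N) - w j (real k * T / real N)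
      = w' j (real (Suc k) * T / real N) - w' j (real k * T / real N)" if "j \<in> {1..d}" for j
    using Suc.prems(1)[OF that, of "Suc k"] Suc.prems(1)[OF that, of k] by simp
  ultimately show ?case
    by (simp only: nv_state.simps, intro full_step_cong) (simp add: set_step_order)
qed simp

section \<open>Continuity of the substeps and measurability of the state\<close>

lemma lipschitz_continuous: "lipschitz V \<Longrightarrow> continuous_on S V"
  using lipschitz_on_continuous_on lipschitz_def continuous_on_subset by (metis subset_UNIV)

lemma continuous_on_flow:
  fixes V :: "'a::euclidean_space \<Rightarrow> 'a"
  assumes "lipschitz V" "continuous_on S f" "continuous_on S g"
  shows "continuous_on S (\<lambda>x. flow V (f x) (g x))"
  using continuous_on_compose2[OF continuous_flow[OF assms(1)] continuous_on_Pair[OF assms(2,3)]] by simp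

lemma continuous_on_lipschitz:
  assumes "lipschitz V" "continuous_on S f"
  shows "continuous_on S (\<lambda>x. V (f x))"
  by (rule continuous_on_compose2[OF lipschitz_continuous[OF assms(1), of UNIV] assms(2)]) simp

lemma continuous_on_Psi4:
  assumes "lipschitz V" "continuous_on S f" "continuous_on S g"
  shows "continuous_on S (\<lambda>x. Psi4 V (f x) (g x))"
  unfolding Psi4_def by (intro continuous_intros continuous_on_lipschitz[OF assms(1)] assms) auto

lemma continuous_on_Psi2:
  assumes "lipschitz V" "continuous_on S g"
  shows "continuous_on S (\<lambda>x. Psi2 V c (g x))"
  unfolding Psi2_def by (intro continuous_intros continuous_on_lipschitz[OF assms(1)] assms) auto

lemma continuous_on_paired_step:
  fixes F G :: "'a::topological_space \<Rightarrow> 'v \<Rightarrow> 'v::real_normed_vector"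
  assumes "continuous_on UNIV (\<lambda>p :: 'a \<times> real \<times> 'v \<times> 'v. F (fst p) (fst (snd (snd p))))"
    "continuous_on UNIV (\<lambda>p :: 'a \<times> real \<times> 'v \<times> 'v. G (fst p) (snd (snd (snd p))))"
  shows "continuous_on UNIV (\<lambda>p. paired_step r (F (fst p)) (G (fst p)) (snd p))"
  unfolding paired_step_def case_prod_unfold
  by (intro continuous_intros continuous_on_max assms)

lemma continuous_diffusion_step:
  fixes \<sigma> :: "nat \<Rightarrow> 'v::euclidean_space \<Rightarrow> 'v"
  assumes "lipschitz (\<sigma> j)"
  shows "continuous_on UNIV (\<lambda>p. diffusion_step \<sigma> r j (fst p) (snd p))"
  unfolding diffusion_step_def
  by (intro continuous_on_paired_step continuous_on_flow continuous_on_Psi4 assms continuous_intros)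

lemma continuous_drift_step:
  fixes \<sigma> :: "nat \<Rightarrow> 'v::euclidean_space \<Rightarrow> 'v"
  assumes "lipschitz (\<sigma> 0)"
  shows "continuous_on UNIV (drift_step \<sigma> r h)"
  unfolding drift_step_def paired_step_def case_prod_unfold
  by (intro continuous_intros continuous_on_max continuous_on_flow continuous_on_Psi2 assms)

lemma continuous_lyapunov: "continuous_on UNIV (lyapunov r m \<kappa> :: real \<times> 'v \<times> 'v::real_normed_vector \<Rightarrow> real)"
  unfolding lyapunov_def case_prod_unfold by (intro continuous_intros) auto

lemma measurable_foldl_diffusion_step:
  fixes \<sigma> :: "nat \<Rightarrow> 'v::euclidean_space \<Rightarrow> 'v"
  assumes "\<And>j. j \<in> set js \<Longrightarrow> lipschitz (\<sigma> j)" "\<And>j. j \<in> set js \<Longrightarrow> (\<lambda>x. dw x j) \<in> borel_measurable M"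
    "s \<in> borel_measurable M"
  shows "(\<lambda>x. foldl (\<lambda>s j. diffusion_step \<sigma> r j (dw x j) s) (s x) js) \<in> borel_measurable M"
  using assms(1,2)
proof (induction js rule: rev_induct)
  case (snoc j js)
  then have IH: "(\<lambda>x. foldl (\<lambda>s j. diffusion_step \<sigma> r j (dw x j) s) (s x) js) \<in> borel_measurable M" by simp
  have "(\<lambda>x. diffusion_step \<sigma> r j (dw x j) (foldl (\<lambda>s j. diffusion_step \<sigma> r j (dw x j) s) (s x) js)) \<in> borel_measurable M"
    using snoc.prems by (intro borel_measurable_continuous_Pair[where H = "diffusion_step \<sigma> r j"] IH continuous_diffusion_step) auto
  then show ?case by simp
qed (simp add: assms)

lemma measurable_full_step:
  fixes \<sigma> :: "nat \<Rightarrow> 'v::euclidean_space \<Rightarrow> 'v"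
  assumes "\<And>j. j \<in> set js \<Longrightarrow> lipschitz (\<sigma> j)" "lipschitz (\<sigma> 0)"
    "\<And>j. j \<in> set js \<Longrightarrow> (\<lambda>x. dw x j) \<in> borel_measurable M" "s \<in> borel_measurable M"
  shows "(\<lambda>x. full_step \<sigma> r h js (dw x) (s x)) \<in> borel_measurable M"
proof -
  have d: "drift_step \<sigma> r h \<in> borel_measurable borel"
    by (intro borel_measurable_continuous_onI continuous_drift_step assms)
  show ?thesis unfolding full_step_def
    by (intro measurable_compose[OF _ d] measurable_foldl_diffusion_step assms)
qed

lemma measurable_nv_state:
  fixes \<sigma> :: "nat \<Rightarrow> 'v::euclidean_space \<Rightarrow> 'v"
  assumes lip: "\<And>j. j \<le> d \<Longrightarrow> lipschitz (\<sigma> j)"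
    and "\<And>j i. j \<in> {1..d} \<Longrightarrow> i \<le> k \<Longrightarrow> (\<lambda>x. w x j (real i * T / real N)) \<in> borel_measurable M"
    and "\<And>i. 1 \<le> i \<Longrightarrow> i \<le> k \<Longrightarrow> (\<lambda>x. e x i) \<in> borel_measurable M"
  shows "(\<lambda>x. nv_state \<sigma> d r T N x0 (w x) (e x) k) \<in> borel_measurable M"
  using assms(2,3)
proof (induction k)
  case (Suc k)
  have IH: "(\<lambda>x. nv_state \<sigma> d r T N x0 (w x) (e x) k) \<in> borel_measurable M"
    by (rule Suc.IH) (use Suc.prems in auto)
  have e: "(\<lambda>x. e x (Suc k)) \<in> borel_measurable M" using Suc.prems by simp
  \<comment> \<open>Only the test for 1 depends on the random sign; the value 0 below represents
    every other sign.\<close>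
  define S where "S c x = full_step \<sigma> r (T / real N) (step_order d c)
     (\<lambda>j. w x j (real (Suc k) * T / real N) - w x j (real k * T / real N)) (nv_state \<sigma> d r T N x0 (w x) (e x) k)" for c x
  have S: "S c \<in> borel_measurable M" for c
    unfolding S_def
    by (intro measurable_full_step borel_measurable_diff Suc.prems(1) IH lip) (auto simp: set_step_order)
  have "nv_state \<sigma> d r T N x0 (w x) (e x) (Suc k) = (if e x (Suc k) = 1 then S 1 x else S 0 x)" for x
    by (simp add: S_def step_order_def)
  moreover have "(\<lambda>x. if e x (Suc k) = 1 then S 1 x else S 0 x) \<in> borel_measurable M"
    using e S by measurable
  ultimately show ?case by presburger
qed simp

section \<open>Expectations\<close>

text \<open>Independence is the product formula on rectangles, and rectangles determine a product of
  sigma-finite measures.\<close>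

lemma indep_rv_distr_Pair:
  assumes M: "prob_space M" and ind: "indep_rv M S X T Y"
  shows "distr M (S \<Otimes>\<^sub>M T) (\<lambda>\<omega>. (X \<omega>, Y \<omega>)) = distr M S X \<Otimes>\<^sub>M distr M T Y"
proof -
  interpret prob_space M by fact
  have X[measurable]: "X \<in> measurable M S" and Y[measurable]: "Y \<in> measurable M T"
    and I: "indep_set (sigma_sets (space M) { X -` A \<inter> space M | A. A \<in> sets S})
       (sigma_sets (space M) { Y -` A \<inter> space M | A. A \<in> sets T})"
    using ind unfolding indep_rv_def by auto
  interpret dX: prob_space "distr M S X" by (rule prob_space_distr[OF X])
  interpret dY: prob_space "distr M T Y" by (rule prob_space_distr[OF Y])
  show ?thesis
  proof (rule pair_measure_eqI[symmetric])
    fix A B assume "A \<in> sets (distr M S X)" "B \<in> sets (distr M T Y)"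
    then have A[measurable]: "A \<in> sets S" and B[measurable]: "B \<in> sets T" by auto
    have "prob ((X -` A \<inter> space M) \<inter> (Y -` B \<inter> space M)) = prob (X -` A \<inter> space M) * prob (Y -` B \<inter> space M)"
      using A B by (intro indep_setD[OF I] sigma_sets.Basic) auto
    moreover have "(\<lambda>\<omega>. (X \<omega>, Y \<omega>)) -` (A \<times> B) \<inter> space M = (X -` A \<inter> space M) \<inter> (Y -` B \<inter> space M)" by auto
    ultimately show "emeasure (distr M S X) A * emeasure (distr M T Y) B
        = emeasure (distr M (S \<Otimes>\<^sub>M T) (\<lambda>\<omega>. (X \<omega>, Y \<omega>))) (A \<times> B)"
      by (simp add: emeasure_distr emeasure_eq_measure ennreal_mult[symmetric])
  qed (auto intro: dX.sigma_finite_measure_axioms dY.sigma_finite_measure_axioms cong: sets_pair_measure_cong)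
qed

text \<open>Both orders of integration are used: the first integrates out a Brownian increment for a
  fixed past, the second integrates over the paths for fixed signs.\<close>

lemma indep_rv_nn_integral:
  assumes M: "prob_space M" and ind: "indep_rv M S X T Y" and f: "f \<in> borel_measurable (S \<Otimes>\<^sub>M T)"
  shows "(\<integral>\<^sup>+ \<omega>. f (X \<omega>, Y \<omega>) \<partial>M) = (\<integral>\<^sup>+ x. \<integral>\<^sup>+ y. f (x, y) \<partial>distr M T Y \<partial>distr M S X)"
    and "(\<integral>\<^sup>+ \<omega>. f (X \<omega>, Y \<omega>) \<partial>M) = (\<integral>\<^sup>+ y. \<integral>\<^sup>+ x. f (x, y) \<partial>distr M S X \<partial>distr M T Y)"
proof -
  interpret prob_space M by fact
  have X[measurable]: "X \<in> measurable M S" and Y[measurable]: "Y \<in> measurable M T"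
    using ind unfolding indep_rv_def by auto
  interpret dX: prob_space "distr M S X" by (rule prob_space_distr[OF X])
  interpret dY: prob_space "distr M T Y" by (rule prob_space_distr[OF Y])
  interpret pair_sigma_finite "distr M S X" "distr M T Y" ..
  have f': "f \<in> borel_measurable (distr M S X \<Otimes>\<^sub>M distr M T Y)"
    using f by (simp cong: measurable_cong_sets sets_pair_measure_cong)
  have "(\<integral>\<^sup>+ \<omega>. f (X \<omega>, Y \<omega>) \<partial>M) = (\<integral>\<^sup>+ p. f p \<partial>distr M (S \<Otimes>\<^sub>M T) (\<lambda>\<omega>. (X \<omega>, Y \<omega>)))"
    using f by (subst nn_integral_distr) auto
  also have "\<dots> = (\<integral>\<^sup>+ p. f p \<partial>(distr M S X \<Otimes>\<^sub>M distr M T Y))"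
    by (simp add: indep_rv_distr_Pair[OF M ind])
  finally have *: "(\<integral>\<^sup>+ \<omega>. f (X \<omega>, Y \<omega>) \<partial>M) = (\<integral>\<^sup>+ p. f p \<partial>(distr M S X \<Otimes>\<^sub>M distr M T Y))" .
  show "(\<integral>\<^sup>+ \<omega>. f (X \<omega>, Y \<omega>) \<partial>M) = (\<integral>\<^sup>+ x. \<integral>\<^sup>+ y. f (x, y) \<partial>distr M T Y \<partial>distr M S X)"
    unfolding * by (rule dY.nn_integral_fst[OF f', symmetric])
  show "(\<integral>\<^sup>+ \<omega>. f (X \<omega>, Y \<omega>) \<partial>M) = (\<integral>\<^sup>+ y. \<integral>\<^sup>+ x. f (x, y) \<partial>distr M S X \<partial>distr M T Y)"
    unfolding * by (rule nn_integral_snd[OF f', symmetric])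
qed

abbreviation gauss :: "real \<Rightarrow> real measure" where
  "gauss h \<equiv> density lborel (\<lambda>x. ennreal (normal_density 0 (sqrt h) x))"

lemma prob_space_gauss: "0 < h \<Longrightarrow> prob_space (gauss h)"
  by (intro prob_space_normal_density) simp

lemma nn_integral_gauss:
  assumes "0 < h" "f \<in> borel_measurable borel"
  shows "(\<integral>\<^sup>+ w. f w \<partial>gauss h) = (\<integral>\<^sup>+ \<xi>. f (sqrt h * \<xi>) \<partial>std_gauss)"
proof -
  interpret prob_space std_gauss by (rule prob_space_normal_density) simp
  have "distributed std_gauss lborel (\<lambda>x. x) (\<lambda>x. ennreal (std_normal_density x))"
    unfolding distributed_def by (auto intro!: distr_id2)
  from normal_density_affine[OF this, of "sqrt h" 0] assms(1)
  have "distributed std_gauss lborel (\<lambda>x. sqrt h * x) (\<lambda>x. ennreal (normal_density 0 (sqrt h) x))" by simp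
  then have "gauss h = distr std_gauss lborel (\<lambda>x. sqrt h * x)" by (simp add: distributed_def)
  then have "(\<integral>\<^sup>+ w. f w \<partial>gauss h) = (\<integral>\<^sup>+ w. f w \<partial>distr std_gauss lborel (\<lambda>x. sqrt h * x))" by simp
  also have "\<dots> = (\<integral>\<^sup>+ \<xi>. f (sqrt h * \<xi>) \<partial>std_gauss)"
    using assms(2) by (subst nn_integral_distr) auto
  finally show ?thesis .
qed

section \<open>Iterating the one-step inequality over substeps, steps and signs\<close>

locale nv_contraction =
  fixes \<sigma> :: "nat \<Rightarrow> 'v::euclidean_space \<Rightarrow> 'v" and d r m :: nat and h c \<kappa> :: real
  assumes lip: "\<And>j. j \<le> d \<Longrightarrow> lipschitz (\<sigma> j)" and h: "0 < h" and c: "0 \<le> c" and \<kappa>: "0 \<le> \<kappa>"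
    and diffusion: "\<And>j s. j \<in> {1..d} \<Longrightarrow> 0 \<le> fst s \<Longrightarrow>
      (\<integral>\<^sup>+ \<xi>. ennreal (lyapunov r m \<kappa> (diffusion_step \<sigma> r j (sqrt h * \<xi>) s)) \<partial>std_gauss) \<le> ennreal (c * lyapunov r m \<kappa> s)"
    and drift: "\<And>s. 0 \<le> fst s \<Longrightarrow> lyapunov r m \<kappa> (drift_step \<sigma> r h s) \<le> c * lyapunov r m \<kappa> s"
begin

abbreviation "\<Lambda> \<equiv> lyapunov r m \<kappa> :: real \<times> 'v \<times> 'v \<Rightarrow> real"

lemma measurable_\<Lambda>: "f \<in> borel_measurable M \<Longrightarrow> (\<lambda>x. ennreal (\<Lambda> (f x))) \<in> borel_measurable M"
  by (intro measurable_compose[OF _ measurable_ennreal] measurable_compose[OF _ borel_measurable_continuous_onI[OF continuous_lyapunov]])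

lemma \<Lambda>_nonneg: "0 \<le> \<Lambda> s"
  using lyapunov_ge(4)[OF \<kappa>] by (cases s) auto

text \<open>Fubini with the last increment innermost. Distinct indices ensure that it does not occur
  in the earlier substeps. The order of the list is arbitrary, so both signs are covered.\<close>

lemma foldl_diffusion_integral:
  assumes "distinct js" "set js \<subseteq> {1..d}" "0 \<le> fst s"
  shows "(\<integral>\<^sup>+ dw. ennreal (\<Lambda> (foldl (\<lambda>s j. diffusion_step \<sigma> r j (dw j) s) s js)) \<partial>PiM (set js) (\<lambda>_. gauss h))
    \<le> ennreal (c ^ length js * \<Lambda> s)"
  using assms(1,2)
proof (induction js rule: rev_induct)
  case Nil
  interpret prob_space "PiM {} (\<lambda>_::nat. gauss h)" by (rule prob_space_PiM) simp
  show ?case by (simp add: emeasure_space_1)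
next
  case (snoc j js)
  interpret gp: prob_space "gauss h" by (rule prob_space_gauss[OF h])
  interpret product_sigma_finite "\<lambda>_::nat. gauss h" by unfold_locales
  define \<Phi> where "\<Phi> dw = foldl (\<lambda>s j. diffusion_step \<sigma> r j (dw j) s) s js" for dw
  have j: "j \<in> {1..d}" "j \<notin> set js" and js: "distinct js" "set js \<subseteq> {1..d}" using snoc.prems by auto
  have comp: "(\<lambda>x. x i) \<in> borel_measurable (PiM I (\<lambda>_. gauss h))" if "i \<in> I" for i I
    using measurable_component_singleton[OF that, of "\<lambda>_. gauss h"] by (simp cong: measurable_cong_sets)
  have m\<Phi>: "\<Phi> \<in> borel_measurable (PiM (set js) (\<lambda>_. gauss h))"
    unfolding \<Phi>_def using js lip by (intro measurable_foldl_diffusion_step comp) auto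
  have "(\<lambda>dw. foldl (\<lambda>s j. diffusion_step \<sigma> r j (dw j) s) s (js @ [j])) \<in> borel_measurable (PiM (insert j (set js)) (\<lambda>_. gauss h))"
    using snoc.prems lip by (intro measurable_foldl_diffusion_step comp) auto
  then have "(\<integral>\<^sup>+ dw. ennreal (\<Lambda> (foldl (\<lambda>s j. diffusion_step \<sigma> r j (dw j) s) s (js @ [j]))) \<partial>PiM (insert j (set js)) (\<lambda>_. gauss h))
      = (\<integral>\<^sup>+ dw. \<integral>\<^sup>+ w. ennreal (\<Lambda> (foldl (\<lambda>s i. diffusion_step \<sigma> r i ((dw(j := w)) i) s) s (js @ [j]))) \<partial>gauss h \<partial>PiM (set js) (\<lambda>_. gauss h))"
    using j by (intro product_nn_integral_insert measurable_\<Lambda>) auto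
  also have "\<dots> \<le> (\<integral>\<^sup>+ dw. ennreal c * ennreal (\<Lambda> (\<Phi> dw)) \<partial>PiM (set js) (\<lambda>_. gauss h))"
  proof (rule nn_integral_mono)
    fix dw
    have "foldl (\<lambda>s i. diffusion_step \<sigma> r i ((dw(j := w)) i) s) s js = \<Phi> dw" for w
      unfolding \<Phi>_def using j by (intro foldl_cong) auto
    then have "(\<integral>\<^sup>+ w. ennreal (\<Lambda> (foldl (\<lambda>s i. diffusion_step \<sigma> r i ((dw(j := w)) i) s) s (js @ [j]))) \<partial>gauss h)
        = (\<integral>\<^sup>+ w. ennreal (\<Lambda> (diffusion_step \<sigma> r j w (\<Phi> dw))) \<partial>gauss h)" by simp
    also have "\<dots> = (\<integral>\<^sup>+ \<xi>. ennreal (\<Lambda> (diffusion_step \<sigma> r j (sqrt h * \<xi>) (\<Phi> dw))) \<partial>std_gauss)"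
      using j lip by (intro nn_integral_gauss h measurable_\<Lambda>
          borel_measurable_continuous_Pair[where H = "diffusion_step \<sigma> r j"] continuous_diffusion_step) auto
    also have "\<dots> \<le> ennreal (c * \<Lambda> (\<Phi> dw))"
    proof (rule diffusion[OF j(1)])
      show "0 \<le> fst (\<Phi> dw)" unfolding \<Phi>_def using foldl_diffusion_step_components(3) assms(3) order_trans by blast
    qed
    finally show "(\<integral>\<^sup>+ w. ennreal (\<Lambda> (foldl (\<lambda>s i. diffusion_step \<sigma> r i ((dw(j := w)) i) s) s (js @ [j]))) \<partial>gauss h)
        \<le> ennreal c * ennreal (\<Lambda> (\<Phi> dw))" using c \<Lambda>_nonneg by (simp add: ennreal_mult)
  qed
  also have "\<dots> = ennreal c * (\<integral>\<^sup>+ dw. ennreal (\<Lambda> (\<Phi> dw)) \<partial>PiM (set js) (\<lambda>_. gauss h))"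
    by (intro nn_integral_cmult measurable_\<Lambda> m\<Phi>)
  also have "\<dots> \<le> ennreal c * ennreal (c ^ length js * \<Lambda> s)"
    unfolding \<Phi>_def by (intro mult_left_mono snoc.IH js) auto
  finally show ?case using c \<Lambda>_nonneg by (simp add: ennreal_mult[symmetric] mult_ac)
qed

lemma full_step_integral:
  assumes "0 \<le> fst s"
  shows "(\<integral>\<^sup>+ dw. ennreal (\<Lambda> (full_step \<sigma> r h (step_order d e) dw s)) \<partial>PiM {1..d} (\<lambda>_. gauss h))
    \<le> ennreal (c ^ (d + 2) * \<Lambda> s)"
proof -
  define s0 where "s0 = drift_step \<sigma> r h s"
  define \<Phi> where "\<Phi> dw = foldl (\<lambda>s j. diffusion_step \<sigma> r j (dw j) s) s0 (step_order d e)" for dw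
  have s0: "0 \<le> fst s0" using assms by (simp add: s0_def drift_step_def)
  have comp: "(\<lambda>x. x i) \<in> borel_measurable (PiM I (\<lambda>_. gauss h))" if "i \<in> I" for i I
    using measurable_component_singleton[OF that, of "\<lambda>_. gauss h"] by (simp cong: measurable_cong_sets)
  have m\<Phi>: "\<Phi> \<in> borel_measurable (PiM {1..d} (\<lambda>_. gauss h))"
    unfolding \<Phi>_def using lip by (intro measurable_foldl_diffusion_step comp) (auto simp: set_step_order)
  have "(\<integral>\<^sup>+ dw. ennreal (\<Lambda> (full_step \<sigma> r h (step_order d e) dw s)) \<partial>PiM {1..d} (\<lambda>_. gauss h))
      \<le> (\<integral>\<^sup>+ dw. ennreal c * ennreal (\<Lambda> (\<Phi> dw)) \<partial>PiM {1..d} (\<lambda>_. gauss h))"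
  proof (rule nn_integral_mono)
    fix dw
    have "0 \<le> fst (\<Phi> dw)" unfolding \<Phi>_def using foldl_diffusion_step_components(3) s0 order_trans by blast
    then have "\<Lambda> (full_step \<sigma> r h (step_order d e) dw s) \<le> c * \<Lambda> (\<Phi> dw)"
      unfolding full_step_def \<Phi>_def s0_def by (rule drift)
    then show "ennreal (\<Lambda> (full_step \<sigma> r h (step_order d e) dw s)) \<le> ennreal c * ennreal (\<Lambda> (\<Phi> dw))"
      using c \<Lambda>_nonneg by (simp add: ennreal_mult[symmetric] ennreal_leI)
  qed
  also have "\<dots> = ennreal c * (\<integral>\<^sup>+ dw. ennreal (\<Lambda> (\<Phi> dw)) \<partial>PiM {1..d} (\<lambda>_. gauss h))"
    by (intro nn_integral_cmult measurable_\<Lambda> m\<Phi>)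
  also have "\<dots> \<le> ennreal c * ennreal (c ^ d * \<Lambda> s0)"
    using foldl_diffusion_integral[OF distinct_step_order[of d e] _ s0]
    unfolding \<Phi>_def set_step_order length_step_order by (intro mult_left_mono) auto
  also have "\<dots> \<le> ennreal (c ^ (d + 2) * \<Lambda> s)"
  proof -
    have "c * (c ^ d * \<Lambda> s0) \<le> c * (c ^ d * (c * \<Lambda> s))"
      unfolding s0_def using c by (intro mult_left_mono drift assms) auto
    then show ?thesis using c \<Lambda>_nonneg by (simp add: ennreal_mult[symmetric] ennreal_leI mult_ac)
  qed
  finally show ?thesis .
qed

end

lemma brownian_increments_distr:
  assumes BM: "brownian_motion M d W" and d: "1 \<le> d" and st: "0 \<le> s" "s < t"
  shows "distr M (PiM {1..d} (\<lambda>_. borel)) (\<lambda>\<omega>. \<lambda>j\<in>{1..d}. W j t \<omega> - W j s \<omega>) = PiM {1..d} (\<lambda>_. gauss (t - s))"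
proof -
  interpret prob_space M using BM by (simp add: brownian_motion_def)
  have D: "\<And>j. j \<in> {1..d} \<Longrightarrow> distributed M lborel (\<lambda>\<omega>. W j t \<omega> - W j s \<omega>) (normal_density 0 (sqrt (t - s)))"
    and I: "indep_vars (\<lambda>_. borel) (\<lambda>j \<omega>. W j t \<omega> - W j s \<omega>) {1..d}"
    using BM st unfolding brownian_motion_def by blast+
  have rv: "\<And>j. j \<in> {1..d} \<Longrightarrow> (\<lambda>\<omega>. W j t \<omega> - W j s \<omega>) \<in> borel_measurable M"
    using D unfolding distributed_def by auto
  have "distr M (PiM {1..d} (\<lambda>_. borel)) (\<lambda>\<omega>. \<lambda>j\<in>{1..d}. W j t \<omega> - W j s \<omega>)
      = PiM {1..d} (\<lambda>j. distr M borel (\<lambda>\<omega>. W j t \<omega> - W j s \<omega>))"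
    by (rule indep_vars_iff_distr_eq_PiM'[THEN iffD1, OF _ rv I]) (use d in auto)
  also have "\<dots> = PiM {1..d} (\<lambda>_. gauss (t - s))"
  proof (rule PiM_cong)
    fix j assume j: "j \<in> {1..d}"
    have "distr M borel (\<lambda>\<omega>. W j t \<omega> - W j s \<omega>) = distr M lborel (\<lambda>\<omega>. W j t \<omega> - W j s \<omega>)"
      by (rule distr_cong) auto
    then show "distr M borel (\<lambda>\<omega>. W j t \<omega> - W j s \<omega>) = gauss (t - s)"
      using D[OF j] by (simp add: distributed_def)
  qed simp
  finally show ?thesis .
qed

text \<open>Markov property: the state after k steps is a function of the paths up to time s, and
  the increments over the next step are independent of these. Each step costs the factor
  \<open>c ^ (d + 2)\<close>, d diffusion and two drift substeps. The sign sequence is arbitrary, so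
  the bound is uniform in it.\<close>

lemma (in nv_contraction) nv_state_integral_fixed:
  assumes BM: "brownian_motion M d W" and d: "1 \<le> d" and N: "1 \<le> N" and hT: "h = T / real N"
  shows "(\<integral>\<^sup>+ \<omega>. ennreal (\<Lambda> (nv_state \<sigma> d r T N x0 (\<lambda>j t. W j t \<omega>) e k)) \<partial>M)
    \<le> ennreal (c ^ ((d + 2) * k) * \<Lambda> (0, x0, x0))"
proof (induction k)
  case 0
  interpret prob_space M using BM by (simp add: brownian_motion_def)
  show ?case by (simp add: emeasure_space_1)
next
  case (Suc k)
  interpret prob_space M using BM by (simp add: brownian_motion_def)
  have T: "0 < T" using h N hT by (simp add: zero_less_divide_iff)
  define s where "s = real k * T / real N"
  define t where "t = real (Suc k) * T / real N"
  have st: "0 \<le> s" "s < t" using T N by (auto simp: s_def t_def divide_strict_right_mono)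
  have tsh: "t - s = h" using N by (simp add: s_def t_def hT field_simps)
  define X where "X \<omega> = (\<lambda>j\<in>{1..d}. \<lambda>u\<in>{0..s}. W j u \<omega>)" for \<omega>
  define Y where "Y \<omega> = (\<lambda>j\<in>{1..d}. W j t \<omega> - W j s \<omega>)" for \<omega>
  define SX where "SX = PiM {1..d} (\<lambda>_. PiM {0..s} (\<lambda>_. borel :: real measure))"
  define SY where "SY = PiM {1..d} (\<lambda>_. borel :: real measure)"
  have ind: "indep_rv M SX X SY Y"
    using BM st unfolding brownian_motion_def SX_def SY_def X_def[abs_def] Y_def[abs_def] by blast
  then have mX: "X \<in> measurable M SX" by (simp add: indep_rv_def)
  have times: "0 \<le> real i * T / real N" "real i * T / real N \<le> s" if "i \<le> k" for i
    using that T N by (auto simp: s_def intro!: divide_right_mono mult_right_mono)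
  have SXc: "(\<lambda>x. x j (real i * T / real N)) \<in> borel_measurable SX" if "j \<in> {1..d}" "i \<le> k" for i j
    unfolding SX_def using that times[OF that(2)]
    by (intro measurable_compose[OF measurable_component_singleton[of j]] measurable_component_singleton) auto
  have mS: "(\<lambda>x. nv_state \<sigma> d r T N x0 x e k) \<in> borel_measurable SX"
    by (intro measurable_nv_state lip SXc) auto
  define f where "f p = full_step \<sigma> r h (step_order d (e (Suc k))) (snd p) (nv_state \<sigma> d r T N x0 (fst p) e k)" for p
  have mf: "f \<in> borel_measurable (SX \<Otimes>\<^sub>M SY)"
    unfolding f_def
  proof (intro measurable_full_step lip)
    show "(\<lambda>x. snd x j) \<in> borel_measurable (SX \<Otimes>\<^sub>M SY)" if "j \<in> set (step_order d (e (Suc k)))" for j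
      unfolding SY_def using that
      by (intro measurable_compose[OF measurable_snd] measurable_component_singleton) (auto simp: set_step_order)
    show "(\<lambda>x. nv_state \<sigma> d r T N x0 (fst x) e k) \<in> borel_measurable (SX \<Otimes>\<^sub>M SY)"
      by (rule measurable_compose[OF measurable_fst mS])
  qed (auto simp: set_step_order)
  have Xk: "nv_state \<sigma> d r T N x0 (\<lambda>j t. W j t \<omega>) e k = nv_state \<sigma> d r T N x0 (X \<omega>) e k" for \<omega>
    using times by (intro nv_state_cong) (auto simp: X_def)
  have "nv_state \<sigma> d r T N x0 (\<lambda>j t. W j t \<omega>) e (Suc k) = f (X \<omega>, Y \<omega>)" for \<omega>
    unfolding nv_state.simps f_def fst_conv snd_conv Xk hT[symmetric]
    by (intro full_step_cong) (auto simp: set_step_order Y_def s_def t_def)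
  then have "(\<integral>\<^sup>+ \<omega>. ennreal (\<Lambda> (nv_state \<sigma> d r T N x0 (\<lambda>j t. W j t \<omega>) e (Suc k))) \<partial>M)
      = (\<integral>\<^sup>+ \<omega>. ennreal (\<Lambda> (f (X \<omega>, Y \<omega>))) \<partial>M)" by simp
  also have "\<dots> = (\<integral>\<^sup>+ x. \<integral>\<^sup>+ y. ennreal (\<Lambda> (f (x, y))) \<partial>distr M SY Y \<partial>distr M SX X)"
    by (rule indep_rv_nn_integral(1)[OF prob_space_axioms ind measurable_\<Lambda>[OF mf]])
  also have "distr M SY Y = PiM {1..d} (\<lambda>_. gauss h)"
    unfolding SY_def Y_def[abs_def] tsh[symmetric] by (rule brownian_increments_distr[OF BM d st])
  also have "(\<integral>\<^sup>+ x. \<integral>\<^sup>+ y. ennreal (\<Lambda> (f (x, y))) \<partial>PiM {1..d} (\<lambda>_. gauss h) \<partial>distr M SX X)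
      \<le> (\<integral>\<^sup>+ x. ennreal (c ^ (d + 2)) * ennreal (\<Lambda> (nv_state \<sigma> d r T N x0 x e k)) \<partial>distr M SX X)"
  proof (rule nn_integral_mono)
    fix x
    show "(\<integral>\<^sup>+ y. ennreal (\<Lambda> (f (x, y))) \<partial>PiM {1..d} (\<lambda>_. gauss h))
        \<le> ennreal (c ^ (d + 2)) * ennreal (\<Lambda> (nv_state \<sigma> d r T N x0 x e k))"
      using full_step_integral[OF nv_state_nonneg, of "e (Suc k)" \<sigma> d r T N x0 x e k] c \<Lambda>_nonneg
      by (simp add: f_def ennreal_mult[symmetric])
  qed
  also have "\<dots> = ennreal (c ^ (d + 2)) * (\<integral>\<^sup>+ x. ennreal (\<Lambda> (nv_state \<sigma> d r T N x0 x e k)) \<partial>distr M SX X)"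
    by (intro nn_integral_cmult measurable_\<Lambda>) (use mS in auto)
  also have "(\<integral>\<^sup>+ x. ennreal (\<Lambda> (nv_state \<sigma> d r T N x0 x e k)) \<partial>distr M SX X)
      = (\<integral>\<^sup>+ \<omega>. ennreal (\<Lambda> (nv_state \<sigma> d r T N x0 (\<lambda>j t. W j t \<omega>) e k)) \<partial>M)"
    unfolding Xk by (intro nn_integral_distr mX measurable_\<Lambda>) (simp add: mS)
  also have "ennreal (c ^ (d + 2)) * \<dots> \<le> ennreal (c ^ (d + 2)) * ennreal (c ^ ((d + 2) * k) * \<Lambda> (0, x0, x0))"
    by (intro mult_left_mono Suc.IH) auto
  also have "\<dots> = ennreal (c ^ ((d + 2) * Suc k) * \<Lambda> (0, x0, x0))"
    using c \<Lambda>_nonneg by (simp add: ennreal_mult[symmetric] power_add mult_ac)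
  finally show ?case .
qed

text \<open>Inside the integral over the signs stands the expectation with frozen signs, whose bound
  is one constant; the joint law of the signs has total mass 1.\<close>

lemma (in nv_contraction) nv_state_integral:
  assumes BM: "brownian_motion M d W" and d: "1 \<le> d" and N: "1 \<le> N" and hT: "h = T / real N"
    and ind: "indep_rv M
                  (PiM {1..d} (\<lambda>_. PiM {0..} (\<lambda>_. borel))) (\<lambda>\<omega>. \<lambda>j\<in>{1..d}. \<lambda>t\<in>{0..}. W j t \<omega>)
                  (PiM {1..} (\<lambda>_. borel)) (\<lambda>\<omega>. \<lambda>k\<in>{1..}. \<eta> k \<omega>)"
  shows "(\<integral>\<^sup>+ \<omega>. ennreal (\<Lambda> (nv_state \<sigma> d r T N x0 (\<lambda>j t. W j t \<omega>) (\<lambda>k. \<eta> k \<omega>) N)) \<partial>M)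
    \<le> ennreal (c ^ ((d + 2) * N) * \<Lambda> (0, x0, x0))"
proof -
  interpret prob_space M using BM by (simp add: brownian_motion_def)
  have T: "0 < T" using h N hT by (simp add: zero_less_divide_iff)
  define X where "X \<omega> = (\<lambda>j\<in>{1..d}. \<lambda>t\<in>{0..}. W j t \<omega>)" for \<omega>
  define Y where "Y \<omega> = (\<lambda>k\<in>{1..}. \<eta> k \<omega>)" for \<omega>
  define SX where "SX = PiM {1..d} (\<lambda>_. PiM {0..} (\<lambda>_::real. borel :: real measure))"
  define SY where "SY = PiM {1..} (\<lambda>_::nat. borel :: real measure)"
  have ind: "indep_rv M SX X SY Y"
    using ind unfolding SX_def SY_def X_def[abs_def] Y_def[abs_def] .
  then have mX: "X \<in> measurable M SX" and mY: "Y \<in> measurable M SY" by (simp_all add: indep_rv_def)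
  interpret dY: prob_space "distr M SY Y" by (rule prob_space_distr[OF mY])
  have times: "0 \<le> real i * T / real N" for i using T N by simp
  have SXc: "(\<lambda>x. x j (real i * T / real N)) \<in> borel_measurable SX" if "j \<in> {1..d}" for i j
    unfolding SX_def using that times
    by (intro measurable_compose[OF measurable_component_singleton[of j]] measurable_component_singleton) auto
  define f where "f p = nv_state \<sigma> d r T N x0 (fst p) (snd p) N" for p
  have mf: "f \<in> borel_measurable (SX \<Otimes>\<^sub>M SY)"
    unfolding f_def
  proof (intro measurable_nv_state lip)
    show "(\<lambda>x. fst x j (real i * T / real N)) \<in> borel_measurable (SX \<Otimes>\<^sub>M SY)" if "j \<in> {1..d}" for i j
      by (rule measurable_compose[OF measurable_fst SXc[OF that]])
    show "(\<lambda>x. snd x i) \<in> borel_measurable (SX \<Otimes>\<^sub>M SY)" if "1 \<le> i" for i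
      unfolding SY_def using that
      by (intro measurable_compose[OF measurable_snd] measurable_component_singleton) auto
  qed auto
  have W: "nv_state \<sigma> d r T N x0 (\<lambda>j t. W j t \<omega>) e N = nv_state \<sigma> d r T N x0 (X \<omega>) e N" for \<omega> e
    using times by (intro nv_state_cong) (auto simp: X_def)
  have "nv_state \<sigma> d r T N x0 (X \<omega>) (\<lambda>k. \<eta> k \<omega>) N = f (X \<omega>, Y \<omega>)" for \<omega>
    unfolding f_def by (intro nv_state_cong) (auto simp: Y_def)
  then have "(\<integral>\<^sup>+ \<omega>. ennreal (\<Lambda> (nv_state \<sigma> d r T N x0 (\<lambda>j t. W j t \<omega>) (\<lambda>k. \<eta> k \<omega>) N)) \<partial>M)
      = (\<integral>\<^sup>+ \<omega>. ennreal (\<Lambda> (f (X \<omega>, Y \<omega>))) \<partial>M)" by (simp add: W)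
  also have "\<dots> = (\<integral>\<^sup>+ e. \<integral>\<^sup>+ x. ennreal (\<Lambda> (f (x, e))) \<partial>distr M SX X \<partial>distr M SY Y)"
    by (rule indep_rv_nn_integral(2)[OF prob_space_axioms ind measurable_\<Lambda>[OF mf]])
  also have "\<dots> \<le> (\<integral>\<^sup>+ e. ennreal (c ^ ((d + 2) * N) * \<Lambda> (0, x0, x0)) \<partial>distr M SY Y)"
  proof (rule nn_integral_mono)
    fix e
    have mfe: "(\<lambda>x. f (x, e)) \<in> borel_measurable SX"
      unfolding f_def fst_conv snd_conv by (intro measurable_nv_state lip SXc) auto
    have "(\<integral>\<^sup>+ x. ennreal (\<Lambda> (f (x, e))) \<partial>distr M SX X) = (\<integral>\<^sup>+ \<omega>. ennreal (\<Lambda> (f (X \<omega>, e))) \<partial>M)"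
      by (intro nn_integral_distr mX measurable_\<Lambda>) (simp add: mfe)
    also have "\<dots> = (\<integral>\<^sup>+ \<omega>. ennreal (\<Lambda> (nv_state \<sigma> d r T N x0 (\<lambda>j t. W j t \<omega>) e N)) \<partial>M)"
      by (simp add: W f_def)
    also have "\<dots> \<le> ennreal (c ^ ((d + 2) * N) * \<Lambda> (0, x0, x0))"
      by (rule nv_state_integral_fixed[OF BM d N hT])
    finally show "(\<integral>\<^sup>+ x. ennreal (\<Lambda> (f (x, e))) \<partial>distr M SX X) \<le> ennreal (c ^ ((d + 2) * N) * \<Lambda> (0, x0, x0))" .
  qed
  also have "\<dots> = ennreal (c ^ ((d + 2) * N) * \<Lambda> (0, x0, x0))"
    using dY.emeasure_space_1 by (simp only: nn_integral_const) simp
  finally show ?thesis .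
qed

section \<open>The strong error\<close>

text \<open>Passing to a smaller power without Hoelder's inequality: for exponents s in [0,1], the power
  of x/B is at most 1 + x/B.\<close>

lemma powr_le_by_scale:
  fixes u a B p :: real
  assumes u: "0 \<le> u" "u ^ (2 * r) \<le> a" and B: "0 < B" and r: "1 \<le> r" and p: "0 \<le> p" "p \<le> 2 * real r"
  shows "u powr (2 * p) \<le> B powr (p / (2 * real r)) * (1 + a\<^sup>2 / B)"
proof (cases "u = 0")
  case True
  then show ?thesis using B by simp
next
  case False
  then have u0: "0 < u" using u by simp
  define s where "s = p / (2 * real r)"
  have s: "0 \<le> s" "s \<le> 1" using p r by (simp_all add: s_def)
  have le: "x powr s \<le> 1 + x" if "0 \<le> x" for x :: real
  proof (cases "x \<le> 1")
    case True
    have "x powr s \<le> 1" using powr_mono2[of s x 1] s that True by simp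
    then show ?thesis using that by simp
  next
    case False
    then have "x powr s \<le> x powr 1" using s by (intro powr_mono) auto
    then show ?thesis using False by simp
  qed
  have "2 * p = real (4 * r) * s" using r by (simp add: s_def)
  then have "u powr (2 * p) = (u powr real (4 * r)) powr s" by (simp only: powr_powr)
  also have "\<dots> = (u ^ (4 * r)) powr s" using u0 by (simp only: powr_realpow)
  also have "u ^ (4 * r) = (u ^ (2 * r))\<^sup>2" by (simp add: power_mult[symmetric])
  also have "((u ^ (2 * r))\<^sup>2) powr s \<le> (a\<^sup>2) powr s"
    using u s by (intro powr_mono2 power_mono) auto
  also have "a\<^sup>2 = B * (a\<^sup>2 / B)" using B by simp
  also have "(B * (a\<^sup>2 / B)) powr s = B powr s * (a\<^sup>2 / B) powr s"
    using B by (intro powr_mult)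
  also have "\<dots> \<le> B powr s * (1 + a\<^sup>2 / B)" using B by (intro mult_left_mono le) auto
  finally show ?thesis by (simp add: s_def)
qed

lemma rademacher_AE:
  assumes "rademacher_seq M \<eta>"
  shows "AE \<omega> in M. \<forall>k\<ge>1. \<eta> k \<omega> = 1 \<or> \<eta> k \<omega> = -1"
proof -
  interpret prob_space M using assms by (simp add: rademacher_seq_def)
  have "AE \<omega> in M. 1 \<le> k \<longrightarrow> \<eta> k \<omega> = 1 \<or> \<eta> k \<omega> = -1" for k
  proof (cases "1 \<le> k")
    case True
    have [measurable]: "\<eta> k \<in> borel_measurable M"
      using assms True unfolding rademacher_seq_def indep_vars_def by auto
    have p: "prob {\<omega>\<in>space M. \<eta> k \<omega> = 1} = 1/2" "prob {\<omega>\<in>space M. \<eta> k \<omega> = -1} = 1/2"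
      using assms True unfolding rademacher_seq_def by auto
    have "prob ({\<omega>\<in>space M. \<eta> k \<omega> = 1} \<union> {\<omega>\<in>space M. \<eta> k \<omega> = -1}) = 1"
      by (subst finite_measure_Union) (auto simp: p)
    then have "AE \<omega> in M. \<omega> \<in> {\<omega>\<in>space M. \<eta> k \<omega> = 1} \<union> {\<omega>\<in>space M. \<eta> k \<omega> = -1}"
      by (subst prob_eq_1[symmetric]) auto
    then show ?thesis by (rule AE_mp) auto
  qed simp
  then show ?thesis by (simp add: AE_all_countable)
qed

text \<open>There are finitely many vector fields and the estimates are monotone in their constants,
  so sums of constants serve all of them; the added 1 gives q \<ge> 1.\<close>

lemma step_estimates_uniform:
  fixes \<sigma> :: "nat \<Rightarrow> 'v::euclidean_space \<Rightarrow> 'v"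
  assumes H: "0 \<le> H" and lip: "\<And>j. j \<le> d \<Longrightarrow> lipschitz (\<sigma> j)" and sm0: "poly_smooth 1 (\<sigma> 0)"
    and sm: "\<And>j. j \<in> {1..d} \<Longrightarrow> poly_smooth 5 (\<sigma> j)"
    and W: "\<And>j. j \<in> {1..d} \<Longrightarrow> lipschitz (\<lambda>x. frechet_derivative (\<sigma> j) (at x) (\<sigma> j x))"
  obtains K C q where "0 \<le> K" "0 \<le> C" "1 \<le> q"
    "step_estimate H K C q (\<lambda>h w. flow (\<sigma> 0) (h/2)) (\<lambda>h w. Psi2 (\<sigma> 0) (h/2))"
    "\<And>j. j \<in> {1..d} \<Longrightarrow> step_estimate H K C q (\<lambda>h w. flow (\<sigma> j) w) (\<lambda>h w. Psi4 (\<sigma> j) w)"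
proof -
  define F where "F j = (if j = 0 then (\<lambda>h w. flow (\<sigma> 0) (h/2)) else (\<lambda>h w. flow (\<sigma> j) w))" for j
  define G where "G j = (if j = 0 then (\<lambda>h w. Psi2 (\<sigma> 0) (h/2)) else (\<lambda>h w. Psi4 (\<sigma> j) w))" for j
  have "\<exists>K C q. 0 \<le> K \<and> 0 \<le> C \<and> step_estimate H K C q (F j) (G j)" if "j \<in> {0..d}" for j
  proof (cases "j = 0")
    case True
    obtain K C q where "0 \<le> K" "0 \<le> C" "step_estimate H K C q (\<lambda>h w. flow (\<sigma> 0) (h/2)) (\<lambda>h w. Psi2 (\<sigma> 0) (h/2))"
      using step_estimate_Psi2[OF lip[OF le0] sm0 H] by blast
    then show ?thesis using True by (auto simp: F_def G_def)
  next
    case False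
    then have j: "j \<in> {1..d}" "j \<le> d" using that by auto
    obtain K C q where "0 \<le> K" "0 \<le> C" "step_estimate H K C q (\<lambda>h w. flow (\<sigma> j) w) (\<lambda>h w. Psi4 (\<sigma> j) w)"
      using step_estimate_Psi4[OF lip[OF j(2)] sm[OF j(1)] W[OF j(1)] H] by blast
    then show ?thesis using False by (auto simp: F_def G_def)
  qed
  then obtain K C q where K: "\<And>j. j \<in> {0..d} \<Longrightarrow> 0 \<le> K j" and C: "\<And>j. j \<in> {0..d} \<Longrightarrow> 0 \<le> C j"
    and s: "\<And>j. j \<in> {0..d} \<Longrightarrow> step_estimate H (K j) (C j) (q j) (F j) (G j)" by metis
  have all: "step_estimate H (sum K {0..d}) (sum C {0..d}) (1 + sum q {0..d}) (F j) (G j)" if j: "j \<in> {0..d}" for j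
  proof (rule step_estimate_mono[OF s[OF j] _ C[OF j]])
    show "K j \<le> sum K {0..d}" by (rule member_le_sum) (use j K in auto)
    show "C j \<le> sum C {0..d}" by (rule member_le_sum) (use j C in auto)
    have "q j \<le> sum q {0..d}" by (rule member_le_sum) (use j in auto)
    then show "q j \<le> 1 + sum q {0..d}" by simp
  qed
  show ?thesis
  proof (rule that)
    show "0 \<le> sum K {0..d}" "0 \<le> sum C {0..d}" by (intro sum_nonneg K C; simp)+
    show "step_estimate H (sum K {0..d}) (sum C {0..d}) (1 + sum q {0..d}) (\<lambda>h w. flow (\<sigma> 0) (h/2)) (\<lambda>h w. Psi2 (\<sigma> 0) (h/2))"
      using all[of 0] by (simp add: F_def G_def)
    show "step_estimate H (sum K {0..d}) (sum C {0..d}) (1 + sum q {0..d}) (\<lambda>h w. flow (\<sigma> j) w) (\<lambda>h w. Psi4 (\<sigma> j) w)"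
      if "j \<in> {1..d}" for j
      using all[of j] that by (auto simp: F_def G_def)
  qed simp
qed

theorem theorem3p3:
  fixes M :: "'a measure"
    and T :: real and d :: nat
    and W :: "nat \<Rightarrow> real \<Rightarrow> 'a \<Rightarrow> real"
    and \<eta> :: "nat \<Rightarrow> 'a \<Rightarrow> real"
    and \<sigma> :: "nat \<Rightarrow> real ^ 'n \<Rightarrow> real ^ 'n"
  assumes T_pos: "T > 0"
    and d_pos: "d \<ge> 1"
    and BM: "brownian_motion M d W"
    and rad: "rademacher_seq M \<eta>"
    and indep: "indep_rv M
                  (PiM {1..d} (\<lambda>_. PiM {0..} (\<lambda>_. borel))) (\<lambda>\<omega>. \<lambda>j\<in>{1..d}. \<lambda>t\<in>{0..}. W j t \<omega>)
                  (PiM {1..} (\<lambda>_. borel)) (\<lambda>\<omega>. \<lambda>k\<in>{1..}. \<eta> k \<omega>)"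
    and sig0_C1: "Ck 1 (\<sigma> 0)"
    and sig0_lip: "lipschitz (\<sigma> 0)"
    and sig0_D1: "deriv_poly_lip 1 (\<sigma> 0)"
    and sigj_C5: "\<And>j. j \<in> {1..d} \<Longrightarrow> Ck 5 (\<sigma> j)"
    and sigj_lip: "\<And>j. j \<in> {1..d} \<Longrightarrow> lipschitz (\<sigma> j)"
    and sigj_D5: "\<And>j. j \<in> {1..d} \<Longrightarrow> deriv_poly_lip 5 (\<sigma> j)"
    and sigj_comm: "\<And>j. j \<in> {1..d} \<Longrightarrow> \<exists>C>0. \<forall>\<theta> x y z w.
          norm (\<sigma> j (x + \<theta> *\<^sub>R \<sigma> j z) + \<sigma> j y - \<sigma> j x - \<sigma> j (y + \<theta> *\<^sub>R \<sigma> j w))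
            \<le> C * \<bar>\<theta>\<bar> * (norm (x - y) + (1 + \<bar>\<theta>\<bar>) * norm (z - w))"
    and sigj_dss: "\<And>j. j \<in> {1..d} \<Longrightarrow> lipschitz (\<lambda>x. frechet_derivative (\<sigma> j) (at x) (\<sigma> j x))"
  shows "\<forall>p::real. p \<ge> 1 \<longrightarrow> (\<exists>C>0. \<exists>q::nat. q \<ge> 1 \<and>
           (\<forall>N::nat. N \<ge> 1 \<longrightarrow> (\<forall>x0 :: real ^ 'n.
              (\<integral>\<^sup>+ \<omega>. ennreal (Max ((\<lambda>k. norm (nv_scheme \<sigma> d T N W \<eta> x0 \<omega> k
                                               - nv_hat_scheme \<sigma> d T N W \<eta> x0 \<omega> k) powr (2 * p)) ` {0..N})) \<partial>M)
              \<le> ennreal (C / real N powr (4 * p) * (1 + norm x0 ^ (2 * q))))))"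
proof (intro allI impI)
  fix p :: real assume p: "1 \<le> p"
  interpret prob_space M using BM by (simp add: brownian_motion_def)
  have lip: "lipschitz (\<sigma> j)" if "j \<le> d" for j
    using that sig0_lip sigj_lip[of j] by (cases "j = 0") auto
  have T0: "0 \<le> T" using T_pos by simp
  obtain K C q where K: "0 \<le> K" and C: "0 \<le> C" and q: "1 \<le> q"
    and est0: "step_estimate T K C q (\<lambda>h w. flow (\<sigma> 0) (h/2)) (\<lambda>h w. Psi2 (\<sigma> 0) (h/2))"
    and est: "\<And>j. j \<in> {1..d} \<Longrightarrow> step_estimate T K C q (\<lambda>h w. flow (\<sigma> j) w) (\<lambda>h w. Psi4 (\<sigma> j) w)"
  proof (rule step_estimates_uniform[of T d \<sigma>, OF T0])
    show "lipschitz (\<sigma> j)" if "j \<le> d" for j by (rule lip[OF that])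
    show "poly_smooth 1 (\<sigma> 0)" by (rule poly_smoothI[OF sig0_C1 sig0_D1])
    show "poly_smooth 5 (\<sigma> j)" if "j \<in> {1..d}" for j by (rule poly_smoothI[OF sigj_C5[OF that] sigj_D5[OF that]])
    show "lipschitz (\<lambda>x. frechet_derivative (\<sigma> j) (at x) (\<sigma> j x))" if "j \<in> {1..d}" for j
      by (rule sigj_dss[OF that])
  qed (rule that, assumption+)
  \<comment> \<open>The Lyapunov argument works with even integer powers, so p is rounded
    up.\<close>
  define r where "r = nat \<lceil>p\<rceil>"
  have pr: "p \<le> real r" unfolding r_def by linarith
  then have r: "1 \<le> r" using p by linarith
  define m where "m = 2 * r * q"
  have m: "1 \<le> m" using r q by (simp add: m_def)
  obtain D where D: "D \<ge> 0" "\<And>h F G (s :: real \<times> (real^'n) \<times> (real^'n)). 0 \<le> h \<Longrightarrow> h \<le> T \<Longrightarrow> 0 \<le> fst s \<Longrightarrow> step_estimate T K C q F G \<Longrightarrow>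
     (\<integral>\<^sup>+ \<xi>. ennreal (lyapunov r m (h ^ (8 * r)) (paired_step r (F h (sqrt h * \<xi>)) (G h (sqrt h * \<xi>)) s)) \<partial>std_gauss)
       \<le> ennreal ((1 + D * h) * lyapunov r m (h ^ (8 * r)) s)"
    by (rule paired_step_lyapunov[OF K C T0 r q]) (rule that, unfold m_def, assumption+)
  define A where "A = exp (D * T * real (d + 2))"
  \<comment> \<open>\<open>T powr (4 * p)\<close> is left over from h = T/N; 1 + 4 A combines the
    summand 1 of the scaling inequality, the bound of a^2 by four times the Lyapunov value, and its
    total growth \<open>A\<close>.\<close>
  define C' where "C' = T powr (4 * p) * (1 + 4 * A)"
  have C': "0 < C'" unfolding C'_def A_def using T_pos by (intro mult_pos_pos add_pos_pos) auto
  have main: "(\<integral>\<^sup>+ \<omega>. ennreal (Max ((\<lambda>k. norm (nv_scheme \<sigma> d T N W \<eta> x0 \<omega> k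
      - nv_hat_scheme \<sigma> d T N W \<eta> x0 \<omega> k) powr (2 * p)) ` {0..N})) \<partial>M)
    \<le> ennreal (C' / real N powr (4 * p) * (1 + norm x0 ^ (2 * m)))" if N: "1 \<le> N" for N x0
  proof -
    define h where "h = T / real N"
    have h: "0 < h" "h \<le> T" using T_pos N by (auto simp: h_def divide_le_eq)
    define \<kappa> where "\<kappa> = h ^ (8 * r)"
    have \<kappa>: "0 < \<kappa>" using h by (simp add: \<kappa>_def)
    define c where "c = 1 + D * h"
    have c: "0 \<le> c" using D(1) h by (simp add: c_def)
    interpret nv: nv_contraction \<sigma> d r m h c \<kappa>
    proof
      show "0 \<le> \<kappa>" "0 < h" "0 \<le> c" using \<kappa> h c by auto
      show "lipschitz (\<sigma> j)" if "j \<le> d" for j by (rule lip[OF that])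
      show "(\<integral>\<^sup>+ \<xi>. ennreal (lyapunov r m \<kappa> (diffusion_step \<sigma> r j (sqrt h * \<xi>) s)) \<partial>std_gauss) \<le> ennreal (c * lyapunov r m \<kappa> s)"
        if "j \<in> {1..d}" "0 \<le> fst s" for j s
        using D(2)[OF _ h(2) that(2) est[OF that(1)]] h(1) by (simp add: diffusion_step_def \<kappa>_def c_def)
      show "lyapunov r m \<kappa> (drift_step \<sigma> r h s) \<le> c * lyapunov r m \<kappa> s" if "0 \<le> fst s" for s
      proof -
        \<comment> \<open>The drift substep ignores \<xi>, so the Gaussian integral of the constant
          is the constant itself.\<close>
        interpret sg: prob_space std_gauss by (rule prob_space_normal_density) simp
        have "ennreal (lyapunov r m \<kappa> (drift_step \<sigma> r h s)) \<le> ennreal (c * lyapunov r m \<kappa> s)"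
          using D(2)[OF _ h(2) that est0] h(1) sg.emeasure_space_1 by (simp add: drift_step_def \<kappa>_def c_def)
        moreover have "0 \<le> c * lyapunov r m \<kappa> s"
          using \<kappa> c by (cases s) (auto intro!: mult_nonneg_nonneg lyapunov_ge(4))
        ultimately show ?thesis by (simp add: ennreal_le_iff)
      qed
    qed
    define S where "S \<omega> = nv_state \<sigma> d r T N x0 (\<lambda>j t. W j t \<omega>) (\<lambda>k. \<eta> k \<omega>) N" for \<omega>
    \<comment> \<open>The initial Lyapunov value. It is also the scale of the final interpolation:
      the expectation of a^2/B is at most 4 A, independently of N and x0.\<close>
    define B where "B = \<kappa> * (1 + norm x0 ^ (2 * m))"
    have B: "0 < B" unfolding B_def using \<kappa> by (intro mult_pos_pos add_pos_nonneg) auto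
    have B_eq: "nv.\<Lambda> (0, x0, x0) = B" using r by (simp add: lyapunov_def B_def power_0_left)
    have cA: "c ^ ((d + 2) * N) \<le> A"
    proof -
      have "c ^ ((d + 2) * N) \<le> exp (D * h) ^ ((d + 2) * N)"
        using c exp_ge_add_one_self[of "D * h"] by (intro power_mono) (auto simp: c_def)
      also have "\<dots> = exp (real ((d + 2) * N) * (D * h))" by (rule exp_of_nat_mult[symmetric])
      also have "real ((d + 2) * N) * (D * h) = D * T * real (d + 2)" using N by (simp add: h_def field_simps)
      finally show ?thesis by (simp add: A_def)
    qed
    have "(\<integral>\<^sup>+ \<omega>. ennreal (nv.\<Lambda> (S \<omega>)) \<partial>M) \<le> ennreal (c ^ ((d + 2) * N) * B)"
      unfolding S_def B_eq[symmetric] by (rule nv.nv_state_integral[OF BM d_pos N h_def indep])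
    also have "\<dots> \<le> ennreal (A * B)" using cA B by (intro ennreal_leI mult_right_mono) auto
    finally have I: "(\<integral>\<^sup>+ \<omega>. ennreal (nv.\<Lambda> (S \<omega>)) \<partial>M) \<le> ennreal (A * B)" .
    define s where "s = p / (2 * real r)"
    have s: "0 \<le> s" "s \<le> 1" using p pr by (simp_all add: s_def)
    have mS: "S \<in> borel_measurable M"
      unfolding S_def
    proof (intro measurable_nv_state lip)
      show "W j (real i * T / real N) \<in> borel_measurable M" if "j \<in> {1..d}" for i j
        using BM that T0 unfolding brownian_motion_def by auto
      show "\<eta> i \<in> borel_measurable M" if "1 \<le> i" for i
        using rad that unfolding rademacher_seq_def indep_vars_def by auto
    qed
    have "(\<integral>\<^sup>+ \<omega>. ennreal (Max ((\<lambda>k. norm (nv_scheme \<sigma> d T N W \<eta> x0 \<omega> k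
        - nv_hat_scheme \<sigma> d T N W \<eta> x0 \<omega> k) powr (2 * p)) ` {0..N})) \<partial>M)
      \<le> (\<integral>\<^sup>+ \<omega>. ennreal (B powr s) + ennreal (4 * B powr s / B) * ennreal (nv.\<Lambda> (S \<omega>)) \<partial>M)"
    proof (rule nn_integral_mono_AE)
      show "AE \<omega> in M. ennreal (Max ((\<lambda>k. norm (nv_scheme \<sigma> d T N W \<eta> x0 \<omega> k
        - nv_hat_scheme \<sigma> d T N W \<eta> x0 \<omega> k) powr (2 * p)) ` {0..N}))
        \<le> ennreal (B powr s) + ennreal (4 * B powr s / B) * ennreal (nv.\<Lambda> (S \<omega>))"
        using rademacher_AE[OF rad]
      proof eventually_elim
        case (elim \<omega>)
        define a where "a = fst (S \<omega>)"
        have a: "a\<^sup>2 \<le> 4 * nv.\<Lambda> (S \<omega>)"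
          using lyapunov_ge(1)[of \<kappa> a r m "fst (snd (S \<omega>))" "snd (snd (S \<omega>))"] \<kappa> by (simp add: a_def)
        have "norm (nv_scheme \<sigma> d T N W \<eta> x0 \<omega> k - nv_hat_scheme \<sigma> d T N W \<eta> x0 \<omega> k) powr (2 * p)
            \<le> B powr s * (1 + 4 * nv.\<Lambda> (S \<omega>) / B)" if "k \<in> {0..N}" for k
        proof -
          have "norm (nv_scheme \<sigma> d T N W \<eta> x0 \<omega> k - nv_hat_scheme \<sigma> d T N W \<eta> x0 \<omega> k) ^ (2 * r) \<le> a"
            using nv_state_max[OF r, of k N \<sigma> d T N x0 "\<lambda>j t. W j t \<omega>" "\<lambda>k. \<eta> k \<omega>"] that
            by (simp add: nv_state_schemes[where r = r and \<eta> = \<eta> and \<omega> = \<omega>, OF elim[rule_format]] a_def S_def)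
          then have "norm (nv_scheme \<sigma> d T N W \<eta> x0 \<omega> k - nv_hat_scheme \<sigma> d T N W \<eta> x0 \<omega> k) powr (2 * p)
              \<le> B powr s * (1 + a\<^sup>2 / B)"
            unfolding s_def using p pr B r by (intro powr_le_by_scale) auto
          also have "\<dots> \<le> B powr s * (1 + 4 * nv.\<Lambda> (S \<omega>) / B)"
            using a B by (intro mult_left_mono add_left_mono divide_right_mono) auto
          finally show ?thesis .
        qed
        then have "Max ((\<lambda>k. norm (nv_scheme \<sigma> d T N W \<eta> x0 \<omega> k
            - nv_hat_scheme \<sigma> d T N W \<eta> x0 \<omega> k) powr (2 * p)) ` {0..N}) \<le> B powr s * (1 + 4 * nv.\<Lambda> (S \<omega>) / B)"
          by (subst Max_le_iff) auto
        also have "\<dots> = B powr s + 4 * B powr s / B * nv.\<Lambda> (S \<omega>)" by (simp add: algebra_simps)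
        finally show ?case using nv.\<Lambda>_nonneg B
          by (simp add: ennreal_mult[symmetric] ennreal_plus[symmetric] ennreal_leI del: ennreal_plus)
      qed
    qed
    also have "\<dots> = ennreal (B powr s) + ennreal (4 * B powr s / B) * (\<integral>\<^sup>+ \<omega>. ennreal (nv.\<Lambda> (S \<omega>)) \<partial>M)"
      using nv.measurable_\<Lambda>[OF mS] by (simp add: nn_integral_add nn_integral_cmult emeasure_space_1)
    also have "\<dots> \<le> ennreal (B powr s) + ennreal (4 * B powr s / B) * ennreal (A * B)"
      by (intro add_left_mono mult_left_mono I) auto
    also have "\<dots> = ennreal (B powr s + 4 * B powr s / B * (A * B))"
      using B by (simp add: ennreal_mult[symmetric] ennreal_plus[symmetric] A_def del: ennreal_plus)
    also have "\<dots> = ennreal (B powr s * (1 + 4 * A))" using B by (simp add: field_simps)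
    also have "\<dots> \<le> ennreal (C' / real N powr (4 * p) * (1 + norm x0 ^ (2 * m)))"
    proof (rule ennreal_leI)
      \<comment> \<open>The exponents fit: h^(8r) to the power p/(2r) is h^(4p), the asserted rate.
        The moment factor is at least 1, so its power s \<le> 1 is at most the factor
        itself.\<close>
      have "\<kappa> powr s = (h powr real (8 * r)) powr s" using h by (simp only: \<kappa>_def powr_realpow)
      also have "\<dots> = h powr (real (8 * r) * s)" by (rule powr_powr)
      also have "real (8 * r) * s = 4 * p" using r by (simp add: s_def)
      finally have "\<kappa> powr s = T powr (4 * p) / real N powr (4 * p)"
        unfolding h_def using T_pos N by (simp add: powr_divide)
      moreover have "(1 + norm x0 ^ (2 * m)) powr s \<le> (1 + norm x0 ^ (2 * m)) powr 1"
        using s by (intro powr_mono) auto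
      moreover have "B powr s = \<kappa> powr s * (1 + norm x0 ^ (2 * m)) powr s"
        unfolding B_def using \<kappa> by (intro powr_mult)
      ultimately have "B powr s \<le> T powr (4 * p) / real N powr (4 * p) * (1 + norm x0 ^ (2 * m))"
        by (simp only: powr_one_gt_zero_iff) (intro mult_left_mono, simp_all)
      then have "B powr s * (1 + 4 * A) \<le> T powr (4 * p) / real N powr (4 * p) * (1 + norm x0 ^ (2 * m)) * (1 + 4 * A)"
        by (rule mult_right_mono) (simp add: A_def)
      then show "B powr s * (1 + 4 * A) \<le> C' / real N powr (4 * p) * (1 + norm x0 ^ (2 * m))"
        by (simp add: C'_def mult_ac)
    qed
    finally show ?thesis .
  qed
  show "\<exists>C>0. \<exists>q::nat. q \<ge> 1 \<and>
           (\<forall>N::nat. N \<ge> 1 \<longrightarrow> (\<forall>x0 :: real ^ 'n.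
              (\<integral>\<^sup>+ \<omega>. ennreal (Max ((\<lambda>k. norm (nv_scheme \<sigma> d T N W \<eta> x0 \<omega> k
                                               - nv_hat_scheme \<sigma> d T N W \<eta> x0 \<omega> k) powr (2 * p)) ` {0..N})) \<partial>M)
              \<le> ennreal (C / real N powr (4 * p) * (1 + norm x0 ^ (2 * q)))))"
    using C' m main by blast
qed

end
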